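(* Let $R$ be an algebra over a commutative ring $k$ and let $(A,C,\psi)$ be a bijective entwining structure over $R$ such that the $R$-coring $C$ possesses a grouplike element $e$. Denote the corresponding right $C$-coaction on $A$ by $a_{\langle0\rangle}\otimes_R a_{\langle1\rangle}:=\psi(e\otimes_R a)$ and the subring of its coinvariants by $B$. Assume that $C$ is flat as a left (respectively right) $R$-module and projective as a right (respectively left) $C$-comodule. (1) Suppose that $(A\otimes_kA)^{coC}=A\otimes_kB$ and that the canonical map $$\mathrm{can}:A\otimes_BA\to A\otimes_RC,\qquad a\otimes_Ba'\mapsto aa'_{\langle0\rangle}\otimes_Ra'_{\langle1\rangle}$$ is surjective. Then $\mathrm{can}$ is bijective. (2) If $\mathrm{can}$ is bijective then $A$ is projective as a right (respectively left) $B$-module.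
   Context: $k$ is a commutative ring; "algebra" means associative unital $k$-algebra. For an algebra $R$, an $R$-ring is a monoid and an $R$-coring is a comonoid in the monoidal category of $R$-$R$ bimodules. An entwining structure over $R$ is a triple $(A,C,\psi)$ where $A=(A,\mu,\eta)$ is an $R$-ring, $C=(C,\Delta,\epsilon)$ is an $R$-coring and $\psi:C\otimes_RA\to A\otimes_RC$ is an $R$-$R$ bimodule map with $\psi\circ(C\otimes_R\eta)=\eta\otimes_RC$, $(A\otimes_R\epsilon)\circ\psi=\epsilon\otimes_RA$, $(\mu\otimes_RC)\circ(A\otimes_R\psi)\circ(\psi\otimes_RA)=\psi\circ(C\otimes_R\mu)$ and $(A\otimes_R\Delta)\circ\psi=(\psi\otimes_RC)\circ(C\otimes_R\psi)\circ(\Delta\otimes_RA)$. It is bijective if $\psi$ is an isomorphism. A right entwined module is a right $A$-module $M$ (hence a right $R$-module) with a right $C$-comodule structure $\tau:M\to M\otimes_RC$, $\tau(m)=m_{\langle0\rangle}\otimes_R m_{\langle1\rangle}$, such that $\tau(m\cdot a)=m_{\langle0\rangle}\cdot\psi(m_{\langle1\rangle}\otimes_Ra)$ (here $A$ acts on the first leg of $\psi(m_{\langle 1\rangle}\otimes_R a)\in A\otimes_R C$). A grouplike element $e\in C$ satisfies $\Delta(e)=e\otimes_Re$, $\epsilon(e)=1_R$. The coinvariants of an entwined module $M$ are $M^{coC}=\{m\in M:\tau(m)=m\otimes_Re\}$. With the right regular $A$-action and the coaction $a\mapsto\psi(e\otimes_Ra)$, $A$ is an entwined module, and $B=A^{coC}=\{b\in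 A:\psi(e\otimes_Rb)=b\otimes_Re\}$. For an entwined module $M$ and a $k$-module $V$, $V\otimes_kM$ is an entwined module via the second tensor factor; in particular $A\otimes_kA$ is. The condition $(A\otimes_kA)^{coC}=A\otimes_kB$ means that the natural map $A\otimes_kB\to(A\otimes_kA)^{coC}$ is bijective. "Projective as a right (left) $C$-comodule" means projective as an object of the category of right (left) $C$-comodules. *)

theory Defs
  imports "HOL-Algebra.Free_Abelian_Groups" "HOL-Algebra.Module"
begin

section \<open>Algebras, one-sided modules and bimodules\<close>

text \<open>
  The library's locale \<^locale>\<open>algebra\<close> is restricted to commutative algebras.
\<close>

locale unital_algebra = module k R + ring R for k (structure) and R (structure) +
  assumes smult_mult_left:
      "\<And>l x y. \<lbrakk>l \<in> carrier k; x \<in> carrier R; y \<in> carrier R\<rbrakk>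
        \<Longrightarrow> l \<odot>\<^bsub>R\<^esub> (x \<otimes>\<^bsub>R\<^esub> y) = (l \<odot>\<^bsub>R\<^esub> x) \<otimes>\<^bsub>R\<^esub> y"
    and smult_mult_right:
      "\<And>l x y. \<lbrakk>l \<in> carrier k; x \<in> carrier R; y \<in> carrier R\<rbrakk>
        \<Longrightarrow> l \<odot>\<^bsub>R\<^esub> (x \<otimes>\<^bsub>R\<^esub> y) = x \<otimes>\<^bsub>R\<^esub> (l \<odot>\<^bsub>R\<^esub> y)"

text \<open>
  As in the library's record \<^type>\<open>module\<close>, the multiplicative fields inherited from
  \<^type>\<open>ring\<close> carry no meaning for a module.  A one-sided module uses the same record; the
  action on the other side is then arbitrary and is ignored by all definitions.
\<close>

record ('s, 'm, 't) bimod = "'m ring" +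
  lact :: "'s \<Rightarrow> 'm \<Rightarrow> 'm"
  ract :: "'m \<Rightarrow> 't \<Rightarrow> 'm"

locale left_module = ring S + M: abelian_group M
  for S :: "('s, 'x) ring_scheme" (structure) and M :: "('s, 'm, 't) bimod" (structure) +
  assumes lact_closed: "\<And>s m. \<lbrakk>s \<in> carrier S; m \<in> carrier M\<rbrakk> \<Longrightarrow> lact M s m \<in> carrier M"
    and lact_add_left: "\<And>s s' m. \<lbrakk>s \<in> carrier S; s' \<in> carrier S; m \<in> carrier M\<rbrakk>
      \<Longrightarrow> lact M (s \<oplus>\<^bsub>S\<^esub> s') m = lact M s m \<oplus>\<^bsub>M\<^esub> lact M s' m"
    and lact_add_right: "\<And>s m m'. \<lbrakk>s \<in> carrier S; m \<in> carrier M; m' \<in> carrier M\<rbrakk>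
      \<Longrightarrow> lact M s (m \<oplus>\<^bsub>M\<^esub> m') = lact M s m \<oplus>\<^bsub>M\<^esub> lact M s m'"
    and lact_mult: "\<And>s s' m. \<lbrakk>s \<in> carrier S; s' \<in> carrier S; m \<in> carrier M\<rbrakk>
      \<Longrightarrow> lact M (s \<otimes>\<^bsub>S\<^esub> s') m = lact M s (lact M s' m)"
    and lact_one: "\<And>m. m \<in> carrier M \<Longrightarrow> lact M \<one>\<^bsub>S\<^esub> m = m"

locale right_module = ring S + M: abelian_group M
  for S :: "('t, 'x) ring_scheme" (structure) and M :: "('s, 'm, 't) bimod" (structure) +
  assumes ract_closed: "\<And>s m. \<lbrakk>s \<in> carrier S; m \<in> carrier M\<rbrakk> \<Longrightarrow> ract M m s \<in> carrier M"
    and ract_add_right: "\<And>s s' m. \<lbrakk>s \<in> carrier S; s' \<in> carrier S; m \<in> carrier M\<rbrakk>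
      \<Longrightarrow> ract M m (s \<oplus>\<^bsub>S\<^esub> s') = ract M m s \<oplus>\<^bsub>M\<^esub> ract M m s'"
    and ract_add_left: "\<And>s m m'. \<lbrakk>s \<in> carrier S; m \<in> carrier M; m' \<in> carrier M\<rbrakk>
      \<Longrightarrow> ract M (m \<oplus>\<^bsub>M\<^esub> m') s = ract M m s \<oplus>\<^bsub>M\<^esub> ract M m' s"
    and ract_mult: "\<And>s s' m. \<lbrakk>s \<in> carrier S; s' \<in> carrier S; m \<in> carrier M\<rbrakk>
      \<Longrightarrow> ract M m (s \<otimes>\<^bsub>S\<^esub> s') = ract M (ract M m s) s'"
    and ract_one: "\<And>m. m \<in> carrier M \<Longrightarrow> ract M m \<one>\<^bsub>S\<^esub> = m"

definition left_linear ::
    "('s, 'x) ring_scheme \<Rightarrow> ('s, 'm, 't) bimod \<Rightarrow> ('s, 'n, 'v) bimod \<Rightarrow> ('m \<Rightarrow> 'n) \<Rightarrow> bool" where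
  "left_linear S M N f \<longleftrightarrow>
     f \<in> carrier M \<rightarrow> carrier N \<and>
     (\<forall>m\<in>carrier M. \<forall>m'\<in>carrier M. f (m \<oplus>\<^bsub>M\<^esub> m') = f m \<oplus>\<^bsub>N\<^esub> f m') \<and>
     (\<forall>s\<in>carrier S. \<forall>m\<in>carrier M. f (lact M s m) = lact N s (f m))"

definition right_linear ::
    "('t, 'x) ring_scheme \<Rightarrow> ('s, 'm, 't) bimod \<Rightarrow> ('v, 'n, 't) bimod \<Rightarrow> ('m \<Rightarrow> 'n) \<Rightarrow> bool" where
  "right_linear S M N f \<longleftrightarrow>
     f \<in> carrier M \<rightarrow> carrier N \<and>
     (\<forall>m\<in>carrier M. \<forall>m'\<in>carrier M. f (m \<oplus>\<^bsub>M\<^esub> m') = f m \<oplus>\<^bsub>N\<^esub> f m') \<and>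
     (\<forall>s\<in>carrier S. \<forall>m\<in>carrier M. f (ract M m s) = ract N (f m) s)"

definition bilinear ::
    "('r, 'x) ring_scheme \<Rightarrow> ('r, 'm, 'r) bimod \<Rightarrow> ('r, 'n, 'r) bimod \<Rightarrow> ('m \<Rightarrow> 'n) \<Rightarrow> bool" where
  "bilinear R M N f \<longleftrightarrow> left_linear R M N f \<and> right_linear R M N f"

text \<open>
  Since R is an algebra over k, the two k-actions on an R-R bimodule induced by the two
  R-actions are required to agree.
\<close>

definition algmap :: "('k, 'r) module \<Rightarrow> 'k \<Rightarrow> 'r" where
  "algmap R l = l \<odot>\<^bsub>R\<^esub> \<one>\<^bsub>R\<^esub>"

locale bimodule =
  left_module R M + right_module R M
  for k :: "('k, 'x) ring_scheme" and R :: "('k, 'r) module" and M :: "('r, 'm, 'r) bimod" +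
  assumes lact_ract: "\<And>r s m. \<lbrakk>r \<in> carrier R; s \<in> carrier R; m \<in> carrier M\<rbrakk>
      \<Longrightarrow> ract M (lact M r m) s = lact M r (ract M m s)"
    and central: "\<And>l m. \<lbrakk>l \<in> carrier k; m \<in> carrier M\<rbrakk>
      \<Longrightarrow> lact M (algmap R l) m = ract M m (algmap R l)"

definition regular :: "('r, 'x) ring_scheme \<Rightarrow> ('r, 'r, 'r) bimod" where
  "regular S = \<lparr>carrier = carrier S, mult = mult S, one = one S, zero = zero S, add = add S,
     lact = mult S, ract = mult S\<rparr>"

definition restrict_scalars ::
    "('s' \<Rightarrow> 's) \<Rightarrow> ('t' \<Rightarrow> 't) \<Rightarrow> ('s, 'm, 't) bimod \<Rightarrow> ('s', 'm, 't') bimod" where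
  "restrict_scalars f g M =
     \<lparr>carrier = carrier M, mult = mult M, one = one M, zero = zero M, add = add M,
      lact = (\<lambda>s. lact M (f s)), ract = (\<lambda>m t. ract M m (g t))\<rparr>"


section \<open>Tensor products over a noncommutative ring\<close>

text \<open>
  The tensor product is the free abelian group on the product of the carriers modulo the
  subgroup generated by the biadditivity and balancing relations; its elements are cosets.
\<close>

definition tens_rels ::
    "('s, 'm, 't) bimod \<Rightarrow> ('t, 'x) ring_scheme \<Rightarrow> ('t, 'n, 'v) bimod \<Rightarrow> (('m \<times> 'n) \<Rightarrow>\<^sub>0 int) set" where
  "tens_rels M S N =
     {frag_of (m \<oplus>\<^bsub>M\<^esub> m', n) - frag_of (m, n) - frag_of (m', n) | m m' n.
        m \<in> carrier M \<and> m' \<in> carrier M \<and> n \<in> carrier N} \<union>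
     {frag_of (m, n \<oplus>\<^bsub>N\<^esub> n') - frag_of (m, n) - frag_of (m, n') | m n n'.
        m \<in> carrier M \<and> n \<in> carrier N \<and> n' \<in> carrier N} \<union>
     {frag_of (ract M m s, n) - frag_of (m, lact N s n) | m s n.
        m \<in> carrier M \<and> s \<in> carrier S \<and> n \<in> carrier N}"

abbreviation tens_free :: "('s, 'm, 't) bimod \<Rightarrow> ('t, 'n, 'v) bimod \<Rightarrow> (('m \<times> 'n) \<Rightarrow>\<^sub>0 int) monoid" where
  "tens_free M N \<equiv> free_Abelian_group (carrier M \<times> carrier N)"

definition tens_kernel ::
    "('s, 'm, 't) bimod \<Rightarrow> ('t, 'x) ring_scheme \<Rightarrow> ('t, 'n, 'v) bimod \<Rightarrow> (('m \<times> 'n) \<Rightarrow>\<^sub>0 int) set" where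
  "tens_kernel M S N = generate (tens_free M N) (tens_rels M S N)"

definition tens_group ::
    "('s, 'm, 't) bimod \<Rightarrow> ('t, 'x) ring_scheme \<Rightarrow> ('t, 'n, 'v) bimod \<Rightarrow> (('m \<times> 'n) \<Rightarrow>\<^sub>0 int) set monoid" where
  "tens_group M S N = tens_free M N Mod tens_kernel M S N"

definition pure_tens ::
    "('s, 'm, 't) bimod \<Rightarrow> ('t, 'x) ring_scheme \<Rightarrow> ('t, 'n, 'v) bimod \<Rightarrow> 'm \<Rightarrow> 'n \<Rightarrow> (('m \<times> 'n) \<Rightarrow>\<^sub>0 int) set" where
  "pure_tens M S N m n = tens_kernel M S N #>\<^bsub>tens_free M N\<^esub> frag_of (m, n)"

text \<open>
  \<open>tens_lift G \<beta>\<close> is the additive map into \<open>G\<close> induced by a balanced map \<open>\<beta>\<close>: a coset is sent to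
  the common value of \<open>\<beta>\<close>, extended linearly, on its representatives.
\<close>

definition tens_lift ::
    "('g, 'z) ring_scheme \<Rightarrow> ('m \<Rightarrow> 'n \<Rightarrow> 'g) \<Rightarrow> (('m \<times> 'n) \<Rightarrow>\<^sub>0 int) set \<Rightarrow> 'g" where
  "tens_lift G \<beta> U = the_elem
     ((\<lambda>u. \<Oplus>\<^bsub>G\<^esub>p\<in>Poly_Mapping.keys u. [Poly_Mapping.lookup u p] \<cdot>\<^bsub>G\<^esub> \<beta> (fst p) (snd p)) ` U)"

definition tens_ring ::
    "('s, 'm, 't) bimod \<Rightarrow> ('t, 'x) ring_scheme \<Rightarrow> ('t, 'n, 'v) bimod \<Rightarrow> (('m \<times> 'n) \<Rightarrow>\<^sub>0 int) set ring" where
  "tens_ring M S N =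
     \<lparr>carrier = carrier (tens_group M S N), mult = undefined, one = undefined,
      zero = one (tens_group M S N), add = mult (tens_group M S N)\<rparr>"

definition tens ::
    "('s, 'm, 't) bimod \<Rightarrow> ('t, 'x) ring_scheme \<Rightarrow> ('t, 'n, 'v) bimod \<Rightarrow>
     ('s, (('m \<times> 'n) \<Rightarrow>\<^sub>0 int) set, 'v) bimod"
    (\<open>(_ \<boxtimes>\<^bsub>_\<^esub>/ _)\<close> [71, 0, 70] 70) where
  "M \<boxtimes>\<^bsub>S\<^esub> N = ring.extend (tens_ring M S N)
     (bimod.fields
        (\<lambda>s. tens_lift (tens_ring M S N) (\<lambda>m n. pure_tens M S N (lact M s m) n))
        (\<lambda>w t. tens_lift (tens_ring M S N) (\<lambda>m n. pure_tens M S N m (ract N n t)) w))"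

text \<open>
  \<open>f \<otimes> g\<close>.  Only the target modules \<open>M\<close> and \<open>N\<close> need to be given.
\<close>

definition tens_map ::
    "('s, 'm, 't) bimod \<Rightarrow> ('t, 'x) ring_scheme \<Rightarrow> ('t, 'n, 'v) bimod \<Rightarrow>
     ('m' \<Rightarrow> 'm) \<Rightarrow> ('n' \<Rightarrow> 'n) \<Rightarrow> (('m' \<times> 'n') \<Rightarrow>\<^sub>0 int) set \<Rightarrow> (('m \<times> 'n) \<Rightarrow>\<^sub>0 int) set" where
  "tens_map M S N f g = tens_lift (M \<boxtimes>\<^bsub>S\<^esub> N) (\<lambda>m n. pure_tens M S N (f m) (g n))"

text \<open>The associativity constraint, its inverse, and the unit constraints.\<close>

definition assoc where
  "assoc X S Y T Z =
     tens_lift (X \<boxtimes>\<^bsub>S\<^esub> (Y \<boxtimes>\<^bsub>T\<^esub> Z)) (\<lambda>w z.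
       tens_lift (X \<boxtimes>\<^bsub>S\<^esub> (Y \<boxtimes>\<^bsub>T\<^esub> Z)) (\<lambda>x y.
         pure_tens X S (Y \<boxtimes>\<^bsub>T\<^esub> Z) x (pure_tens Y T Z y z)) w)"

definition assoc_inv where
  "assoc_inv X S Y T Z =
     tens_lift ((X \<boxtimes>\<^bsub>S\<^esub> Y) \<boxtimes>\<^bsub>T\<^esub> Z) (\<lambda>x w.
       tens_lift ((X \<boxtimes>\<^bsub>S\<^esub> Y) \<boxtimes>\<^bsub>T\<^esub> Z) (\<lambda>y z.
         pure_tens (X \<boxtimes>\<^bsub>S\<^esub> Y) T Z (pure_tens X S Y x y) z) w)"

definition lunit :: "('s, 'm, 't) bimod \<Rightarrow> (('s \<times> 'm) \<Rightarrow>\<^sub>0 int) set \<Rightarrow> 'm" where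
  "lunit M = tens_lift M (\<lambda>s m. lact M s m)"

definition runit :: "('s, 'm, 't) bimod \<Rightarrow> (('m \<times> 't) \<Rightarrow>\<^sub>0 int) set \<Rightarrow> 'm" where
  "runit M = tens_lift M (\<lambda>m t. ract M m t)"


section \<open>Ring and coring objects in bimodules, entwining structures\<close>

text \<open>Monoids in the monoidal category of R-R bimodules.\<close>

locale ring_over = bimodule k R A
  for k :: "('k, 'x) ring_scheme" and R :: "('k, 'r) module" and A :: "('r, 'a, 'r) bimod" +
  fixes \<mu> :: "(('a \<times> 'a) \<Rightarrow>\<^sub>0 int) set \<Rightarrow> 'a" and \<eta> :: "'r \<Rightarrow> 'a"
  assumes mu_bilinear: "bilinear R (A \<boxtimes>\<^bsub>R\<^esub> A) A \<mu>"
    and eta_bilinear: "bilinear R (regular R) A \<eta>"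
    and mu_assoc: "\<And>t. t \<in> carrier ((A \<boxtimes>\<^bsub>R\<^esub> A) \<boxtimes>\<^bsub>R\<^esub> A) \<Longrightarrow>
      \<mu> (tens_map A R A \<mu> id t) = \<mu> (tens_map A R A id \<mu> (assoc A R A R A t))"
    and mu_unit_left: "\<And>t. t \<in> carrier (regular R \<boxtimes>\<^bsub>R\<^esub> A) \<Longrightarrow> \<mu> (tens_map A R A \<eta> id t) = lunit A t"
    and mu_unit_right: "\<And>t. t \<in> carrier (A \<boxtimes>\<^bsub>R\<^esub> regular R) \<Longrightarrow> \<mu> (tens_map A R A id \<eta> t) = runit A t"

text \<open>Comonoids in the monoidal category of R-R bimodules.\<close>

locale coring_over = bimodule k R C
  for k :: "('k, 'x) ring_scheme" and R :: "('k, 'r) module" and C :: "('r, 'c, 'r) bimod" +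
  fixes \<Delta> :: "'c \<Rightarrow> (('c \<times> 'c) \<Rightarrow>\<^sub>0 int) set" and \<epsilon> :: "'c \<Rightarrow> 'r"
  assumes Delta_bilinear: "bilinear R C (C \<boxtimes>\<^bsub>R\<^esub> C) \<Delta>"
    and eps_bilinear: "bilinear R C (regular R) \<epsilon>"
    and Delta_coassoc: "\<And>c. c \<in> carrier C \<Longrightarrow>
      assoc C R C R C (tens_map (C \<boxtimes>\<^bsub>R\<^esub> C) R C \<Delta> id (\<Delta> c)) = tens_map C R (C \<boxtimes>\<^bsub>R\<^esub> C) id \<Delta> (\<Delta> c)"
    and counit_left: "\<And>c. c \<in> carrier C \<Longrightarrow> lunit C (tens_map (regular R) R C \<epsilon> id (\<Delta> c)) = c"
    and counit_right: "\<And>c. c \<in> carrier C \<Longrightarrow> runit C (tens_map C R (regular R) id \<epsilon> (\<Delta> c)) = c"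

text \<open>
  In \<open>psi_unit\<close> the carrier of \<open>C\<close> is identified with \<open>C \<boxtimes> R\<close> and \<open>R \<boxtimes> C\<close> by \<open>c \<mapsto> c \<otimes> 1\<close> and
  \<open>c \<mapsto> 1 \<otimes> c\<close>.
\<close>

locale entwining_structure = A: ring_over k R A \<mu> \<eta> + C: coring_over k R C \<Delta> \<epsilon>
  for k :: "('k, 'x) ring_scheme" and R :: "('k, 'r) module"
    and A :: "('r, 'a, 'r) bimod" and \<mu> :: "(('a \<times> 'a) \<Rightarrow>\<^sub>0 int) set \<Rightarrow> 'a" and \<eta> :: "'r \<Rightarrow> 'a"
    and C :: "('r, 'c, 'r) bimod" and \<Delta> :: "'c \<Rightarrow> (('c \<times> 'c) \<Rightarrow>\<^sub>0 int) set" and \<epsilon> :: "'c \<Rightarrow> 'r" +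
  fixes \<psi> :: "(('c \<times> 'a) \<Rightarrow>\<^sub>0 int) set \<Rightarrow> (('a \<times> 'c) \<Rightarrow>\<^sub>0 int) set"
  assumes psi_bilinear: "bilinear R (C \<boxtimes>\<^bsub>R\<^esub> A) (A \<boxtimes>\<^bsub>R\<^esub> C) \<psi>"
    and psi_unit: "\<And>c. c \<in> carrier C \<Longrightarrow>
      \<psi> (tens_map C R A id \<eta> (pure_tens C R (regular R) c \<one>\<^bsub>R\<^esub>)) =
      tens_map A R C \<eta> id (pure_tens (regular R) R C \<one>\<^bsub>R\<^esub> c)"
    and psi_counit: "\<And>t. t \<in> carrier (C \<boxtimes>\<^bsub>R\<^esub> A) \<Longrightarrow>
      runit A (tens_map A R (regular R) id \<epsilon> (\<psi> t)) = lunit A (tens_map (regular R) R A \<epsilon> id t)"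
    and psi_mu: "\<And>t. t \<in> carrier ((C \<boxtimes>\<^bsub>R\<^esub> A) \<boxtimes>\<^bsub>R\<^esub> A) \<Longrightarrow>
      tens_map A R C \<mu> id
        (assoc_inv A R A R C
          (tens_map A R (A \<boxtimes>\<^bsub>R\<^esub> C) id \<psi>
            (assoc A R C R A
              (tens_map (A \<boxtimes>\<^bsub>R\<^esub> C) R A \<psi> id t)))) =
      \<psi> (tens_map C R A id \<mu> (assoc C R A R A t))"
    and psi_Delta: "\<And>t. t \<in> carrier (C \<boxtimes>\<^bsub>R\<^esub> A) \<Longrightarrow>
      tens_map A R (C \<boxtimes>\<^bsub>R\<^esub> C) id \<Delta> (\<psi> t) =
      assoc A R C R C
        (tens_map (A \<boxtimes>\<^bsub>R\<^esub> C) R C \<psi> id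
          (assoc_inv C R A R C
            (tens_map C R (A \<boxtimes>\<^bsub>R\<^esub> C) id \<psi>
              (assoc C R C R A
                (tens_map (C \<boxtimes>\<^bsub>R\<^esub> C) R A \<Delta> id t)))))"

definition bijective_entwining where
  "bijective_entwining k R A \<mu> \<eta> C \<Delta> \<epsilon> \<psi> \<longleftrightarrow>
     entwining_structure k R A \<mu> \<eta> C \<Delta> \<epsilon> \<psi> \<and>
     bij_betw \<psi> (carrier (C \<boxtimes>\<^bsub>R\<^esub> A)) (carrier (A \<boxtimes>\<^bsub>R\<^esub> C))"

definition grouplike where
  "grouplike R C \<Delta> \<epsilon> e \<longleftrightarrow>
     e \<in> carrier C \<and> \<Delta> e = pure_tens C R C e e \<and> \<epsilon> e = \<one>\<^bsub>R\<^esub>"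

text \<open>The ring underlying an R-ring, with \<open>a a' = \<mu> (a \<otimes> a')\<close> and unit \<open>\<eta> 1\<close>.\<close>

definition ring_of ::
    "('k, 'r) module \<Rightarrow> ('r, 'a, 'r) bimod \<Rightarrow> ((('a \<times> 'a) \<Rightarrow>\<^sub>0 int) set \<Rightarrow> 'a) \<Rightarrow> ('r \<Rightarrow> 'a) \<Rightarrow>
     ('r, 'a, 'r) bimod" where
  "ring_of R A \<mu> \<eta> = A\<lparr>mult := (\<lambda>a a'. \<mu> (pure_tens A R A a a')), one := \<eta> \<one>\<^bsub>R\<^esub>\<rparr>"


section \<open>Comodules, flatness and projectivity\<close>

locale right_comodule = right_module R M
  for R :: "('k, 'r) module" and C :: "('r, 'c, 'r) bimod"
    and \<Delta> :: "'c \<Rightarrow> (('c \<times> 'c) \<Rightarrow>\<^sub>0 int) set" and \<epsilon> :: "'c \<Rightarrow> 'r"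
    and M :: "('s, 'm, 'r) bimod" and \<tau> :: "'m \<Rightarrow> (('m \<times> 'c) \<Rightarrow>\<^sub>0 int) set" +
  assumes coact_linear: "right_linear R M (M \<boxtimes>\<^bsub>R\<^esub> C) \<tau>"
    and coact_coassoc: "\<And>m. m \<in> carrier M \<Longrightarrow>
      assoc M R C R C (tens_map (M \<boxtimes>\<^bsub>R\<^esub> C) R C \<tau> id (\<tau> m)) = tens_map M R (C \<boxtimes>\<^bsub>R\<^esub> C) id \<Delta> (\<tau> m)"
    and coact_counit: "\<And>m. m \<in> carrier M \<Longrightarrow> runit M (tens_map M R (regular R) id \<epsilon> (\<tau> m)) = m"

locale left_comodule = left_module R M
  for R :: "('k, 'r) module" and C :: "('r, 'c, 'r) bimod"
    and \<Delta> :: "'c \<Rightarrow> (('c \<times> 'c) \<Rightarrow>\<^sub>0 int) set" and \<epsilon> :: "'c \<Rightarrow> 'r"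
    and M :: "('r, 'm, 's) bimod" and \<tau> :: "'m \<Rightarrow> (('c \<times> 'm) \<Rightarrow>\<^sub>0 int) set" +
  assumes coact_linear: "left_linear R M (C \<boxtimes>\<^bsub>R\<^esub> M) \<tau>"
    and coact_coassoc: "\<And>m. m \<in> carrier M \<Longrightarrow>
      assoc C R C R M (tens_map (C \<boxtimes>\<^bsub>R\<^esub> C) R M \<Delta> id (\<tau> m)) = tens_map C R (C \<boxtimes>\<^bsub>R\<^esub> M) id \<tau> (\<tau> m)"
    and coact_counit: "\<And>m. m \<in> carrier M \<Longrightarrow> lunit M (tens_map (regular R) R M \<epsilon> id (\<tau> m)) = m"

definition right_comodule_hom where
  "right_comodule_hom R C M \<tau> N \<sigma> f \<longleftrightarrow>
     right_linear R M N f \<and> (\<forall>m\<in>carrier M. \<sigma> (f m) = tens_map N R C f id (\<tau> m))"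

definition left_comodule_hom where
  "left_comodule_hom R C M \<tau> N \<sigma> f \<longleftrightarrow>
     left_linear R M N f \<and> (\<forall>m\<in>carrier M. \<sigma> (f m) = tens_map C R N id f (\<tau> m))"

text \<open>
  Quantification over all modules or comodules is rendered by quantification over those whose
  carrier is a subset of a type \<open>'u\<close>, passed as \<open>TYPE('u)\<close>.

  For a coring \<open>C\<close> over \<open>R\<close>, flat as a left \<open>R\<close>-module, every element of a right \<open>C\<close>-comodule lies in
  a subcomodule of cardinality at most the maximum of \<open>|R|\<close>, \<open>|C|\<close> and \<open>\<aleph>\<^sub>0\<close>, and cokernels of
  comodule maps can be formed on a set of representatives.  Consequently, as soon as \<open>'u\<close> has at
  least that cardinality, the epimorphisms below are the surjective comodule maps, and flatness
  of \<open>C\<close> and projectivity of the comodule \<open>C\<close> do not depend on the choice of \<open>'u\<close>.  The same holds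
  with left and right exchanged.
\<close>

definition flat_left_module ::
    "'u itself \<Rightarrow> ('s, 'x) ring_scheme \<Rightarrow> ('s, 'c, 't) bimod \<Rightarrow> bool" where
  "flat_left_module _ S C \<longleftrightarrow> left_module S C \<and>
     (\<forall>(M :: (unit, 'u, 's) bimod) (N :: (unit, 'u, 's) bimod) f.
        right_module S M \<longrightarrow> right_module S N \<longrightarrow> right_linear S M N f \<longrightarrow> inj_on f (carrier M) \<longrightarrow>
        inj_on (tens_map N S C f id) (carrier (M \<boxtimes>\<^bsub>S\<^esub> C)))"

definition flat_right_module ::
    "'u itself \<Rightarrow> ('t, 'x) ring_scheme \<Rightarrow> ('s, 'c, 't) bimod \<Rightarrow> bool" where
  "flat_right_module _ S C \<longleftrightarrow> right_module S C \<and>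
     (\<forall>(M :: ('t, 'u, unit) bimod) (N :: ('t, 'u, unit) bimod) f.
        left_module S M \<longrightarrow> left_module S N \<longrightarrow> left_linear S M N f \<longrightarrow> inj_on f (carrier M) \<longrightarrow>
        inj_on (tens_map C S N id f) (carrier (C \<boxtimes>\<^bsub>S\<^esub> M)))"

definition right_comodule_epi ::
    "('k, 'r) module \<Rightarrow> ('r, 'c, 'r) bimod \<Rightarrow> ('c \<Rightarrow> (('c \<times> 'c) \<Rightarrow>\<^sub>0 int) set) \<Rightarrow> ('c \<Rightarrow> 'r) \<Rightarrow>
     (unit, 'u, 'r) bimod \<Rightarrow> ('u \<Rightarrow> (('u \<times> 'c) \<Rightarrow>\<^sub>0 int) set) \<Rightarrow>
     (unit, 'u, 'r) bimod \<Rightarrow> ('u \<Rightarrow> (('u \<times> 'c) \<Rightarrow>\<^sub>0 int) set) \<Rightarrow> ('u \<Rightarrow> 'u) \<Rightarrow> bool" where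
  "right_comodule_epi R C \<Delta> \<epsilon> M \<tau> N \<sigma> p \<longleftrightarrow> right_comodule_hom R C M \<tau> N \<sigma> p \<and>
     (\<forall>(Q :: (unit, 'u, 'r) bimod) \<kappa> g h.
        right_comodule R C \<Delta> \<epsilon> Q \<kappa> \<longrightarrow>
        right_comodule_hom R C N \<sigma> Q \<kappa> g \<longrightarrow> right_comodule_hom R C N \<sigma> Q \<kappa> h \<longrightarrow>
        (\<forall>m\<in>carrier M. g (p m) = h (p m)) \<longrightarrow> (\<forall>n\<in>carrier N. g n = h n))"

definition left_comodule_epi ::
    "('k, 'r) module \<Rightarrow> ('r, 'c, 'r) bimod \<Rightarrow> ('c \<Rightarrow> (('c \<times> 'c) \<Rightarrow>\<^sub>0 int) set) \<Rightarrow> ('c \<Rightarrow> 'r) \<Rightarrow>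
     ('r, 'u, unit) bimod \<Rightarrow> ('u \<Rightarrow> (('c \<times> 'u) \<Rightarrow>\<^sub>0 int) set) \<Rightarrow>
     ('r, 'u, unit) bimod \<Rightarrow> ('u \<Rightarrow> (('c \<times> 'u) \<Rightarrow>\<^sub>0 int) set) \<Rightarrow> ('u \<Rightarrow> 'u) \<Rightarrow> bool" where
  "left_comodule_epi R C \<Delta> \<epsilon> M \<tau> N \<sigma> p \<longleftrightarrow> left_comodule_hom R C M \<tau> N \<sigma> p \<and>
     (\<forall>(Q :: ('r, 'u, unit) bimod) \<kappa> g h.
        left_comodule R C \<Delta> \<epsilon> Q \<kappa> \<longrightarrow>
        left_comodule_hom R C N \<sigma> Q \<kappa> g \<longrightarrow> left_comodule_hom R C N \<sigma> Q \<kappa> h \<longrightarrow>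
        (\<forall>m\<in>carrier M. g (p m) = h (p m)) \<longrightarrow> (\<forall>n\<in>carrier N. g n = h n))"

definition projective_right_comodule ::
    "'u itself \<Rightarrow> ('k, 'r) module \<Rightarrow> ('r, 'c, 'r) bimod \<Rightarrow> ('c \<Rightarrow> (('c \<times> 'c) \<Rightarrow>\<^sub>0 int) set) \<Rightarrow> ('c \<Rightarrow> 'r) \<Rightarrow>
     ('s, 'p, 'r) bimod \<Rightarrow> ('p \<Rightarrow> (('p \<times> 'c) \<Rightarrow>\<^sub>0 int) set) \<Rightarrow> bool" where
  "projective_right_comodule _ R C \<Delta> \<epsilon> P \<rho> \<longleftrightarrow> right_comodule R C \<Delta> \<epsilon> P \<rho> \<and>
     (\<forall>(M :: (unit, 'u, 'r) bimod) \<tau> (N :: (unit, 'u, 'r) bimod) \<sigma> p f.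
        right_comodule R C \<Delta> \<epsilon> M \<tau> \<longrightarrow> right_comodule R C \<Delta> \<epsilon> N \<sigma> \<longrightarrow>
        right_comodule_epi R C \<Delta> \<epsilon> M \<tau> N \<sigma> p \<longrightarrow> right_comodule_hom R C P \<rho> N \<sigma> f \<longrightarrow>
        (\<exists>g. right_comodule_hom R C P \<rho> M \<tau> g \<and> (\<forall>x\<in>carrier P. p (g x) = f x)))"

definition projective_left_comodule ::
    "'u itself \<Rightarrow> ('k, 'r) module \<Rightarrow> ('r, 'c, 'r) bimod \<Rightarrow> ('c \<Rightarrow> (('c \<times> 'c) \<Rightarrow>\<^sub>0 int) set) \<Rightarrow> ('c \<Rightarrow> 'r) \<Rightarrow>
     ('r, 'p, 's) bimod \<Rightarrow> ('p \<Rightarrow> (('c \<times> 'p) \<Rightarrow>\<^sub>0 int) set) \<Rightarrow> bool" where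
  "projective_left_comodule _ R C \<Delta> \<epsilon> P \<rho> \<longleftrightarrow> left_comodule R C \<Delta> \<epsilon> P \<rho> \<and>
     (\<forall>(M :: ('r, 'u, unit) bimod) \<tau> (N :: ('r, 'u, unit) bimod) \<sigma> p f.
        left_comodule R C \<Delta> \<epsilon> M \<tau> \<longrightarrow> left_comodule R C \<Delta> \<epsilon> N \<sigma> \<longrightarrow>
        left_comodule_epi R C \<Delta> \<epsilon> M \<tau> N \<sigma> p \<longrightarrow> left_comodule_hom R C P \<rho> N \<sigma> f \<longrightarrow>
        (\<exists>g. left_comodule_hom R C P \<rho> M \<tau> g \<and> (\<forall>x\<in>carrier P. p (g x) = f x)))"

definition projective_right_module ::
    "'u itself \<Rightarrow> ('t, 'x) ring_scheme \<Rightarrow> ('s, 'p, 't) bimod \<Rightarrow> bool" where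
  "projective_right_module _ S P \<longleftrightarrow> right_module S P \<and>
     (\<forall>(M :: (unit, 'u, 't) bimod) (N :: (unit, 'u, 't) bimod) p f.
        right_module S M \<longrightarrow> right_module S N \<longrightarrow>
        right_linear S M N p \<longrightarrow> p ` carrier M = carrier N \<longrightarrow> right_linear S P N f \<longrightarrow>
        (\<exists>g. right_linear S P M g \<and> (\<forall>x\<in>carrier P. p (g x) = f x)))"

definition projective_left_module ::
    "'u itself \<Rightarrow> ('t, 'x) ring_scheme \<Rightarrow> ('t, 'p, 's) bimod \<Rightarrow> bool" where
  "projective_left_module _ S P \<longleftrightarrow> left_module S P \<and>
     (\<forall>(M :: ('t, 'u, unit) bimod) (N :: ('t, 'u, unit) bimod) p f.
        left_module S M \<longrightarrow> left_module S N \<longrightarrow>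
        left_linear S M N p \<longrightarrow> p ` carrier M = carrier N \<longrightarrow> left_linear S P N f \<longrightarrow>
        (\<exists>g. left_linear S P M g \<and> (\<forall>x\<in>carrier P. p (g x) = f x)))"

text \<open>
  A type large enough to test flatness and projectivity of \<open>C\<close>.  The component \<open>'a\<close>, which is
  irrelevant for these notions by the above, gives room for entwined modules built from \<open>A\<close>.
\<close>

type_synonym ('r, 'a, 'c) test_type = "('r \<times> 'a \<times> 'c \<times> nat) list"


section \<open>Coinvariants and the canonical map\<close>

definition coinvariants where
  "coinvariants R C M \<tau> e = {m \<in> carrier M. \<tau> m = pure_tens M R C m e}"

definition regular_coaction where
  "regular_coaction R A C \<psi> e a = \<psi> (pure_tens C R A e a)"

definition coinvariant_ring where
  "coinvariant_ring R A \<mu> \<eta> C \<psi> e =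
     (ring_of R A \<mu> \<eta>)\<lparr>carrier := coinvariants R C A (regular_coaction R A C \<psi> e) e\<rparr>"

text \<open>
  The coaction on \<open>V \<otimes>\<^sub>k M\<close> induced by a coaction \<open>\<tau>\<close> on \<open>M\<close>, where \<open>M\<close> is regarded as a
  k-R bimodule.
\<close>

definition tensor_coaction where
  "tensor_coaction k R C V M \<tau> = assoc_inv V k M R C \<circ> tens_map V k (M \<boxtimes>\<^bsub>R\<^esub> C) id \<tau>"

text \<open>The R-R bimodule \<open>A\<close> as a k-k bimodule and as a k-R bimodule.\<close>

definition as_kk :: "('k, 'r) module \<Rightarrow> ('r, 'a, 'r) bimod \<Rightarrow> ('k, 'a, 'k) bimod" where
  "as_kk R A = restrict_scalars (algmap R) (algmap R) A"

definition as_kR :: "('k, 'r) module \<Rightarrow> ('r, 'a, 'r) bimod \<Rightarrow> ('k, 'a, 'r) bimod" where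
  "as_kR R A = restrict_scalars (algmap R) id A"

text \<open>\<open>(A \<otimes>\<^sub>k A)\<^sup>c\<^sup>o\<^sup>C = A \<otimes>\<^sub>k B\<close>: the map induced by the inclusion of \<open>B\<close> into \<open>A\<close> is bijective.\<close>

definition coinvariants_tensor_condition where
  "coinvariants_tensor_condition k R A C \<psi> e \<longleftrightarrow>
     bij_betw (tens_map (as_kk R A) k (as_kR R A) id id)
       (carrier (as_kk R A \<boxtimes>\<^bsub>k\<^esub>
          (as_kk R A)\<lparr>carrier := coinvariants R C A (regular_coaction R A C \<psi> e) e\<rparr>))
       (coinvariants R C (as_kk R A \<boxtimes>\<^bsub>k\<^esub> as_kR R A)
          (tensor_coaction k R C (as_kk R A) (as_kR R A) (regular_coaction R A C \<psi> e)) e)"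

definition can where
  "can R A \<mu> \<eta> C \<psi> e =
     tens_lift (A \<boxtimes>\<^bsub>R\<^esub> C)
       (\<lambda>a a'. tens_map A R C (\<lambda>x. a \<otimes>\<^bsub>ring_of R A \<mu> \<eta>\<^esub> x) id (regular_coaction R A C \<psi> e a'))"

end

(*
  If C is projective as a right comodule and can is surjective, then the maps
      A --> A (x) C,  a |--> x a_<0> (x) a_<1>   (x in A)
  define a comodule map from a direct sum of copies of A, indexed by A, onto A (x) C.  Hence
  c |--> 1 (x) c lifts to a family of comodule maps sigma_x : C --> A.  Put
  s_x = mu (sigma_x (x) A) psi^{-1} : A (x) C --> A and beta_x(a) = s_x(a (x) e).  Colinearity of
  sigma_x forces beta_x(a) to lie in B, and
      sum_x x beta_x(a) = a,    s_x(can(a (x) a')) = beta_x(a) a'.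
  The first identity is a dual basis of A as a right B-module; together with the second one it
  makes w |--> sum_x x (x)_B s_x(w) a left inverse of can.  If C is projective as a left comodule,
  one uses the left coaction a |--> psi^{-1}(a (x) e) of A, s_x = mu (A (x) sigma_x) and
  beta_x(a) = s_x(psi(e (x) a)) instead.

  Projectivity of C is only given for comodules on the test type, so the direct sum and A (x) C
  are transported along injections into that type.
*)

theory Submission
  imports Defs
begin

section \<open>Additive maps between abelian groups and finitely supported sums\<close>

section \<open>Additive maps\<close>

text \<open>The formulas for s_x describe morphisms of entwined modules. A \<otimes> C is entwined,
  with coaction on the second leg and action (a' \<otimes> c) a = a' \<psi>(c \<otimes> a), and
  \<psi> identifies it with C \<otimes> A, the right A-module induced from C. Here bijectivity
  enters: a colinear map from C to A extends to a right A-linear colinear map on C \<otimes> A,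
  hence on A \<otimes> C. Such a map preserves coinvariants, and a \<otimes> e is coinvariant, so
  its image lies in B. Since can(a \<otimes> a') = (a \<otimes> e) a', right A-linearity gives the
  second identity. The first identity is the lifting equation with the counit applied: colinear maps
  into A \<otimes> C are determined by their composite with A \<otimes> \<epsilon>. The lifting
  starts from a direct sum because its elements have finitely many nonzero coordinates; this keeps
  the sums over x finite although x runs through all of A. In the left-handed case the inverse of
  \<psi> is the entwining, and e \<otimes> a replaces a \<otimes> e.\<close>

definition additive :: "('g, 'x) ring_scheme \<Rightarrow> ('h, 'y) ring_scheme \<Rightarrow> ('g \<Rightarrow> 'h) \<Rightarrow> bool" where
  "additive G H f \<longleftrightarrow> f \<in> carrier G \<rightarrow> carrier H \<and>
     (\<forall>x\<in>carrier G. \<forall>y\<in>carrier G. f (x \<oplus>\<^bsub>G\<^esub> y) = f x \<oplus>\<^bsub>H\<^esub> f y)"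

lemma additiveI:
  assumes "\<And>x. x \<in> carrier G \<Longrightarrow> f x \<in> carrier H"
    and "\<And>x y. x \<in> carrier G \<Longrightarrow> y \<in> carrier G \<Longrightarrow> f (x \<oplus>\<^bsub>G\<^esub> y) = f x \<oplus>\<^bsub>H\<^esub> f y"
  shows "additive G H f"
  using assms by (auto simp: additive_def)

lemma additive_closed: "additive G H f \<Longrightarrow> x \<in> carrier G \<Longrightarrow> f x \<in> carrier H"
  by (auto simp: additive_def)

lemma additive_add:
  "additive G H f \<Longrightarrow> x \<in> carrier G \<Longrightarrow> y \<in> carrier G \<Longrightarrow> f (x \<oplus>\<^bsub>G\<^esub> y) = f x \<oplus>\<^bsub>H\<^esub> f y"
  by (auto simp: additive_def)

lemma additive_comp: "additive G H f \<Longrightarrow> additive H K g \<Longrightarrow> additive G K (\<lambda>x. g (f x))"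
  by (auto simp: additive_def Pi_def)

lemma additive_id: "additive G G (\<lambda>x. x)" "additive G G id"
  by (auto simp: additive_def)

lemma additive_zero:
  assumes "abelian_group G" "abelian_group H" "additive G H f"
  shows "f \<zero>\<^bsub>G\<^esub> = \<zero>\<^bsub>H\<^esub>"
proof -
  interpret G: abelian_group G by fact
  interpret H: abelian_group H by fact
  have "f \<zero>\<^bsub>G\<^esub> \<oplus>\<^bsub>H\<^esub> f \<zero>\<^bsub>G\<^esub> = f \<zero>\<^bsub>G\<^esub>"
    using additive_add[OF assms(3), of "\<zero>\<^bsub>G\<^esub>" "\<zero>\<^bsub>G\<^esub>"] by simp
  then show ?thesis
    using additive_closed[OF assms(3) G.zero_closed] by (metis H.add.l_cancel_one)
qed

lemma additive_minus:
  assumes "abelian_group G" "abelian_group H" "additive G H f" "x \<in> carrier G"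
  shows "f (\<ominus>\<^bsub>G\<^esub> x) = \<ominus>\<^bsub>H\<^esub> f x"
proof -
  interpret G: abelian_group G by fact
  interpret H: abelian_group H by fact
  have "f (\<ominus>\<^bsub>G\<^esub> x) \<oplus>\<^bsub>H\<^esub> f x = \<zero>\<^bsub>H\<^esub>"
    using additive_add[OF assms(3), of "\<ominus>\<^bsub>G\<^esub> x" x] assms by (simp add: G.l_neg additive_zero)
  then show ?thesis
    using additive_closed[OF assms(3)] assms(4) by (metis G.a_inv_closed H.minus_equality)
qed

lemma additive_plus:
  assumes "abelian_group H" "additive G H f" "additive G H g"
  shows "additive G H (\<lambda>x. f x \<oplus>\<^bsub>H\<^esub> g x)"
proof -
  interpret H: abelian_group H by fact
  show ?thesis using assms(2,3) by (auto simp: additive_def Pi_iff H.a_ac)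
qed

text \<open>The sums of the argument range over all of \<open>carrier A\<close>, which may be
  infinite. \<open>gfinprod\<close> sums over the support and returns the neutral element when the
  support is infinite, so \<open>fin_supp\<close> has to accompany every statement in which sums are
  added or mapped.\<close>

abbreviation fsum :: "('g, 'x) ring_scheme \<Rightarrow> 'i set \<Rightarrow> ('i \<Rightarrow> 'g) \<Rightarrow> 'g" where
  "fsum G I h \<equiv> gfinprod (add_monoid G) h I"

abbreviation fin_supp :: "('g, 'x) ring_scheme \<Rightarrow> 'i set \<Rightarrow> ('i \<Rightarrow> 'g) \<Rightarrow> bool" where
  "fin_supp G I h \<equiv> finite {i \<in> I. h i \<noteq> \<zero>\<^bsub>G\<^esub>}"

lemma (in abelian_group) fsum_closed: "h \<in> I \<rightarrow> carrier G \<Longrightarrow> fsum G I h \<in> carrier G"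
  using add.gfinprod_closed[of h I] by simp

lemma (in abelian_group) fsum_add:
  "fin_supp G I h \<Longrightarrow> fin_supp G I h' \<Longrightarrow> h \<in> I \<rightarrow> carrier G \<Longrightarrow> h' \<in> I \<rightarrow> carrier G \<Longrightarrow>
   fsum G I (\<lambda>i. h i \<oplus> h' i) = fsum G I h \<oplus> fsum G I h'"
  using add.gfinprod_distrib[of I h h'] by simp

lemma (in abelian_group) fsum_cong:
  "h \<in> I \<rightarrow> carrier G \<Longrightarrow> (\<And>i. i \<in> I \<Longrightarrow> h i = h' i) \<Longrightarrow> fsum G I h = fsum G I h'"
  using add.gfinprod_cong[of I I h h'] by (simp add: simp_implies_def)

lemma (in abelian_group) fsum_single:
  assumes "i \<in> I" "x \<in> carrier G"
  shows "fsum G I (\<lambda>j. if j = i then x else \<zero>) = x"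
proof -
  have "fsum G I (\<lambda>j. if j = i then x else \<zero>) = fsum G {i} (\<lambda>j. if j = i then x else \<zero>)"
    by (rule add.gfinprod_mono_neutral_cong_right[simplified]) (use assms in auto)
  also have "\<dots> = x"
    using assms add.gfinprod_eq_finprod[of "{i}" "\<lambda>j. if j = i then x else \<zero>"]
      add.finprod_singleton[of i "{i}" "\<lambda>j. x"]
    by (simp add: finsum_singleton)
  finally show ?thesis .
qed

lemma fin_supp_map:
  assumes "fin_supp G I h" "\<And>i. i \<in> I \<Longrightarrow> h i = \<zero>\<^bsub>G\<^esub> \<Longrightarrow> h' i = \<zero>\<^bsub>H\<^esub>"
  shows "fin_supp H I h'"
  by (rule finite_subset[OF _ assms(1)]) (use assms(2) in auto)

text \<open>An additive map may annihilate terms, so the support of the image family is only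
  contained in that of \<open>h\<close>. Both sums are computed over the support of
  \<open>h\<close>, which is finite, and the image sum is then enlarged to \<open>I\<close> by
  zeros.\<close>

lemma fsum_additive:
  assumes G: "abelian_group G" and H: "abelian_group H" and f: "additive G H f"
    and fin: "fin_supp G I h" and h: "h \<in> I \<rightarrow> carrier G"
  shows "f (fsum G I h) = fsum H I (\<lambda>i. f (h i))"
proof -
  interpret G: abelian_group G by fact
  interpret H: abelian_group H by fact
  have fin_sum: "f (finsum G h J) = finsum H (\<lambda>i. f (h i)) J" if "finite J" "J \<subseteq> I" for J
    using that
  proof (induction J rule: finite_induct)
    case empty
    then show ?case using additive_zero[OF G H f] by simp
  next
    case (insert j J)
    then have "finsum G h J \<in> carrier G" "h j \<in> carrier G" "h \<in> J \<rightarrow> carrier G"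
      "(\<lambda>i. f (h i)) \<in> J \<rightarrow> carrier H" "f (h j) \<in> carrier H"
      using h f by (auto simp: additive_def Pi_def intro!: G.finsum_closed)
    with insert show ?case by (simp add: additive_add[OF f])
  qed
  let ?J = "{i \<in> I. h i \<noteq> \<zero>\<^bsub>G\<^esub>}"
  have "f (fsum G I h) = f (finsum G h ?J)"
    using fin by (simp add: gfinprod_def finsum_def)
  also have "\<dots> = finsum H (\<lambda>i. f (h i)) ?J"
    using fin_sum[OF fin] by auto
  also have "\<dots> = fsum H ?J (\<lambda>i. f (h i))"
    using H.add.gfinprod_eq_finprod[OF fin, of "\<lambda>i. f (h i)"] h f
    by (auto simp: additive_def Pi_def finsum_def)
  also have "\<dots> = fsum H I (\<lambda>i. f (h i))"
    by (rule H.add.gfinprod_mono_neutral_cong_left[simplified])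
      (use h f additive_zero[OF G H f] in \<open>auto simp: additive_def\<close>)
  finally show ?thesis .
qed

section \<open>Universal property of the tensor product over a ring\<close>

section \<open>The universal property of the tensor product\<close>

locale tensor_pair = M: right_module S M + N: left_module S N
  for M :: "('s, 'm, 't) bimod" and S :: "('t, 'x) ring_scheme" and N :: "('t, 'n, 'v) bimod"

text \<open>The target is a bare abelian group. Linearity over the outer rings is proved afterwards
  for the induced maps, because the outer actions on a tensor product are themselves obtained from
  this universal property.\<close>

definition balanced ::
    "('s, 'm, 't) bimod \<Rightarrow> ('t, 'x) ring_scheme \<Rightarrow> ('t, 'n, 'v) bimod \<Rightarrow> ('g, 'z) ring_scheme \<Rightarrow>
     ('m \<Rightarrow> 'n \<Rightarrow> 'g) \<Rightarrow> bool" where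
  "balanced M S N G \<beta> \<longleftrightarrow>
     (\<forall>m\<in>carrier M. additive N G (\<beta> m)) \<and> (\<forall>n\<in>carrier N. additive M G (\<lambda>m. \<beta> m n)) \<and>
     (\<forall>m\<in>carrier M. \<forall>s\<in>carrier S. \<forall>n\<in>carrier N. \<beta> (ract M m s) n = \<beta> m (lact N s n))"

lemma balancedI:
  assumes "\<And>m. m \<in> carrier M \<Longrightarrow> additive N G (\<beta> m)"
    and "\<And>n. n \<in> carrier N \<Longrightarrow> additive M G (\<lambda>m. \<beta> m n)"
    and "\<And>m s n. \<lbrakk>m \<in> carrier M; s \<in> carrier S; n \<in> carrier N\<rbrakk> \<Longrightarrow> \<beta> (ract M m s) n = \<beta> m (lact N s n)"
  shows "balanced M S N G \<beta>"
  using assms by (simp add: balanced_def)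

lemma tens_simps:
  "carrier (M \<boxtimes>\<^bsub>S\<^esub> N) = carrier (tens_group M S N)"
  "zero (M \<boxtimes>\<^bsub>S\<^esub> N) = one (tens_group M S N)"
  "add (M \<boxtimes>\<^bsub>S\<^esub> N) = mult (tens_group M S N)"
  "lact (M \<boxtimes>\<^bsub>S\<^esub> N) s = tens_lift (tens_ring M S N) (\<lambda>m n. pure_tens M S N (lact M s m) n)"
  "ract (M \<boxtimes>\<^bsub>S\<^esub> N) w t = tens_lift (tens_ring M S N) (\<lambda>m n. pure_tens M S N m (ract N n t)) w"
  by (simp_all add: tens_def tens_ring_def ring.defs bimod.defs)

lemma tens_ring_simps:
  "carrier (tens_ring M S N) = carrier (tens_group M S N)"
  "zero (tens_ring M S N) = one (tens_group M S N)"
  "add (tens_ring M S N) = mult (tens_group M S N)"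
  by (simp_all add: tens_ring_def)

text \<open>A coset is mapped by \<^const>\<open>tens_lift\<close> to the value of this map on any of its elements.\<close>

definition frag_lift :: "('g, 'z) ring_scheme \<Rightarrow> ('m \<Rightarrow> 'n \<Rightarrow> 'g) \<Rightarrow> (('m \<times> 'n) \<Rightarrow>\<^sub>0 int) \<Rightarrow> 'g" where
  "frag_lift G \<beta> u = (\<Oplus>\<^bsub>G\<^esub>p\<in>Poly_Mapping.keys u. [Poly_Mapping.lookup u p] \<cdot>\<^bsub>G\<^esub> \<beta> (fst p) (snd p))"

lemma frag_lift_superset:
  assumes "abelian_group G" "finite K" "Poly_Mapping.keys u \<subseteq> K"
    and "\<And>p. p \<in> K \<Longrightarrow> \<beta> (fst p) (snd p) \<in> carrier G"
  shows "frag_lift G \<beta> u = (\<Oplus>\<^bsub>G\<^esub>p\<in>K. [Poly_Mapping.lookup u p] \<cdot>\<^bsub>G\<^esub> \<beta> (fst p) (snd p))"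
proof -
  interpret G: abelian_group G by fact
  have closed: "[Poly_Mapping.lookup u p] \<cdot>\<^bsub>G\<^esub> \<beta> (fst p) (snd p) \<in> carrier G" if "p \<in> K" for p
    using assms(4)[OF that] by (rule G.add.int_pow_closed)
  have zero: "[(0::int)] \<cdot>\<^bsub>G\<^esub> x = \<zero>\<^bsub>G\<^esub>" for x
    by (simp add: add_pow_def)
  show ?thesis
    unfolding frag_lift_def
    by (rule G.add.finprod_mono_neutral_cong_left)
      (use assms(2,3) closed zero in \<open>auto simp: in_keys_iff Pi_def\<close>)
qed

lemma frag_lift_hom:
  assumes "abelian_group G" and \<beta>: "\<And>p. p \<in> P \<Longrightarrow> \<beta> (fst p) (snd p) \<in> carrier G"
  shows "frag_lift G \<beta> \<in> hom (free_Abelian_group P) (add_monoid G)"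
proof (rule homI)
  interpret G: abelian_group G by fact
  fix u v assume "u \<in> carrier (free_Abelian_group P)" "v \<in> carrier (free_Abelian_group P)"
  then have uv: "Poly_Mapping.keys u \<subseteq> P" "Poly_Mapping.keys v \<subseteq> P" by auto
  \<comment> \<open>Coefficients of \<open>u\<close> and \<open>v\<close> may cancel, so the keys of
    \<open>u + v\<close> can be a proper subset of \<open>?K\<close>. All three sums are taken over
    this common set.\<close>
  let ?K = "Poly_Mapping.keys u \<union> Poly_Mapping.keys v"
  let ?f = "\<lambda>u p. [Poly_Mapping.lookup u p] \<cdot>\<^bsub>G\<^esub> \<beta> (fst p) (snd p)"
  have c: "\<beta> (fst p) (snd p) \<in> carrier G" if "p \<in> ?K" for p
    using \<beta> uv that by blast
  have lift: "frag_lift G \<beta> w = finsum G (?f w) ?K" if "Poly_Mapping.keys w \<subseteq> ?K" for w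
    by (rule frag_lift_superset) (use c that assms(1) in auto)
  have "finsum G (?f (u + v)) ?K = finsum G (\<lambda>p. ?f u p \<oplus>\<^bsub>G\<^esub> ?f v p) ?K"
    using c by (intro G.finsum_cong') (auto simp: lookup_add G.add.int_pow_mult)
  also have "\<dots> = finsum G (?f u) ?K \<oplus>\<^bsub>G\<^esub> finsum G (?f v) ?K"
    using c by (intro G.finsum_addf) auto
  finally show "frag_lift G \<beta> (u \<otimes>\<^bsub>free_Abelian_group P\<^esub> v)
      = frag_lift G \<beta> u \<otimes>\<^bsub>add_monoid G\<^esub> frag_lift G \<beta> v"
    using lift[of u] lift[of v] lift[of "u + v"] keys_add[of u v] by simp
next
  interpret G: abelian_group G by fact
  fix u assume "u \<in> carrier (free_Abelian_group P)"
  then show "frag_lift G \<beta> u \<in> carrier (add_monoid G)"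
    using \<beta> by (auto simp: frag_lift_def intro!: G.finsum_closed G.add.int_pow_closed)
qed

lemma frag_lift_of:
  assumes "abelian_group G" "\<beta> m n \<in> carrier G"
  shows "frag_lift G \<beta> (frag_of (m, n)) = \<beta> m n"
proof -
  interpret G: abelian_group G by fact
  show ?thesis
    using assms(2) by (simp add: frag_lift_def G.add.int_pow_1)
qed

context tensor_pair
begin

lemma tens_rels_carrier: "tens_rels M S N \<subseteq> carrier (tens_free M N)"
  by (auto simp: tens_rels_def M.ract_closed N.lact_closed dest!: subsetD[OF keys_diff])

lemma tens_kernel_normal: "tens_kernel M S N \<lhd> tens_free M N"
  unfolding tens_kernel_def
  by (intro comm_group.subgroup_imp_normal abelian_free_Abelian_group
      group.generate_is_subgroup[OF group_free_Abelian_group] tens_rels_carrier)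

lemma tens_abelian_group: "abelian_group (M \<boxtimes>\<^bsub>S\<^esub> N)" "abelian_group (tens_ring M S N)"
proof -
  interpret K: normal "tens_kernel M S N" "tens_free M N" by (rule tens_kernel_normal)
  interpret G: comm_group "tens_group M S N"
    unfolding tens_group_def
    by (rule comm_group.abelian_FactGroup[OF abelian_free_Abelian_group K.subgroup_axioms])
  show "abelian_group (M \<boxtimes>\<^bsub>S\<^esub> N)" "abelian_group (tens_ring M S N)"
    by (rule abelian_groupI;
        simp add: tens_simps tens_ring_simps G.m_assoc G.l_inv_ex; simp add: G.m_comm)+
qed

lemma tens_cosets:
  "carrier (M \<boxtimes>\<^bsub>S\<^esub> N) = (\<lambda>u. tens_kernel M S N #>\<^bsub>tens_free M N\<^esub> u) ` carrier (tens_free M N)"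
  by (auto simp: tens_simps tens_group_def FactGroup_def RCOSETS_def)

lemma tens_coset_add:
  assumes "u \<in> carrier (tens_free M N)" "v \<in> carrier (tens_free M N)"
  shows "(tens_kernel M S N #>\<^bsub>tens_free M N\<^esub> u) \<oplus>\<^bsub>M \<boxtimes>\<^bsub>S\<^esub> N\<^esub> (tens_kernel M S N #>\<^bsub>tens_free M N\<^esub> v)
    = tens_kernel M S N #>\<^bsub>tens_free M N\<^esub> (u + v)"
  using normal.rcos_sum[OF tens_kernel_normal assms] by (simp add: tens_simps tens_group_def FactGroup_def)

lemma tens_coset_eqI:
  assumes "u \<in> carrier (tens_free M N)" "v \<in> carrier (tens_free M N)" "u - v \<in> tens_rels M S N"
  shows "tens_kernel M S N #>\<^bsub>tens_free M N\<^esub> u = tens_kernel M S N #>\<^bsub>tens_free M N\<^esub> v"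
proof -
  interpret K: normal "tens_kernel M S N" "tens_free M N" by (rule tens_kernel_normal)
  have "u - v \<in> tens_kernel M S N"
    unfolding tens_kernel_def using assms(3) by (rule generate.incl)
  moreover have "u = (u - v) \<otimes>\<^bsub>tens_free M N\<^esub> v" by simp
  ultimately have "u \<in> tens_kernel M S N #>\<^bsub>tens_free M N\<^esub> v"
    unfolding r_coset_def by blast
  then show ?thesis using assms(2) K.repr_independence K.subgroup_axioms by blast
qed

lemma pure_closed:
  "m \<in> carrier M \<Longrightarrow> n \<in> carrier N \<Longrightarrow> pure_tens M S N m n \<in> carrier (M \<boxtimes>\<^bsub>S\<^esub> N)"
  by (auto simp: tens_cosets pure_tens_def)

lemma pure_add_left:
  assumes "m \<in> carrier M" "m' \<in> carrier M" "n \<in> carrier N"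
  shows "pure_tens M S N (m \<oplus>\<^bsub>M\<^esub> m') n = pure_tens M S N m n \<oplus>\<^bsub>M \<boxtimes>\<^bsub>S\<^esub> N\<^esub> pure_tens M S N m' n"
proof -
  have "frag_of (m \<oplus>\<^bsub>M\<^esub> m', n) - (frag_of (m, n) + frag_of (m', n)) \<in> tens_rels M S N"
    using assms by (auto simp: tens_rels_def diff_diff_eq)
  with assms show ?thesis
    using keys_add
    by (simp add: pure_tens_def tens_coset_add)
      (rule tens_coset_eqI; fastforce dest!: subsetD[OF keys_add])
qed

lemma pure_add_right:
  assumes "m \<in> carrier M" "n \<in> carrier N" "n' \<in> carrier N"
  shows "pure_tens M S N m (n \<oplus>\<^bsub>N\<^esub> n') = pure_tens M S N m n \<oplus>\<^bsub>M \<boxtimes>\<^bsub>S\<^esub> N\<^esub> pure_tens M S N m n'"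
proof -
  have "frag_of (m, n \<oplus>\<^bsub>N\<^esub> n') - (frag_of (m, n) + frag_of (m, n')) \<in> tens_rels M S N"
    using assms by (auto simp: tens_rels_def diff_diff_eq)
  with assms show ?thesis
    using keys_add
    by (simp add: pure_tens_def tens_coset_add)
      (rule tens_coset_eqI; fastforce dest!: subsetD[OF keys_add])
qed

lemma pure_balanced:
  assumes "m \<in> carrier M" "s \<in> carrier S" "n \<in> carrier N"
  shows "pure_tens M S N (ract M m s) n = pure_tens M S N m (lact N s n)"
  unfolding pure_tens_def
  by (rule tens_coset_eqI) (use assms in \<open>auto simp: tens_rels_def M.ract_closed N.lact_closed\<close>)

lemma balanced_pure: "balanced M S N (M \<boxtimes>\<^bsub>S\<^esub> N) (pure_tens M S N)"
  by (intro balancedI additiveI pure_closed pure_add_left pure_add_right pure_balanced)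

text \<open>Zero and negatives need no cases of their own: zero is 0 \<otimes> 0, and the negative
  of m \<otimes> n is (-m) \<otimes> n, so both are pure.\<close>

lemma tens_induct [consumes 1, case_names pure add]:
  assumes t: "t \<in> carrier (M \<boxtimes>\<^bsub>S\<^esub> N)"
    and pure: "\<And>m n. m \<in> carrier M \<Longrightarrow> n \<in> carrier N \<Longrightarrow> P (pure_tens M S N m n)"
    and add: "\<And>t t'. \<lbrakk>t \<in> carrier (M \<boxtimes>\<^bsub>S\<^esub> N); t' \<in> carrier (M \<boxtimes>\<^bsub>S\<^esub> N); P t; P t'\<rbrakk> \<Longrightarrow> P (t \<oplus>\<^bsub>M \<boxtimes>\<^bsub>S\<^esub> N\<^esub> t')"
  shows "P t"
proof -
  interpret T: abelian_group "M \<boxtimes>\<^bsub>S\<^esub> N" by (rule tens_abelian_group)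
  let ?c = "\<lambda>u. tens_kernel M S N #>\<^bsub>tens_free M N\<^esub> u"
  have c: "?c u \<in> carrier (M \<boxtimes>\<^bsub>S\<^esub> N)" if "Poly_Mapping.keys u \<subseteq> carrier M \<times> carrier N" for u
    unfolding tens_cosets using that by (intro imageI) simp
  have zero: "pure_tens M S N \<zero>\<^bsub>M\<^esub> n = \<zero>\<^bsub>M \<boxtimes>\<^bsub>S\<^esub> N\<^esub>" if "n \<in> carrier N" for n
    using that balanced_pure additive_zero[OF M.M.abelian_group_axioms T.abelian_group_axioms, of "\<lambda>m. pure_tens M S N m n"]
    by (simp add: balanced_def)
  have neg: "pure_tens M S N (\<ominus>\<^bsub>M\<^esub> m) n = \<ominus>\<^bsub>M \<boxtimes>\<^bsub>S\<^esub> N\<^esub> pure_tens M S N m n"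
    if "m \<in> carrier M" "n \<in> carrier N" for m n
    using that balanced_pure additive_minus[OF M.M.abelian_group_axioms T.abelian_group_axioms, of "\<lambda>m. pure_tens M S N m n"]
    by (simp add: balanced_def)
  have c0: "?c 0 = \<zero>\<^bsub>M \<boxtimes>\<^bsub>S\<^esub> N\<^esub>"
    using tens_coset_add[of 0 0] c[of 0] T.add.l_cancel_one by fastforce
  have cneg: "?c (- u) = \<ominus>\<^bsub>M \<boxtimes>\<^bsub>S\<^esub> N\<^esub> ?c u" if "Poly_Mapping.keys u \<subseteq> carrier M \<times> carrier N" for u
    using tens_coset_add[of "- u" u] c[of u] c[of "- u"] that c0 T.minus_equality by simp
  \<comment> \<open>The induction principle of the free abelian group has a case for differences,
    whereas \<open>P\<close> is only known to be stable under sums. Carrying the negative along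
    closes this gap.\<close>
  have "P (?c u) \<and> P (\<ominus>\<^bsub>M \<boxtimes>\<^bsub>S\<^esub> N\<^esub> ?c u)" if "Poly_Mapping.keys u \<subseteq> carrier M \<times> carrier N" for u
  proof (rule free_Abelian_group_induct[OF that, where P="\<lambda>u. P (?c u) \<and> P (\<ominus>\<^bsub>M \<boxtimes>\<^bsub>S\<^esub> N\<^esub> ?c u)"])
    have "P (pure_tens M S N \<zero>\<^bsub>M\<^esub> \<zero>\<^bsub>N\<^esub>)" by (intro pure) auto
    then show "P (?c 0) \<and> P (\<ominus>\<^bsub>M \<boxtimes>\<^bsub>S\<^esub> N\<^esub> ?c 0)"
      using T.minus_equality[OF T.l_zero[OF T.zero_closed] T.zero_closed T.zero_closed]
      unfolding c0 zero[OF N.M.zero_closed] by metis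
  next
    fix x y
    assume xy: "Poly_Mapping.keys x \<subseteq> carrier M \<times> carrier N" "Poly_Mapping.keys y \<subseteq> carrier M \<times> carrier N"
      and P: "P (?c x) \<and> P (\<ominus>\<^bsub>M \<boxtimes>\<^bsub>S\<^esub> N\<^esub> ?c x)" "P (?c y) \<and> P (\<ominus>\<^bsub>M \<boxtimes>\<^bsub>S\<^esub> N\<^esub> ?c y)"
    have "?c (x - y) = ?c x \<oplus>\<^bsub>M \<boxtimes>\<^bsub>S\<^esub> N\<^esub> \<ominus>\<^bsub>M \<boxtimes>\<^bsub>S\<^esub> N\<^esub> ?c y"
      using tens_coset_add[of x "- y"] xy by (simp add: cneg)
    moreover have "\<ominus>\<^bsub>M \<boxtimes>\<^bsub>S\<^esub> N\<^esub> (?c x \<oplus>\<^bsub>M \<boxtimes>\<^bsub>S\<^esub> N\<^esub> \<ominus>\<^bsub>M \<boxtimes>\<^bsub>S\<^esub> N\<^esub> ?c y)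
        = \<ominus>\<^bsub>M \<boxtimes>\<^bsub>S\<^esub> N\<^esub> ?c x \<oplus>\<^bsub>M \<boxtimes>\<^bsub>S\<^esub> N\<^esub> ?c y"
      using c xy by (simp add: T.minus_add)
    ultimately show "P (?c (x - y)) \<and> P (\<ominus>\<^bsub>M \<boxtimes>\<^bsub>S\<^esub> N\<^esub> ?c (x - y))"
      using P xy c by (auto intro!: add)
  next
    fix p assume "p \<in> carrier M \<times> carrier N"
    then obtain m n where p: "p = (m, n)" "m \<in> carrier M" "n \<in> carrier N" by auto
    then have "?c (frag_of p) = pure_tens M S N m n" by (simp add: pure_tens_def)
    then show "P (?c (frag_of p)) \<and> P (\<ominus>\<^bsub>M \<boxtimes>\<^bsub>S\<^esub> N\<^esub> ?c (frag_of p))"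
      using p pure[of m n] pure[of "\<ominus>\<^bsub>M\<^esub> m" n] by (simp add: neg)
  qed
  then show ?thesis using t by (auto simp: tens_cosets)
qed

lemma tens_generate:
  "carrier (M \<boxtimes>\<^bsub>S\<^esub> N) \<subseteq> generate (add_monoid (M \<boxtimes>\<^bsub>S\<^esub> N)) {pure_tens M S N m n |m n. m \<in> carrier M \<and> n \<in> carrier N}"
proof
  fix t assume "t \<in> carrier (M \<boxtimes>\<^bsub>S\<^esub> N)"
  then show "t \<in> generate (add_monoid (M \<boxtimes>\<^bsub>S\<^esub> N)) {pure_tens M S N m n |m n. m \<in> carrier M \<and> n \<in> carrier N}"
  proof (induction t rule: tens_induct)
    case (pure m n)
    then show ?case by (intro generate.incl) blast
  next
    case (add t t')
    from generate.eng[OF add(3,4)] show ?case by simp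
  qed
qed

text \<open>Pure tensors generate under addition alone, so additivity of both maps is enough. Nearly
  every identity between maps out of a tensor product below is checked on pure tensors in this
  way.\<close>

lemma tens_ext:
  assumes "additive (M \<boxtimes>\<^bsub>S\<^esub> N) G f" "additive (M \<boxtimes>\<^bsub>S\<^esub> N) G g"
    and "\<And>m n. m \<in> carrier M \<Longrightarrow> n \<in> carrier N \<Longrightarrow> f (pure_tens M S N m n) = g (pure_tens M S N m n)"
    and "t \<in> carrier (M \<boxtimes>\<^bsub>S\<^esub> N)"
  shows "f t = g t"
  using assms(4) by (induction t rule: tens_induct) (auto simp: assms additive_add[OF assms(1)] additive_add[OF assms(2)])

text \<open>The choice by \<open>the_elem\<close> in \<open>tens_lift\<close> is meaningful because
  \<open>frag_lift\<close> is a homomorphism that annihilates the three kinds of relations, hence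
  the subgroup they generate, and is therefore constant on each coset.\<close>

lemma tens_lift_coset:
  assumes G: "abelian_group G" and \<beta>: "balanced M S N G \<beta>" and u: "u \<in> carrier (tens_free M N)"
  shows "tens_lift G \<beta> (tens_kernel M S N #>\<^bsub>tens_free M N\<^esub> u) = frag_lift G \<beta> u"
proof -
  interpret K: normal "tens_kernel M S N" "tens_free M N" by (rule tens_kernel_normal)
  interpret G: abelian_group G by fact
  have \<beta>_closed: "\<beta> m n \<in> carrier G" if "m \<in> carrier M" "n \<in> carrier N" for m n
    using \<beta> that by (auto simp: balanced_def additive_def)
  have hom: "frag_lift G \<beta> \<in> hom (tens_free M N) (add_monoid G)"
    using \<beta>_closed by (intro frag_lift_hom[OF G]) auto
  then interpret h: group_hom "tens_free M N" "add_monoid G" "frag_lift G \<beta>"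
    by (simp add: group_hom_def group_hom_axioms_def G.a_group)
  have of: "frag_lift G \<beta> (frag_of (m, n)) = \<beta> m n" if "m \<in> carrier M" "n \<in> carrier N" for m n
    using that by (simp add: frag_lift_of[OF G] \<beta>_closed)
  have diff: "frag_lift G \<beta> (x - y) = frag_lift G \<beta> x \<ominus>\<^bsub>G\<^esub> frag_lift G \<beta> y"
    if "x \<in> carrier (tens_free M N)" "y \<in> carrier (tens_free M N)" for x y
    using that h.hom_mult[of x "- y"] h.hom_inv[of y]
    by (simp add: a_inv_def a_minus_def)
  have cancel: "x \<oplus>\<^bsub>G\<^esub> y \<ominus>\<^bsub>G\<^esub> x \<ominus>\<^bsub>G\<^esub> y = \<zero>\<^bsub>G\<^esub>" if "x \<in> carrier G" "y \<in> carrier G" for x y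
    using that G.r_neg[of "x \<oplus>\<^bsub>G\<^esub> y"] by (simp add: G.minus_eq G.minus_add G.a_assoc)
  have rels: "frag_lift G \<beta> r = \<zero>\<^bsub>G\<^esub>" if "r \<in> tens_rels M S N" for r
    using that unfolding tens_rels_def
  proof (elim UnE CollectE exE conjE)
    fix m m' n assume r: "r = frag_of (m \<oplus>\<^bsub>M\<^esub> m', n) - frag_of (m, n) - frag_of (m', n)"
      and c: "m \<in> carrier M" "m' \<in> carrier M" "n \<in> carrier N"
    have "frag_lift G \<beta> r = \<beta> (m \<oplus>\<^bsub>M\<^esub> m') n \<ominus>\<^bsub>G\<^esub> \<beta> m n \<ominus>\<^bsub>G\<^esub> \<beta> m' n"
      using c keys_diff by (subst r, subst diff) (fastforce simp: diff of)+
    also have "\<dots> = \<zero>\<^bsub>G\<^esub>"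
      using additive_add[of M G "\<lambda>m. \<beta> m n" m m'] \<beta> c by (simp add: balanced_def \<beta>_closed cancel)
    finally show ?thesis .
  next
    fix m n n' assume r: "r = frag_of (m, n \<oplus>\<^bsub>N\<^esub> n') - frag_of (m, n) - frag_of (m, n')"
      and c: "m \<in> carrier M" "n \<in> carrier N" "n' \<in> carrier N"
    have "frag_lift G \<beta> r = \<beta> m (n \<oplus>\<^bsub>N\<^esub> n') \<ominus>\<^bsub>G\<^esub> \<beta> m n \<ominus>\<^bsub>G\<^esub> \<beta> m n'"
      using c keys_diff by (subst r, subst diff) (fastforce simp: diff of)+
    also have "\<dots> = \<zero>\<^bsub>G\<^esub>"
      using additive_add[of N G "\<beta> m" n n'] \<beta> c by (simp add: balanced_def \<beta>_closed cancel)
    finally show ?thesis .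
  next
    fix m s n assume r: "r = frag_of (ract M m s, n) - frag_of (m, lact N s n)"
      and c: "m \<in> carrier M" "s \<in> carrier S" "n \<in> carrier N"
    then show ?thesis
      using \<beta> \<beta>_closed
      by (simp add: diff of M.ract_closed N.lact_closed balanced_def G.minus_eq G.r_neg)
  qed
  have ker: "frag_lift G \<beta> v = \<zero>\<^bsub>G\<^esub>" if "v \<in> tens_kernel M S N" for v
    using that unfolding tens_kernel_def
  proof (induction v rule: generate.induct)
    case one
    then show ?case using h.hom_one by simp
  next
    case (incl h)
    then show ?case by (rule rels)
  next
    case (inv v)
    then show ?case using h.hom_inv[of v] rels[of v] tens_rels_carrier by auto
  next
    case (eng v w)
    then have "v \<in> carrier (tens_free M N)" "w \<in> carrier (tens_free M N)"
      using K.generate_in_carrier[OF tens_rels_carrier] by blast+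
    with eng show ?case using h.hom_mult[of v w] by simp
  qed
  have "frag_lift G \<beta> ` (tens_kernel M S N #>\<^bsub>tens_free M N\<^esub> u) = {frag_lift G \<beta> u}"
  proof -
    have "frag_lift G \<beta> (v + u) = frag_lift G \<beta> u" if "v \<in> tens_kernel M S N" for v
      using h.hom_mult[of v u] u ker[OF that] K.mem_carrier[OF that] h.hom_closed[OF u] by simp
    \<comment> \<open>This makes the coset nonempty, so the image is a singleton and not the empty
      set.\<close>
    moreover have "0 \<in> tens_kernel M S N"
      using generate.one[of "tens_free M N"] by (simp add: tens_kernel_def)
    ultimately show ?thesis by (auto simp: r_coset_def)
  qed
  then show ?thesis by (simp add: tens_lift_def frag_lift_def[abs_def])
qed

lemma tens_lift_additive:
  assumes G: "abelian_group G" and \<beta>: "balanced M S N G \<beta>"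
  shows "additive (M \<boxtimes>\<^bsub>S\<^esub> N) G (tens_lift G \<beta>)"
proof -
  have "\<beta> m n \<in> carrier G" if "m \<in> carrier M" "n \<in> carrier N" for m n
    using \<beta> that by (auto simp: balanced_def additive_def)
  then have hom: "frag_lift G \<beta> \<in> hom (tens_free M N) (add_monoid G)"
    by (intro frag_lift_hom[OF G]) auto
  show ?thesis
    using hom_in_carrier[OF hom] hom_mult[OF hom]
    by (auto intro!: additiveI simp: tens_cosets tens_lift_coset[OF G \<beta>] tens_coset_add
        simp del: carrier_free_Abelian_group_iff)
      (metis monoid.m_closed[OF group.is_monoid[OF group_free_Abelian_group]] mult_free_Abelian_group tens_lift_coset[OF G \<beta>])
qed

lemma tens_lift_pure:
  assumes G: "abelian_group G" and \<beta>: "balanced M S N G \<beta>" and "m \<in> carrier M" "n \<in> carrier N"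
  shows "tens_lift G \<beta> (pure_tens M S N m n) = \<beta> m n"
  using assms(3,4) tens_lift_coset[OF G \<beta>, of "frag_of (m, n)"] frag_lift_of[OF G, of \<beta> m n] \<beta>
  by (auto simp: pure_tens_def balanced_def additive_def)

end

section \<open>Outer actions on tensor products and linear maps between them\<close>

section \<open>Actions on tensor products\<close>

lemma additive_tens_ring [simp]: "additive G (tens_ring M S N) f = additive G (M \<boxtimes>\<^bsub>S\<^esub> N) f"
  by (simp add: additive_def tens_simps tens_ring_simps)

lemma balanced_tens_ring [simp]: "balanced M S N (tens_ring M' S' N') \<beta> = balanced M S N (M' \<boxtimes>\<^bsub>S'\<^esub> N') \<beta>"
  by (simp add: balanced_def)

lemma left_linear_additive: "left_linear S M N f \<Longrightarrow> additive M N f"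
  by (auto simp: left_linear_def additive_def)

lemma right_linear_additive: "right_linear S M N f \<Longrightarrow> additive M N f"
  by (auto simp: right_linear_def additive_def)

lemma left_linear_iff:
  "left_linear S M N f \<longleftrightarrow> additive M N f \<and> (\<forall>s\<in>carrier S. \<forall>m\<in>carrier M. f (lact M s m) = lact N s (f m))"
  by (auto simp: left_linear_def additive_def)

lemma right_linear_iff:
  "right_linear S M N f \<longleftrightarrow> additive M N f \<and> (\<forall>s\<in>carrier S. \<forall>m\<in>carrier M. f (ract M m s) = ract N (f m) s)"
  by (auto simp: right_linear_def additive_def)

lemma left_linear_id: "left_linear S M M id" "left_linear S M M (\<lambda>x. x)"
  by (auto simp: left_linear_def)

lemma right_linear_id: "right_linear S M M id" "right_linear S M M (\<lambda>x. x)"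
  by (auto simp: right_linear_def)

lemma left_linear_comp:
  "left_linear S M N f \<Longrightarrow> left_linear S N P g \<Longrightarrow> left_linear S M P (\<lambda>x. g (f x))"
  by (auto simp: left_linear_def Pi_def)

lemma right_linear_comp:
  "right_linear S M N f \<Longrightarrow> right_linear S N P g \<Longrightarrow> right_linear S M P (\<lambda>x. g (f x))"
  by (auto simp: right_linear_def Pi_def)

lemma additive_lact: "left_module S M \<Longrightarrow> s \<in> carrier S \<Longrightarrow> additive M M (lact M s)"
  by (auto intro!: additiveI simp: left_module.lact_closed left_module.lact_add_right)

lemma additive_lact': "left_module S M \<Longrightarrow> m \<in> carrier M \<Longrightarrow> additive S M (\<lambda>s. lact M s m)"
  by (auto intro!: additiveI simp: left_module.lact_closed left_module.lact_add_left)

lemma additive_ract: "right_module S M \<Longrightarrow> s \<in> carrier S \<Longrightarrow> additive M M (\<lambda>m. ract M m s)"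
  by (auto intro!: additiveI simp: right_module.ract_closed right_module.ract_add_left)

lemma additive_ract': "right_module S M \<Longrightarrow> m \<in> carrier M \<Longrightarrow> additive S M (ract M m)"
  by (auto intro!: additiveI simp: right_module.ract_closed right_module.ract_add_right)

text \<open>In contrast to \<open>bimodule\<close> the two rings may differ and no base ring occurs.
  One notion then covers the bimodules over \<open>R\<close> as well as the ring underlying
  \<open>A\<close> acting on itself from both sides.\<close>

locale two_sided = left_module S M + right_module T M
  for S :: "('s, 'x) ring_scheme" and M :: "('s, 'm, 't) bimod" and T :: "('t, 'y) ring_scheme" +
  assumes lact_ract: "\<And>s t m. \<lbrakk>s \<in> carrier S; t \<in> carrier T; m \<in> carrier M\<rbrakk>
    \<Longrightarrow> ract M (lact M s m) t = lact M s (ract M m t)"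

lemma two_sidedD: "two_sided S M T \<Longrightarrow> left_module S M" "two_sided S M T \<Longrightarrow> right_module T M"
  by (simp_all add: two_sided_def)

lemma (in bimodule) two_sided: "two_sided R M R"
  by unfold_locales (rule lact_ract)

lemma tensor_pairI: "right_module S M \<Longrightarrow> left_module S N \<Longrightarrow> tensor_pair M S N"
  by (simp add: tensor_pair_def)

lemma balanced_compose:
  assumes "balanced M S N G \<beta>" "additive G H f"
  shows "balanced M S N H (\<lambda>m n. f (\<beta> m n))"
  by (rule balancedI; (rule additive_comp[OF _ assms(2)])?) (use assms(1) in \<open>simp_all add: balanced_def\<close>)

lemma balanced_pre:
  assumes "balanced M S N G \<beta>" "right_linear S M' M f" "left_linear S N' N g"
  shows "balanced M' S N' G (\<lambda>m n. \<beta> (f m) (g n))"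
proof (rule balancedI)
  fix m assume "m \<in> carrier M'"
  then show "additive N' G (\<lambda>n. \<beta> (f m) (g n))"
    using assms additive_comp[OF left_linear_additive, of S N' N g G "\<beta> (f m)"]
    by (auto simp: balanced_def right_linear_def)
next
  fix n assume "n \<in> carrier N'"
  then show "additive M' G (\<lambda>m. \<beta> (f m) (g n))"
    using assms additive_comp[OF right_linear_additive, of S M' M f G "\<lambda>m. \<beta> m (g n)"]
    by (auto simp: balanced_def left_linear_def)
next
  fix m s n assume "m \<in> carrier M'" "s \<in> carrier S" "n \<in> carrier N'"
  then show "\<beta> (f (ract M' m s)) (g n) = \<beta> (f m) (g (lact N' s n))"
    using assms by (simp add: balanced_def left_linear_def right_linear_def Pi_iff)
qed

text \<open>Acting by \<open>q\<close> is a right linear endomorphism of \<open>M\<close> because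
  the two actions on \<open>M\<close> commute. This is what makes the action on the first leg
  respect the balancing over \<open>S\<close>.\<close>

lemma tens_lact:
  assumes M: "two_sided Q M S" and N: "left_module S N" and q: "q \<in> carrier Q"
  shows tens_lact_additive: "additive (M \<boxtimes>\<^bsub>S\<^esub> N) (M \<boxtimes>\<^bsub>S\<^esub> N) (lact (M \<boxtimes>\<^bsub>S\<^esub> N) q)"
    and tens_lact_pure: "\<lbrakk>m \<in> carrier M; n \<in> carrier N\<rbrakk> \<Longrightarrow>
      lact (M \<boxtimes>\<^bsub>S\<^esub> N) q (pure_tens M S N m n) = pure_tens M S N (lact M q m) n"
proof -
  interpret M: two_sided Q M S by fact
  interpret tensor_pair M S N by (intro tensor_pairI M.right_module_axioms N)
  have "right_linear S M M (lact M q)"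
    using q additive_lact[OF M.left_module_axioms] by (simp add: right_linear_iff M.lact_ract)
  from balanced_pre[OF balanced_pure this left_linear_id(2)]
  have b: "balanced M S N (tens_ring M S N) (\<lambda>m n. pure_tens M S N (lact M q m) n)" by simp
  show "additive (M \<boxtimes>\<^bsub>S\<^esub> N) (M \<boxtimes>\<^bsub>S\<^esub> N) (lact (M \<boxtimes>\<^bsub>S\<^esub> N) q)"
    using tens_lift_additive[OF tens_abelian_group(2) b] by (simp add: tens_simps[abs_def])
  show "lact (M \<boxtimes>\<^bsub>S\<^esub> N) q (pure_tens M S N m n) = pure_tens M S N (lact M q m) n"
    if "m \<in> carrier M" "n \<in> carrier N"
    using tens_lift_pure[OF tens_abelian_group(2) b that] by (simp add: tens_simps)
qed

lemma tens_ract: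
  assumes M: "right_module S M" and N: "two_sided S N T" and t: "t \<in> carrier T"
  shows tens_ract_additive: "additive (M \<boxtimes>\<^bsub>S\<^esub> N) (M \<boxtimes>\<^bsub>S\<^esub> N) (\<lambda>w. ract (M \<boxtimes>\<^bsub>S\<^esub> N) w t)"
    and tens_ract_pure: "\<lbrakk>m \<in> carrier M; n \<in> carrier N\<rbrakk> \<Longrightarrow>
      ract (M \<boxtimes>\<^bsub>S\<^esub> N) (pure_tens M S N m n) t = pure_tens M S N m (ract N n t)"
proof -
  interpret N: two_sided S N T by fact
  interpret tensor_pair M S N by (intro tensor_pairI M N.left_module_axioms)
  have "left_linear S N N (\<lambda>n. ract N n t)"
    using t additive_ract[OF N.right_module_axioms] by (simp add: left_linear_iff N.lact_ract)
  from balanced_pre[OF balanced_pure right_linear_id(2) this]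
  have b: "balanced M S N (tens_ring M S N) (\<lambda>m n. pure_tens M S N m (ract N n t))" by simp
  show "additive (M \<boxtimes>\<^bsub>S\<^esub> N) (M \<boxtimes>\<^bsub>S\<^esub> N) (\<lambda>w. ract (M \<boxtimes>\<^bsub>S\<^esub> N) w t)"
    using tens_lift_additive[OF tens_abelian_group(2) b] by (simp add: tens_simps[abs_def])
  show "ract (M \<boxtimes>\<^bsub>S\<^esub> N) (pure_tens M S N m n) t = pure_tens M S N m (ract N n t)"
    if "m \<in> carrier M" "n \<in> carrier N"
    using tens_lift_pure[OF tens_abelian_group(2) b that] by (simp add: tens_simps)
qed

lemma tens_left_module:
  assumes M: "two_sided Q M S" and N: "left_module S N"
  shows "left_module Q (M \<boxtimes>\<^bsub>S\<^esub> N)"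
proof -
  interpret M: two_sided Q M S by fact
  interpret tensor_pair M S N by (intro tensor_pairI M.right_module_axioms N)
  interpret T: abelian_group "M \<boxtimes>\<^bsub>S\<^esub> N" by (rule tens_abelian_group)
  note add = tens_lact_additive[OF M N]
  show ?thesis
  proof (unfold_locales, goal_cases)
    case (1 s m)
    then show ?case using additive_closed[OF add] by blast
  next
    case (2 s s' w)
    have "additive (M \<boxtimes>\<^bsub>S\<^esub> N) (M \<boxtimes>\<^bsub>S\<^esub> N)
        (\<lambda>w. lact (M \<boxtimes>\<^bsub>S\<^esub> N) s w \<oplus>\<^bsub>M \<boxtimes>\<^bsub>S\<^esub> N\<^esub> lact (M \<boxtimes>\<^bsub>S\<^esub> N) s' w)"
      using 2 by (intro additive_plus T.abelian_group_axioms add)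
    from tens_ext[OF add this _ 2(3)] show ?case
      using 2 by (simp add: tens_lact_pure[OF M N] M.lact_add_left M.lact_closed pure_add_left)
  next
    case (3 s w w')
    then show ?case using additive_add[OF add] by blast
  next
    case (4 s s' w)
    from tens_ext[OF add additive_comp[OF add add] _ 4(3)] show ?case
      using 4 by (simp add: tens_lact_pure[OF M N] M.lact_mult M.lact_closed)
  next
    case (5 w)
    from tens_ext[OF add additive_id(1) _ 5] show ?case
      by (simp add: tens_lact_pure[OF M N] M.lact_one)
  qed
qed

lemma tens_right_module:
  assumes M: "right_module S M" and N: "two_sided S N T"
  shows "right_module T (M \<boxtimes>\<^bsub>S\<^esub> N)"
proof -
  interpret N: two_sided S N T by fact
  interpret tensor_pair M S N by (intro tensor_pairI M N.left_module_axioms)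
  interpret T: abelian_group "M \<boxtimes>\<^bsub>S\<^esub> N" by (rule tens_abelian_group)
  note add = tens_ract_additive[OF M N]
  show ?thesis
  proof (unfold_locales, goal_cases)
    case (1 s m)
    then show ?case using additive_closed[OF add] by blast
  next
    case (2 s s' w)
    have "additive (M \<boxtimes>\<^bsub>S\<^esub> N) (M \<boxtimes>\<^bsub>S\<^esub> N)
        (\<lambda>w. ract (M \<boxtimes>\<^bsub>S\<^esub> N) w s \<oplus>\<^bsub>M \<boxtimes>\<^bsub>S\<^esub> N\<^esub> ract (M \<boxtimes>\<^bsub>S\<^esub> N) w s')"
      using 2 by (intro additive_plus T.abelian_group_axioms add)
    from tens_ext[OF add this _ 2(3)] show ?case
      using 2 by (simp add: tens_ract_pure[OF M N] N.ract_add_right N.ract_closed pure_add_right)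
  next
    case (3 s w w')
    then show ?case using additive_add[OF add] by blast
  next
    case (4 s s' w)
    from tens_ext[OF add additive_comp[OF add add] _ 4(3)] show ?case
      using 4 by (simp add: tens_ract_pure[OF M N] N.ract_mult N.ract_closed)
  next
    case (5 w)
    from tens_ext[OF add additive_id(1) _ 5] show ?case
      by (simp add: tens_ract_pure[OF M N] N.ract_one)
  qed
qed

lemma tens_two_sided:
  assumes M: "two_sided Q M S" and N: "two_sided S N T"
  shows "two_sided Q (M \<boxtimes>\<^bsub>S\<^esub> N) T"
proof -
  interpret M: two_sided Q M S by fact
  interpret N: two_sided S N T by fact
  interpret tensor_pair M S N by (intro tensor_pairI M.right_module_axioms N.left_module_axioms)
  note [intro] = tens_lact_additive[OF M N.left_module_axioms] tens_ract_additive[OF M.right_module_axioms N]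
  have "ract (M \<boxtimes>\<^bsub>S\<^esub> N) (lact (M \<boxtimes>\<^bsub>S\<^esub> N) s w) t = lact (M \<boxtimes>\<^bsub>S\<^esub> N) s (ract (M \<boxtimes>\<^bsub>S\<^esub> N) w t)"
    if "s \<in> carrier Q" "t \<in> carrier T" "w \<in> carrier (M \<boxtimes>\<^bsub>S\<^esub> N)" for s t w
    by (rule tens_ext[OF additive_comp additive_comp _ that(3)])
      (use that in \<open>auto simp: tens_lact_pure[OF M N.left_module_axioms]
        tens_ract_pure[OF M.right_module_axioms N] M.lact_closed N.ract_closed\<close>)
  then show ?thesis
    by (intro two_sided.intro two_sided_axioms.intro tens_left_module[OF M N.left_module_axioms]
        tens_right_module[OF M.right_module_axioms N])
qed

lemma tens_left_linearI:
  assumes M: "two_sided Q M S" and N: "left_module S N" and P: "left_module Q P"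
    and f: "additive (M \<boxtimes>\<^bsub>S\<^esub> N) P f"
    and "\<And>q m n. \<lbrakk>q \<in> carrier Q; m \<in> carrier M; n \<in> carrier N\<rbrakk>
      \<Longrightarrow> f (pure_tens M S N (lact M q m) n) = lact P q (f (pure_tens M S N m n))"
  shows "left_linear Q (M \<boxtimes>\<^bsub>S\<^esub> N) P f"
proof -
  interpret tensor_pair M S N using M N by (simp add: tensor_pairI two_sidedD)
  have "f (lact (M \<boxtimes>\<^bsub>S\<^esub> N) q w) = lact P q (f w)" if "q \<in> carrier Q" "w \<in> carrier (M \<boxtimes>\<^bsub>S\<^esub> N)" for q w
    by (rule tens_ext[OF additive_comp[OF tens_lact_additive[OF M N] f] additive_comp[OF f additive_lact[OF P]] _ that(2)])
      (use assms(5) that in \<open>simp_all add: tens_lact_pure[OF M N]\<close>)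
  then show ?thesis using f by (simp add: left_linear_iff)
qed

lemma tens_right_linearI:
  assumes M: "right_module S M" and N: "two_sided S N T" and P: "right_module T P"
    and f: "additive (M \<boxtimes>\<^bsub>S\<^esub> N) P f"
    and "\<And>t m n. \<lbrakk>t \<in> carrier T; m \<in> carrier M; n \<in> carrier N\<rbrakk>
      \<Longrightarrow> f (pure_tens M S N m (ract N n t)) = ract P (f (pure_tens M S N m n)) t"
  shows "right_linear T (M \<boxtimes>\<^bsub>S\<^esub> N) P f"
proof -
  interpret tensor_pair M S N using M N by (simp add: tensor_pairI two_sidedD)
  have "f (ract (M \<boxtimes>\<^bsub>S\<^esub> N) w t) = ract P (f w) t" if "t \<in> carrier T" "w \<in> carrier (M \<boxtimes>\<^bsub>S\<^esub> N)" for t w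
    by (rule tens_ext[OF additive_comp[OF tens_ract_additive[OF M N] f] additive_comp[OF f additive_ract[OF P]] _ that(2)])
      (use assms(5) that in \<open>simp_all add: tens_ract_pure[OF M N]\<close>)
  then show ?thesis using f by (simp add: right_linear_iff)
qed

lemma pure_tens_right_linear:
  assumes M: "right_module S M" and N: "two_sided S N T" and m: "m \<in> carrier M"
  shows "right_linear T N (M \<boxtimes>\<^bsub>S\<^esub> N) (pure_tens M S N m)"
proof -
  interpret tensor_pair M S N using M N by (simp add: tensor_pairI two_sidedD)
  show ?thesis
    using balanced_pure m by (simp add: right_linear_iff balanced_def tens_ract_pure[OF M N])
qed

lemma pure_tens_left_linear:
  assumes M: "two_sided Q M S" and N: "left_module S N" and n: "n \<in> carrier N"
  shows "left_linear Q M (M \<boxtimes>\<^bsub>S\<^esub> N) (\<lambda>m. pure_tens M S N m n)"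
proof -
  interpret tensor_pair M S N using M N by (simp add: tensor_pairI two_sidedD)
  show ?thesis
    using balanced_pure n by (simp add: left_linear_iff balanced_def tens_lact_pure[OF M N])
qed

section \<open>Functoriality, associativity and unit constraints of the tensor product\<close>

section \<open>Functoriality and coherence\<close>

lemma tens_map:
  assumes "tensor_pair M' S N'" "tensor_pair M S N" "right_linear S M' M f" "left_linear S N' N g"
  shows tens_map_additive: "additive (M' \<boxtimes>\<^bsub>S\<^esub> N') (M \<boxtimes>\<^bsub>S\<^esub> N) (tens_map M S N f g)"
    and tens_map_pure: "\<lbrakk>m \<in> carrier M'; n \<in> carrier N'\<rbrakk> \<Longrightarrow>
      tens_map M S N f g (pure_tens M' S N' m n) = pure_tens M S N (f m) (g n)"
proof -
  interpret T: tensor_pair M S N by fact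
  interpret T': tensor_pair M' S N' by fact
  note b = balanced_pre[OF T.balanced_pure assms(3,4)]
  show "additive (M' \<boxtimes>\<^bsub>S\<^esub> N') (M \<boxtimes>\<^bsub>S\<^esub> N) (tens_map M S N f g)"
    unfolding tens_map_def by (rule T'.tens_lift_additive[OF T.tens_abelian_group(1) b])
  show "\<lbrakk>m \<in> carrier M'; n \<in> carrier N'\<rbrakk> \<Longrightarrow>
      tens_map M S N f g (pure_tens M' S N' m n) = pure_tens M S N (f m) (g n)"
    unfolding tens_map_def by (rule T'.tens_lift_pure[OF T.tens_abelian_group(1) b])
qed

lemma tens_map_comp:
  assumes "tensor_pair M S N" "tensor_pair M' S N'" "tensor_pair M'' S N''"
    and "right_linear S M M' f" "left_linear S N N' g" "right_linear S M' M'' f'" "left_linear S N' N'' g'"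
    and "t \<in> carrier (M \<boxtimes>\<^bsub>S\<^esub> N)"
  shows "tens_map M'' S N'' f' g' (tens_map M' S N' f g t) = tens_map M'' S N'' (\<lambda>x. f' (f x)) (\<lambda>x. g' (g x)) t"
proof -
  note m1 = tens_map[OF assms(1,2,4,5)]
  note m2 = tens_map[OF assms(2,3,6,7)]
  note m = tens_map[OF assms(1,3) right_linear_comp[OF assms(4,6)] left_linear_comp[OF assms(5,7)]]
  show ?thesis
    by (rule tensor_pair.tens_ext[OF assms(1) additive_comp[OF m1(1) m2(1)] m(1) _ assms(8)])
      (simp add: m1(2) m2(2) m(2) additive_closed[OF right_linear_additive[OF assms(4)]]
        additive_closed[OF left_linear_additive[OF assms(5)]])
qed

lemma tens_map_cong:
  assumes "tensor_pair M' S N'" "tensor_pair M S N" "right_linear S M' M f" "left_linear S N' N g"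
    and "right_linear S M' M f'" "left_linear S N' N g'"
    and "\<And>m. m \<in> carrier M' \<Longrightarrow> f m = f' m" "\<And>n. n \<in> carrier N' \<Longrightarrow> g n = g' n"
    and "t \<in> carrier (M' \<boxtimes>\<^bsub>S\<^esub> N')"
  shows "tens_map M S N f g t = tens_map M S N f' g' t"
  by (rule tensor_pair.tens_ext[OF assms(1) tens_map_additive tens_map_additive _ assms(9)])
    (use assms in \<open>auto simp: tens_map_pure\<close>)

lemma tens_map_left_linear:
  assumes "two_sided Q M' S" "left_module S N'" "two_sided Q M S" "left_module S N"
    and "left_linear Q M' M f" "right_linear S M' M f" "left_linear S N' N g"
  shows "left_linear Q (M' \<boxtimes>\<^bsub>S\<^esub> N') (M \<boxtimes>\<^bsub>S\<^esub> N) (tens_map M S N f g)"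
proof (rule tens_left_linearI[OF assms(1,2) tens_left_module[OF assms(3,4)]])
  have p: "tensor_pair M' S N'" "tensor_pair M S N"
    using assms by (simp_all add: tensor_pairI two_sidedD)
  show "additive (M' \<boxtimes>\<^bsub>S\<^esub> N') (M \<boxtimes>\<^bsub>S\<^esub> N) (tens_map M S N f g)"
    by (rule tens_map_additive[OF p assms(6,7)])
  show "tens_map M S N f g (pure_tens M' S N' (lact M' q m) n) = lact (M \<boxtimes>\<^bsub>S\<^esub> N) q (tens_map M S N f g (pure_tens M' S N' m n))"
    if "q \<in> carrier Q" "m \<in> carrier M'" "n \<in> carrier N'" for q m n
    using that assms(5-7) left_module.lact_closed[OF two_sidedD(1)[OF assms(1)]]
    by (simp add: tens_map_pure[OF p assms(6,7)] tens_lact_pure[OF assms(3,4)] left_linear_def right_linear_def Pi_iff)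
qed

lemma tens_map_right_linear:
  assumes "right_module S M'" "two_sided S N' T" "right_module S M" "two_sided S N T"
    and "right_linear S M' M f" "left_linear S N' N g" "right_linear T N' N g"
  shows "right_linear T (M' \<boxtimes>\<^bsub>S\<^esub> N') (M \<boxtimes>\<^bsub>S\<^esub> N) (tens_map M S N f g)"
proof (rule tens_right_linearI[OF assms(1,2) tens_right_module[OF assms(3,4)]])
  have p: "tensor_pair M' S N'" "tensor_pair M S N"
    using assms by (simp_all add: tensor_pairI two_sidedD)
  show "additive (M' \<boxtimes>\<^bsub>S\<^esub> N') (M \<boxtimes>\<^bsub>S\<^esub> N) (tens_map M S N f g)"
    by (rule tens_map_additive[OF p assms(5,6)])
  show "tens_map M S N f g (pure_tens M' S N' m (ract N' n t)) = ract (M \<boxtimes>\<^bsub>S\<^esub> N) (tens_map M S N f g (pure_tens M' S N' m n)) t"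
    if "t \<in> carrier T" "m \<in> carrier M'" "n \<in> carrier N'" for t m n
    using that assms(5-7) right_module.ract_closed[OF two_sidedD(2)[OF assms(2)]]
    by (simp add: tens_map_pure[OF p assms(5,6)] tens_ract_pure[OF assms(3,4)] left_linear_def right_linear_def Pi_iff)
qed

locale tensor_triple =
  X: right_module S X + Y: two_sided S Y T + Z: left_module T Z
  for X :: "('s, 'x, 'a) bimod" and S :: "('a, 'p) ring_scheme" and Y :: "('a, 'y, 'b) bimod"
    and T :: "('b, 'q) ring_scheme" and Z :: "('b, 'z, 'c) bimod"
begin

sublocale XY: tensor_pair X S Y by (intro tensor_pairI X.right_module_axioms Y.left_module_axioms)
sublocale YZ: tensor_pair Y T Z by (intro tensor_pairI Z.left_module_axioms Y.right_module_axioms)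

lemma XY_right: "right_module T (X \<boxtimes>\<^bsub>S\<^esub> Y)"
  by (rule tens_right_module[OF X.right_module_axioms Y.two_sided_axioms])

lemma YZ_left: "left_module S (Y \<boxtimes>\<^bsub>T\<^esub> Z)"
  by (rule tens_left_module[OF Y.two_sided_axioms Z.left_module_axioms])

sublocale XYZ: tensor_pair "X \<boxtimes>\<^bsub>S\<^esub> Y" T Z by (intro tensor_pairI XY_right Z.left_module_axioms)
sublocale X_YZ: tensor_pair X S "Y \<boxtimes>\<^bsub>T\<^esub> Z" by (intro tensor_pairI X.right_module_axioms YZ_left)

lemma tens3_ext:
  assumes f: "additive ((X \<boxtimes>\<^bsub>S\<^esub> Y) \<boxtimes>\<^bsub>T\<^esub> Z) G f" and g: "additive ((X \<boxtimes>\<^bsub>S\<^esub> Y) \<boxtimes>\<^bsub>T\<^esub> Z) G g"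
    and eq: "\<And>x y z. \<lbrakk>x \<in> carrier X; y \<in> carrier Y; z \<in> carrier Z\<rbrakk> \<Longrightarrow>
      f (pure_tens (X \<boxtimes>\<^bsub>S\<^esub> Y) T Z (pure_tens X S Y x y) z) = g (pure_tens (X \<boxtimes>\<^bsub>S\<^esub> Y) T Z (pure_tens X S Y x y) z)"
    and t: "t \<in> carrier ((X \<boxtimes>\<^bsub>S\<^esub> Y) \<boxtimes>\<^bsub>T\<^esub> Z)"
  shows "f t = g t"
proof (rule XYZ.tens_ext[OF f g _ t])
  fix w z assume w: "w \<in> carrier (X \<boxtimes>\<^bsub>S\<^esub> Y)" and z: "z \<in> carrier Z"
  have add: "additive (X \<boxtimes>\<^bsub>S\<^esub> Y) ((X \<boxtimes>\<^bsub>S\<^esub> Y) \<boxtimes>\<^bsub>T\<^esub> Z) (\<lambda>w. pure_tens (X \<boxtimes>\<^bsub>S\<^esub> Y) T Z w z)"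
    using XYZ.balanced_pure z by (simp add: balanced_def)
  show "f (pure_tens (X \<boxtimes>\<^bsub>S\<^esub> Y) T Z w z) = g (pure_tens (X \<boxtimes>\<^bsub>S\<^esub> Y) T Z w z)"
    by (rule XY.tens_ext[OF additive_comp[OF add f] additive_comp[OF add g] _ w]) (use eq z in auto)
qed

lemma tens3_ext':
  assumes f: "additive (X \<boxtimes>\<^bsub>S\<^esub> (Y \<boxtimes>\<^bsub>T\<^esub> Z)) G f" and g: "additive (X \<boxtimes>\<^bsub>S\<^esub> (Y \<boxtimes>\<^bsub>T\<^esub> Z)) G g"
    and eq: "\<And>x y z. \<lbrakk>x \<in> carrier X; y \<in> carrier Y; z \<in> carrier Z\<rbrakk> \<Longrightarrow>
      f (pure_tens X S (Y \<boxtimes>\<^bsub>T\<^esub> Z) x (pure_tens Y T Z y z)) = g (pure_tens X S (Y \<boxtimes>\<^bsub>T\<^esub> Z) x (pure_tens Y T Z y z))"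
    and t: "t \<in> carrier (X \<boxtimes>\<^bsub>S\<^esub> (Y \<boxtimes>\<^bsub>T\<^esub> Z))"
  shows "f t = g t"
proof (rule X_YZ.tens_ext[OF f g _ t])
  fix x w assume x: "x \<in> carrier X" and w: "w \<in> carrier (Y \<boxtimes>\<^bsub>T\<^esub> Z)"
  have add: "additive (Y \<boxtimes>\<^bsub>T\<^esub> Z) (X \<boxtimes>\<^bsub>S\<^esub> (Y \<boxtimes>\<^bsub>T\<^esub> Z)) (pure_tens X S (Y \<boxtimes>\<^bsub>T\<^esub> Z) x)"
    using X_YZ.balanced_pure x by (simp add: balanced_def)
  show "f (pure_tens X S (Y \<boxtimes>\<^bsub>T\<^esub> Z) x w) = g (pure_tens X S (Y \<boxtimes>\<^bsub>T\<^esub> Z) x w)"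
    by (rule YZ.tens_ext[OF additive_comp[OF add f] additive_comp[OF add g] _ w]) (use eq x in auto)
qed

text \<open>The map is a lift in two stages. For fixed \<open>z\<close> the assignment of x
  \<otimes> (y \<otimes> z) to \<open>x\<close> and \<open>y\<close> is balanced over
  \<open>S\<close>, and its lift \<open>?l w z\<close> is in turn balanced over \<open>T\<close> in
  \<open>w\<close> and \<open>z\<close>.\<close>

lemma
  shows assoc_additive: "additive ((X \<boxtimes>\<^bsub>S\<^esub> Y) \<boxtimes>\<^bsub>T\<^esub> Z) (X \<boxtimes>\<^bsub>S\<^esub> (Y \<boxtimes>\<^bsub>T\<^esub> Z)) (assoc X S Y T Z)"
    and assoc_pure: "\<lbrakk>x \<in> carrier X; y \<in> carrier Y; z \<in> carrier Z\<rbrakk> \<Longrightarrow>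
      assoc X S Y T Z (pure_tens (X \<boxtimes>\<^bsub>S\<^esub> Y) T Z (pure_tens X S Y x y) z)
      = pure_tens X S (Y \<boxtimes>\<^bsub>T\<^esub> Z) x (pure_tens Y T Z y z)"
proof -
  let ?G = "X \<boxtimes>\<^bsub>S\<^esub> (Y \<boxtimes>\<^bsub>T\<^esub> Z)"
  let ?p = "\<lambda>z x y. pure_tens X S (Y \<boxtimes>\<^bsub>T\<^esub> Z) x (pure_tens Y T Z y z)"
  let ?l = "\<lambda>w z. tens_lift ?G (?p z) w"
  interpret G: abelian_group ?G by (rule X_YZ.tens_abelian_group)
  have add: "additive Y ?G (?p z x)" "additive Z ?G (\<lambda>z. ?p z x y)" "additive X ?G (\<lambda>x. ?p z x y)"
    if "x \<in> carrier X" "y \<in> carrier Y" "z \<in> carrier Z" for x y z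
  proof -
    have x: "additive (Y \<boxtimes>\<^bsub>T\<^esub> Z) ?G (pure_tens X S (Y \<boxtimes>\<^bsub>T\<^esub> Z) x)"
      using that X_YZ.balanced_pure by (simp add: balanced_def)
    show "additive Y ?G (?p z x)" "additive Z ?G (\<lambda>z. ?p z x y)"
      by (rule additive_comp[OF _ x]; use that YZ.balanced_pure in \<open>simp add: balanced_def\<close>)+
    show "additive X ?G (\<lambda>x. ?p z x y)"
      using that X_YZ.balanced_pure YZ.pure_closed[of y z] by (simp add: balanced_def)
  qed
  have b: "balanced X S Y ?G (?p z)" if "z \<in> carrier Z" for z
  proof (rule balancedI)
    fix x s y assume "x \<in> carrier X" "s \<in> carrier S" "y \<in> carrier Y"
    with that show "?p z (ract X x s) y = ?p z x (lact Y s y)"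
      by (simp add: X_YZ.pure_balanced YZ.pure_closed
          tens_lact_pure[OF Y.two_sided_axioms Z.left_module_axioms])
  \<comment> \<open>\<open>add\<close> bundles three additivity statements about a full triple; zero
    fills the coordinate on which the statement at hand does not depend.\<close>
  qed (use add(1)[OF _ Y.M.zero_closed that] add(3)[OF X.M.zero_closed _ that] in auto)
  note lift = XY.tens_lift_additive[OF G.abelian_group_axioms b]
    XY.tens_lift_pure[OF G.abelian_group_axioms b]
  have ext: "f w = g w" if "additive (X \<boxtimes>\<^bsub>S\<^esub> Y) ?G f" "additive (X \<boxtimes>\<^bsub>S\<^esub> Y) ?G g" "w \<in> carrier (X \<boxtimes>\<^bsub>S\<^esub> Y)"
    "\<And>x y. \<lbrakk>x \<in> carrier X; y \<in> carrier Y\<rbrakk> \<Longrightarrow> f (pure_tens X S Y x y) = g (pure_tens X S Y x y)" for f g w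
    using XY.tens_ext that by blast
  \<comment> \<open>Additivity in \<open>z\<close> and balancing over \<open>T\<close> are equations
    between additive maps in \<open>w\<close>, so they are tested on pure tensors x \<otimes> y,
    where the inner lift is explicit.\<close>
  have b': "balanced (X \<boxtimes>\<^bsub>S\<^esub> Y) T Z ?G ?l"
  proof (rule balancedI)
    fix w assume w: "w \<in> carrier (X \<boxtimes>\<^bsub>S\<^esub> Y)"
    show "additive Z ?G (?l w)"
    proof (rule additiveI)
      show "?l w z \<in> carrier ?G" if "z \<in> carrier Z" for z
        using lift(1)[OF that] w by (rule additive_closed)
      fix z z' assume zz: "z \<in> carrier Z" "z' \<in> carrier Z"
      then have "additive (X \<boxtimes>\<^bsub>S\<^esub> Y) ?G (\<lambda>w. ?l w z \<oplus>\<^bsub>?G\<^esub> ?l w z')"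
        by (intro additive_plus G.abelian_group_axioms lift)
      from ext[OF lift(1) this w, of "z \<oplus>\<^bsub>Z\<^esub> z'"] show "?l w (z \<oplus>\<^bsub>Z\<^esub> z') = ?l w z \<oplus>\<^bsub>?G\<^esub> ?l w z'"
        using zz additive_add[OF add(2)] by (simp add: lift(2))
    qed
  next
    fix w s z assume A: "w \<in> carrier (X \<boxtimes>\<^bsub>S\<^esub> Y)" "s \<in> carrier T" "z \<in> carrier Z"
    show "?l (ract (X \<boxtimes>\<^bsub>S\<^esub> Y) w s) z = ?l w (lact Z s z)"
      by (rule ext[OF additive_comp[OF tens_ract_additive[OF X.right_module_axioms Y.two_sided_axioms A(2)]
              lift(1)[OF A(3)]] lift(1)[OF Z.lact_closed[OF A(2,3)]] A(1)])
        (simp add: A lift(2) Z.lact_closed Y.ract_closed YZ.pure_balanced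
          tens_ract_pure[OF X.right_module_axioms Y.two_sided_axioms])
  qed (rule lift(1))
  show "additive ((X \<boxtimes>\<^bsub>S\<^esub> Y) \<boxtimes>\<^bsub>T\<^esub> Z) ?G (assoc X S Y T Z)"
    unfolding assoc_def by (rule XYZ.tens_lift_additive[OF G.abelian_group_axioms b'])
  show "assoc X S Y T Z (pure_tens (X \<boxtimes>\<^bsub>S\<^esub> Y) T Z (pure_tens X S Y x y) z)
      = pure_tens X S (Y \<boxtimes>\<^bsub>T\<^esub> Z) x (pure_tens Y T Z y z)"
    if "x \<in> carrier X" "y \<in> carrier Y" "z \<in> carrier Z"
    using that XYZ.tens_lift_pure[OF G.abelian_group_axioms b'] XY.pure_closed
    by (simp add: assoc_def lift(2))
qed

lemma
  shows assoc_inv_additive: "additive (X \<boxtimes>\<^bsub>S\<^esub> (Y \<boxtimes>\<^bsub>T\<^esub> Z)) ((X \<boxtimes>\<^bsub>S\<^esub> Y) \<boxtimes>\<^bsub>T\<^esub> Z) (assoc_inv X S Y T Z)"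
    and assoc_inv_pure: "\<lbrakk>x \<in> carrier X; y \<in> carrier Y; z \<in> carrier Z\<rbrakk> \<Longrightarrow>
      assoc_inv X S Y T Z (pure_tens X S (Y \<boxtimes>\<^bsub>T\<^esub> Z) x (pure_tens Y T Z y z))
      = pure_tens (X \<boxtimes>\<^bsub>S\<^esub> Y) T Z (pure_tens X S Y x y) z"
proof -
  let ?G = "(X \<boxtimes>\<^bsub>S\<^esub> Y) \<boxtimes>\<^bsub>T\<^esub> Z"
  let ?p = "\<lambda>x y z. pure_tens (X \<boxtimes>\<^bsub>S\<^esub> Y) T Z (pure_tens X S Y x y) z"
  let ?l = "\<lambda>x w. tens_lift ?G (?p x) w"
  interpret G: abelian_group ?G by (rule XYZ.tens_abelian_group)
  have add: "additive Z ?G (?p x y)" "additive Y ?G (\<lambda>y. ?p x y z)" "additive X ?G (\<lambda>x. ?p x y z)"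
    if "x \<in> carrier X" "y \<in> carrier Y" "z \<in> carrier Z" for x y z
  proof -
    have z: "additive (X \<boxtimes>\<^bsub>S\<^esub> Y) ?G (\<lambda>w. pure_tens (X \<boxtimes>\<^bsub>S\<^esub> Y) T Z w z)"
      using that XYZ.balanced_pure by (simp add: balanced_def)
    show "additive Y ?G (\<lambda>y. ?p x y z)" "additive X ?G (\<lambda>x. ?p x y z)"
      by (rule additive_comp[OF _ z]; use that XY.balanced_pure in \<open>simp add: balanced_def\<close>)+
    show "additive Z ?G (?p x y)"
      using that XYZ.balanced_pure XY.pure_closed[of x y] by (simp add: balanced_def)
  qed
  have b: "balanced Y T Z ?G (?p x)" if "x \<in> carrier X" for x
  proof (rule balancedI)
    fix y s z assume "y \<in> carrier Y" "s \<in> carrier T" "z \<in> carrier Z"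
    with that show "?p x (ract Y y s) z = ?p x y (lact Z s z)"
      by (simp add: XYZ.pure_balanced[symmetric] XY.pure_closed
          tens_ract_pure[OF X.right_module_axioms Y.two_sided_axioms])
  qed (use add(1)[OF that _ Z.M.zero_closed] add(2)[OF that Y.M.zero_closed] in auto)
  note lift = YZ.tens_lift_additive[OF G.abelian_group_axioms b]
    YZ.tens_lift_pure[OF G.abelian_group_axioms b]
  have ext: "f w = g w" if "additive (Y \<boxtimes>\<^bsub>T\<^esub> Z) ?G f" "additive (Y \<boxtimes>\<^bsub>T\<^esub> Z) ?G g" "w \<in> carrier (Y \<boxtimes>\<^bsub>T\<^esub> Z)"
    "\<And>x y. \<lbrakk>x \<in> carrier Y; y \<in> carrier Z\<rbrakk> \<Longrightarrow> f (pure_tens Y T Z x y) = g (pure_tens Y T Z x y)" for f g w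
    using YZ.tens_ext that by blast
  have b': "balanced X S (Y \<boxtimes>\<^bsub>T\<^esub> Z) ?G ?l"
  proof (rule balancedI)
    fix w assume w: "w \<in> carrier (Y \<boxtimes>\<^bsub>T\<^esub> Z)"
    show "additive X ?G (\<lambda>x. ?l x w)"
    proof (rule additiveI)
      show "?l x w \<in> carrier ?G" if "x \<in> carrier X" for x
        using lift(1)[OF that] w by (rule additive_closed)
      fix x x' assume xx: "x \<in> carrier X" "x' \<in> carrier X"
      then have "additive (Y \<boxtimes>\<^bsub>T\<^esub> Z) ?G (\<lambda>w. ?l x w \<oplus>\<^bsub>?G\<^esub> ?l x' w)"
        by (intro additive_plus G.abelian_group_axioms lift)
      from ext[OF lift(1) this w, of "x \<oplus>\<^bsub>X\<^esub> x'"] show "?l (x \<oplus>\<^bsub>X\<^esub> x') w = ?l x w \<oplus>\<^bsub>?G\<^esub> ?l x' w"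
        using xx by (simp add: lift(2) XY.pure_add_left XY.pure_closed XYZ.pure_add_left)
    qed
  next
    fix x s w assume A: "x \<in> carrier X" "s \<in> carrier S" "w \<in> carrier (Y \<boxtimes>\<^bsub>T\<^esub> Z)"
    show "?l (ract X x s) w = ?l x (lact (Y \<boxtimes>\<^bsub>T\<^esub> Z) s w)"
      by (rule ext[OF lift(1)[OF X.ract_closed[OF A(2,1)]] additive_comp[OF
              tens_lact_additive[OF Y.two_sided_axioms Z.left_module_axioms A(2)] lift(1)[OF A(1)]] A(3)])
        (simp add: A lift(2) X.ract_closed Y.lact_closed XY.pure_balanced
          tens_lact_pure[OF Y.two_sided_axioms Z.left_module_axioms])
  qed (rule lift(1))
  show "additive (X \<boxtimes>\<^bsub>S\<^esub> (Y \<boxtimes>\<^bsub>T\<^esub> Z)) ?G (assoc_inv X S Y T Z)"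
    unfolding assoc_inv_def by (rule X_YZ.tens_lift_additive[OF G.abelian_group_axioms b'])
  show "assoc_inv X S Y T Z (pure_tens X S (Y \<boxtimes>\<^bsub>T\<^esub> Z) x (pure_tens Y T Z y z))
      = pure_tens (X \<boxtimes>\<^bsub>S\<^esub> Y) T Z (pure_tens X S Y x y) z"
    if "x \<in> carrier X" "y \<in> carrier Y" "z \<in> carrier Z"
    using that X_YZ.tens_lift_pure[OF G.abelian_group_axioms b'] YZ.pure_closed
    by (simp add: assoc_inv_def lift(2))
qed

lemma assoc_assoc_inv:
  "t \<in> carrier (X \<boxtimes>\<^bsub>S\<^esub> (Y \<boxtimes>\<^bsub>T\<^esub> Z)) \<Longrightarrow> assoc X S Y T Z (assoc_inv X S Y T Z t) = t"
  by (rule tens3_ext'[OF additive_comp[OF assoc_inv_additive assoc_additive] additive_id(1)])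
    (simp_all add: assoc_pure assoc_inv_pure)

lemma assoc_inv_assoc:
  "t \<in> carrier ((X \<boxtimes>\<^bsub>S\<^esub> Y) \<boxtimes>\<^bsub>T\<^esub> Z) \<Longrightarrow> assoc_inv X S Y T Z (assoc X S Y T Z t) = t"
  by (rule tens3_ext[OF additive_comp[OF assoc_additive assoc_inv_additive] additive_id(1)])
    (simp_all add: assoc_pure assoc_inv_pure)

end

lemma tensor_tripleI: "right_module S X \<Longrightarrow> two_sided S Y T \<Longrightarrow> left_module T Z \<Longrightarrow> tensor_triple X S Y T Z"
  by (simp add: tensor_triple_def)

lemma assoc_left_linear:
  assumes X: "two_sided Q X S" and Y: "two_sided S Y T" and Z: "left_module T Z"
  shows "left_linear Q ((X \<boxtimes>\<^bsub>S\<^esub> Y) \<boxtimes>\<^bsub>T\<^esub> Z) (X \<boxtimes>\<^bsub>S\<^esub> (Y \<boxtimes>\<^bsub>T\<^esub> Z)) (assoc X S Y T Z)"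
proof -
  interpret tensor_triple X S Y T Z using assms by (simp add: tensor_tripleI two_sidedD)
  interpret X: two_sided Q X S by fact
  have XY: "two_sided Q (X \<boxtimes>\<^bsub>S\<^esub> Y) T" using X Y by (rule tens_two_sided)
  have "assoc X S Y T Z (lact ((X \<boxtimes>\<^bsub>S\<^esub> Y) \<boxtimes>\<^bsub>T\<^esub> Z) q w) = lact (X \<boxtimes>\<^bsub>S\<^esub> (Y \<boxtimes>\<^bsub>T\<^esub> Z)) q (assoc X S Y T Z w)"
    if q: "q \<in> carrier Q" and w: "w \<in> carrier ((X \<boxtimes>\<^bsub>S\<^esub> Y) \<boxtimes>\<^bsub>T\<^esub> Z)" for q w
    by (rule tens3_ext[OF additive_comp[OF tens_lact_additive[OF XY Z q] assoc_additive]
          additive_comp[OF assoc_additive tens_lact_additive[OF X YZ_left q]] _ w])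
      (simp add: tens_lact_pure[OF XY Z] tens_lact_pure[OF X Y.left_module_axioms] tens_lact_pure[OF X YZ_left]
        q XY.pure_closed YZ.pure_closed assoc_pure X.lact_closed)
  then show ?thesis by (simp add: left_linear_iff assoc_additive)
qed

lemma assoc_inv_right_linear:
  assumes X: "right_module S X" and Y: "two_sided S Y T" and Z: "two_sided T Z Q"
  shows "right_linear Q (X \<boxtimes>\<^bsub>S\<^esub> (Y \<boxtimes>\<^bsub>T\<^esub> Z)) ((X \<boxtimes>\<^bsub>S\<^esub> Y) \<boxtimes>\<^bsub>T\<^esub> Z) (assoc_inv X S Y T Z)"
proof -
  interpret tensor_triple X S Y T Z using assms by (simp add: tensor_tripleI two_sidedD)
  interpret Z: two_sided T Z Q by fact
  have YZ: "two_sided S (Y \<boxtimes>\<^bsub>T\<^esub> Z) Q" using Y Z by (rule tens_two_sided)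
  have "assoc_inv X S Y T Z (ract (X \<boxtimes>\<^bsub>S\<^esub> (Y \<boxtimes>\<^bsub>T\<^esub> Z)) w q) = ract ((X \<boxtimes>\<^bsub>S\<^esub> Y) \<boxtimes>\<^bsub>T\<^esub> Z) (assoc_inv X S Y T Z w) q"
    if q: "q \<in> carrier Q" and w: "w \<in> carrier (X \<boxtimes>\<^bsub>S\<^esub> (Y \<boxtimes>\<^bsub>T\<^esub> Z))" for q w
    by (rule tens3_ext'[OF additive_comp[OF tens_ract_additive[OF X YZ q] assoc_inv_additive]
          additive_comp[OF assoc_inv_additive tens_ract_additive[OF XY_right Z q]] _ w])
      (simp add: tens_ract_pure[OF X YZ] tens_ract_pure[OF Y.right_module_axioms Z] tens_ract_pure[OF XY_right Z]
        q XY.pure_closed YZ.pure_closed assoc_inv_pure Z.ract_closed)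
  then show ?thesis by (simp add: right_linear_iff assoc_inv_additive)
qed

lemma regular_simps [simp]:
  "carrier (regular S) = carrier S" "mult (regular S) = mult S" "one (regular S) = one S"
  "zero (regular S) = zero S" "add (regular S) = add S" "lact (regular S) = mult S" "ract (regular S) = mult S"
  by (simp_all add: regular_def)

lemma regular_two_sided:
  assumes "ring S"
  shows "two_sided S (regular S) S"
proof -
  interpret ring S by fact
  interpret M: abelian_group "regular S"
    by (rule abelian_groupI) (auto simp: a_ac intro: add.l_inv_ex)
  show ?thesis
    by unfold_locales (auto simp: l_distr r_distr m_assoc)
qed

lemma lunit:
  assumes M: "left_module S M"
  shows lunit_additive: "additive (regular S \<boxtimes>\<^bsub>S\<^esub> M) M (lunit M)"
    and lunit_pure: "\<lbrakk>s \<in> carrier S; m \<in> carrier M\<rbrakk> \<Longrightarrow> lunit M (pure_tens (regular S) S M s m) = lact M s m"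
proof -
  interpret M: left_module S M by fact
  interpret T: tensor_pair "regular S" S M
    using regular_two_sided[OF M.ring_axioms] M by (simp add: tensor_pairI two_sidedD)
  have b: "balanced (regular S) S M M (lact M)"
    using additive_lact[OF M] additive_lact'[OF M] by (auto intro!: balancedI simp: additive_def M.lact_mult)
  show "additive (regular S \<boxtimes>\<^bsub>S\<^esub> M) M (lunit M)"
    unfolding lunit_def by (rule T.tens_lift_additive[OF M.M.abelian_group_axioms b])
  show "\<lbrakk>s \<in> carrier S; m \<in> carrier M\<rbrakk> \<Longrightarrow> lunit M (pure_tens (regular S) S M s m) = lact M s m"
    unfolding lunit_def using T.tens_lift_pure[OF M.M.abelian_group_axioms b] by simp
qed

lemma runit:
  assumes M: "right_module S M"
  shows runit_additive: "additive (M \<boxtimes>\<^bsub>S\<^esub> regular S) M (runit M)"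
    and runit_pure: "\<lbrakk>m \<in> carrier M; s \<in> carrier S\<rbrakk> \<Longrightarrow> runit M (pure_tens M S (regular S) m s) = ract M m s"
proof -
  interpret M: right_module S M by fact
  interpret T: tensor_pair M S "regular S"
    using regular_two_sided[OF M.ring_axioms] M by (simp add: tensor_pairI two_sidedD)
  have b: "balanced M S (regular S) M (ract M)"
    using additive_ract[OF M] additive_ract'[OF M] by (auto intro!: balancedI simp: additive_def M.ract_mult)
  show "additive (M \<boxtimes>\<^bsub>S\<^esub> regular S) M (runit M)"
    unfolding runit_def by (rule T.tens_lift_additive[OF M.M.abelian_group_axioms b])
  show "\<lbrakk>m \<in> carrier M; s \<in> carrier S\<rbrakk> \<Longrightarrow> runit M (pure_tens M S (regular S) m s) = ract M m s"
    unfolding runit_def using T.tens_lift_pure[OF M.M.abelian_group_axioms b] by simp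
qed

section \<open>Generators, transport of structure along injections, and direct sums\<close>

section \<open>Direct sums and transport of modules\<close>

lemma additive_ext_generate:
  assumes "abelian_group M" "abelian_group G" "additive M G f" "additive M G g"
    and "X \<subseteq> carrier M" "\<And>x. x \<in> X \<Longrightarrow> f x = g x" "m \<in> generate (add_monoid M) X"
  shows "f m = g m"
proof -
  interpret M: abelian_group M by fact
  show ?thesis
    using assms(7)
  proof (induction m rule: generate.induct)
    case one
    then show ?case using assms(1-4) by (simp add: additive_zero)
  next
    case (incl x)
    then show ?case by (rule assms(6))
  next
    case (inv x)
    then have "x \<in> carrier M" using assms(5) by auto
    then show ?case
      using additive_minus[OF assms(1-3)] additive_minus[OF assms(1,2,4)] assms(6)[OF inv] by (simp add: a_inv_def)
  next
    case (eng x y)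
    have "x \<in> carrier M" "y \<in> carrier M"
      using M.add.generate_in_carrier[of X] assms(5) eng(1,2) by auto
    then show ?case using eng additive_add[OF assms(3)] additive_add[OF assms(4)] by simp
  qed
qed

lemma generate_subset_image:
  assumes "abelian_group M" "abelian_group G" "additive M G f" "X \<subseteq> f ` carrier M"
  shows "generate (add_monoid G) X \<subseteq> f ` carrier M"
proof
  interpret M: abelian_group M by fact
  fix y assume "y \<in> generate (add_monoid G) X"
  then show "y \<in> f ` carrier M"
  proof (induction y rule: generate.induct)
    case one
    then show ?case using additive_zero[OF assms(1-3)] M.zero_closed by (metis image_eqI monoid.simps(2))
  next
    case (incl x)
    then show ?case using assms(4) by blast
  next
    case (inv x)
    then obtain m where "m \<in> carrier M" "x = f m" using assms(4) by blast
    then show ?case using additive_minus[OF assms(1-3)] M.a_inv_closed by (metis a_inv_def image_eqI)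
  next
    case (eng x y)
    then obtain m n where "m \<in> carrier M" "x = f m" "n \<in> carrier M" "y = f n" by blast
    then show ?case using additive_add[OF assms(3)] M.a_closed by (metis image_eqI monoid.simps(1))
  qed
qed

text \<open>The maps \<open>f\<close> and \<open>g\<close> re-index the scalars. On the side that
  carries the module structure the identity is used. The other scalar type has to become
  \<open>unit\<close>, since that is the shape over which projectivity quantifies, and a constant
  map serves there.\<close>

definition transport :: "('s' \<Rightarrow> 's) \<Rightarrow> ('t' \<Rightarrow> 't) \<Rightarrow> ('m \<Rightarrow> 'u) \<Rightarrow> ('s, 'm, 't) bimod \<Rightarrow> ('s', 'u, 't') bimod" where
  "transport f g j M =
     (let i = inv_into (carrier M) j in
     \<lparr>carrier = j ` carrier M, mult = undefined, one = undefined, zero = j \<zero>\<^bsub>M\<^esub>,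
      add = (\<lambda>u v. j (i u \<oplus>\<^bsub>M\<^esub> i v)),
      lact = (\<lambda>s u. j (lact M (f s) (i u))), ract = (\<lambda>u t. j (ract M (i u) (g t)))\<rparr>)"

lemma transport_simps:
  "carrier (transport f g j M) = j ` carrier M"
  "zero (transport f g j M) = j \<zero>\<^bsub>M\<^esub>"
  "add (transport f g j M) u v = j (inv_into (carrier M) j u \<oplus>\<^bsub>M\<^esub> inv_into (carrier M) j v)"
  "lact (transport f g j M) s u = j (lact M (f s) (inv_into (carrier M) j u))"
  "ract (transport f g j M) u t = j (ract M (inv_into (carrier M) j u) (g t))"
  by (simp_all add: transport_def Let_def)

lemma transport_abelian_group:
  assumes "abelian_group M" "inj_on j (carrier M)"
  shows "abelian_group (transport f g j M)"
proof -
  interpret M: abelian_group M by fact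
  have inv: "\<exists>y\<in>carrier M. j (x \<oplus>\<^bsub>M\<^esub> y) = j \<zero>\<^bsub>M\<^esub>" if "x \<in> carrier M" for x
    using M.add.r_inv_ex[of x] that by metis
  show ?thesis
    by (intro abelian_groupI) (use assms(2) inv in \<open>auto simp: transport_simps M.a_ac\<close>)
qed

lemma transport_right_module:
  assumes "right_module S M" "inj_on j (carrier M)"
  shows "right_module S (transport f id j M)"
proof -
  interpret M: right_module S M by fact
  interpret T: abelian_group "transport f id j M"
    by (rule transport_abelian_group[OF M.M.abelian_group_axioms assms(2)])
  show ?thesis
    by unfold_locales
      (use assms(2) in \<open>auto simp: transport_simps M.ract_closed M.ract_add_left M.ract_add_right M.ract_mult M.ract_one\<close>)
qed

lemma transport_right_linear:
  assumes "right_module S M" "inj_on j (carrier M)"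
  shows "right_linear S M (transport f id j M) j"
    and "right_linear S (transport f id j M) M (inv_into (carrier M) j)"
proof -
  interpret M: right_module S M by fact
  show "right_linear S M (transport f id j M) j" "right_linear S (transport f id j M) M (inv_into (carrier M) j)"
    using assms(2) by (auto simp: right_linear_def transport_simps M.ract_closed)
qed

text \<open>Elements are extensional on \<open>I\<close>, so that equality is equality of
  coordinates. Finite support makes the sums in maps out of the direct sum meaningful and allows an
  encoding by finite lists.\<close>

definition dsum :: "'i set \<Rightarrow> ('s, 'm, 't) bimod \<Rightarrow> ('s, 'i \<Rightarrow> 'm, 't) bimod" where
  "dsum I M =
     \<lparr>carrier = {f \<in> I \<rightarrow>\<^sub>E carrier M. fin_supp M I f}, mult = undefined, one = undefined,
      zero = (\<lambda>i\<in>I. \<zero>\<^bsub>M\<^esub>), add = (\<lambda>f g. \<lambda>i\<in>I. f i \<oplus>\<^bsub>M\<^esub> g i),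
      lact = (\<lambda>s f. \<lambda>i\<in>I. lact M s (f i)), ract = (\<lambda>f t. \<lambda>i\<in>I. ract M (f i) t)\<rparr>"

definition dsum_incl :: "'i set \<Rightarrow> ('s, 'm, 't) bimod \<Rightarrow> 'i \<Rightarrow> 'm \<Rightarrow> 'i \<Rightarrow> 'm" where
  "dsum_incl I M i m = (\<lambda>x\<in>I. if x = i then m else \<zero>\<^bsub>M\<^esub>)"

lemma dsum_simps [simp]:
  "zero (dsum I M) = (\<lambda>i\<in>I. \<zero>\<^bsub>M\<^esub>)"
  "add (dsum I M) f g = (\<lambda>i\<in>I. f i \<oplus>\<^bsub>M\<^esub> g i)"
  "lact (dsum I M) s f = (\<lambda>i\<in>I. lact M s (f i))"
  "ract (dsum I M) f t = (\<lambda>i\<in>I. ract M (f i) t)"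
  by (simp_all add: dsum_def)

lemma dsum_carrier: "f \<in> carrier (dsum I M) \<longleftrightarrow> f \<in> I \<rightarrow>\<^sub>E carrier M \<and> fin_supp M I f"
  by (simp add: dsum_def)

lemma dsum_carrierD: "f \<in> carrier (dsum I M) \<Longrightarrow> i \<in> I \<Longrightarrow> f i \<in> carrier M"
  by (auto simp: dsum_carrier)

lemma dsum_abelian_group:
  assumes "abelian_group M"
  shows "abelian_group (dsum I M)"
proof -
  interpret M: abelian_group M by fact
  have "group (add_monoid M)" by (rule M.a_group)
  then have S: "group (sum_group I (\<lambda>_. add_monoid M))" by simp
  \<comment> \<open>The carrier is that of \<open>sum_group\<close>, from which closure under
    addition and the existence of inverses are inherited.\<close>
  have eq: "carrier (dsum I M) = carrier (sum_group I (\<lambda>_. add_monoid M))"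
    using M.a_group by (auto simp: carrier_sum_group dsum_carrier)
  show ?thesis
  proof (rule abelian_groupI)
    fix f g h assume fgh: "f \<in> carrier (dsum I M)" "g \<in> carrier (dsum I M)" "h \<in> carrier (dsum I M)"
    show "f \<oplus>\<^bsub>dsum I M\<^esub> g \<in> carrier (dsum I M)"
      using fgh monoid.m_closed[OF group.is_monoid[OF S], of f g] by (simp add: eq)
    show "f \<oplus>\<^bsub>dsum I M\<^esub> g \<oplus>\<^bsub>dsum I M\<^esub> h = f \<oplus>\<^bsub>dsum I M\<^esub> (g \<oplus>\<^bsub>dsum I M\<^esub> h)"
      using dsum_carrierD[OF fgh(1)] dsum_carrierD[OF fgh(2)] dsum_carrierD[OF fgh(3)]
      by (auto simp: M.a_assoc fun_eq_iff restrict_def)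
  next
    fix f g assume fg: "f \<in> carrier (dsum I M)" "g \<in> carrier (dsum I M)"
    show "f \<oplus>\<^bsub>dsum I M\<^esub> g = g \<oplus>\<^bsub>dsum I M\<^esub> f"
      using dsum_carrierD[OF fg(1)] dsum_carrierD[OF fg(2)] by (auto simp: M.a_comm fun_eq_iff restrict_def)
  next
    show "\<zero>\<^bsub>dsum I M\<^esub> \<in> carrier (dsum I M)" by (simp add: dsum_carrier)
  next
    fix f assume f: "f \<in> carrier (dsum I M)"
    then show "\<zero>\<^bsub>dsum I M\<^esub> \<oplus>\<^bsub>dsum I M\<^esub> f = f"
      by (auto simp: dsum_carrier PiE_iff extensional_def fun_eq_iff restrict_def)
    show "\<exists>g\<in>carrier (dsum I M). g \<oplus>\<^bsub>dsum I M\<^esub> f = \<zero>\<^bsub>dsum I M\<^esub>"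
      using f group.l_inv_ex[OF S, of f] by (simp add: eq)
  qed
qed

lemma dsum_incl_closed:
  "abelian_group M \<Longrightarrow> m \<in> carrier M \<Longrightarrow> dsum_incl I M i m \<in> carrier (dsum I M)"
  using finite_subset[of "{x \<in> I. dsum_incl I M i m x \<noteq> \<zero>\<^bsub>M\<^esub>}" "{i}"]
  by (auto simp: dsum_carrier dsum_incl_def abelian_monoid.zero_closed[OF abelian_group.axioms(1)])

lemma dsum_incl_additive:
  assumes "abelian_group M"
  shows "additive M (dsum I M) (dsum_incl I M i)"
proof -
  interpret M: abelian_group M by fact
  show ?thesis
    by (rule additiveI[OF dsum_incl_closed[OF assms]]) (auto simp: dsum_incl_def fun_eq_iff)
qed

lemma dsum_proj_additive: "i \<in> I \<Longrightarrow> additive (dsum I M) M (\<lambda>f. f i)"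
  by (rule additiveI) (simp_all add: dsum_carrierD)

text \<open>This is the map out of the direct sum induced by the family \<open>g\<close>. The
  support of the summands stays finite because each \<open>g i\<close> sends zero to zero.\<close>

lemma dsum_copair_additive:
  assumes "abelian_group M" "abelian_group G" "\<And>i. i \<in> I \<Longrightarrow> additive M G (g i)"
  shows "additive (dsum I M) G (\<lambda>f. fsum G I (\<lambda>i. g i (f i)))"
proof (rule additiveI)
  interpret G: abelian_group G by fact
  have closed: "(\<lambda>i. g i (f i)) \<in> I \<rightarrow> carrier G" if "f \<in> carrier (dsum I M)" for f
    using dsum_carrierD[OF that] additive_closed[OF assms(3)] by auto
  have fin: "fin_supp G I (\<lambda>i. g i (f i))" if "f \<in> carrier (dsum I M)" for f
    by (rule fin_supp_map[where G=M and I=I and h=f]) (use that additive_zero[OF assms(1,2,3)] in \<open>auto simp: dsum_carrier\<close>)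
  show "fsum G I (\<lambda>i. g i (f i)) \<in> carrier G" if "f \<in> carrier (dsum I M)" for f
    using closed[OF that] by (rule G.fsum_closed)
  fix f h assume fh: "f \<in> carrier (dsum I M)" "h \<in> carrier (dsum I M)"
  have "fsum G I (\<lambda>i. g i ((f \<oplus>\<^bsub>dsum I M\<^esub> h) i)) = fsum G I (\<lambda>i. g i (f i) \<oplus>\<^bsub>G\<^esub> g i (h i))"
    by (rule G.fsum_cong[symmetric])
      (use closed fh additive_add[OF assms(3)] dsum_carrierD[OF fh(1)] dsum_carrierD[OF fh(2)] in \<open>auto simp: Pi_iff\<close>)
  also have "\<dots> = fsum G I (\<lambda>i. g i (f i)) \<oplus>\<^bsub>G\<^esub> fsum G I (\<lambda>i. g i (h i))"
    using fh by (intro G.fsum_add fin closed)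
  finally show "fsum G I (\<lambda>i. g i ((f \<oplus>\<^bsub>dsum I M\<^esub> h) i))
      = fsum G I (\<lambda>i. g i (f i)) \<oplus>\<^bsub>G\<^esub> fsum G I (\<lambda>i. g i (h i))" .
qed

lemma dsum_copair_incl:
  assumes "abelian_group M" "abelian_group G" "\<And>i. i \<in> I \<Longrightarrow> additive M G (g i)" "i \<in> I" "m \<in> carrier M"
  shows "fsum G I (\<lambda>x. g x (dsum_incl I M i m x)) = g i m"
proof -
  interpret G: abelian_group G by fact
  have "fsum G I (\<lambda>x. g x (dsum_incl I M i m x)) = fsum G I (\<lambda>x. if x = i then g i m else \<zero>\<^bsub>G\<^esub>)"
    by (rule G.fsum_cong)
      (use assms additive_closed[OF assms(3)] additive_zero[OF assms(1-3)] in \<open>auto simp: dsum_incl_def\<close>)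
  also have "\<dots> = g i m"
    using assms additive_closed[OF assms(3)] by (intro G.fsum_single) auto
  finally show ?thesis .
qed

text \<open>Induction on the finite support: subtracting the coordinate at one index leaves an
  element with smaller support, and an element with empty support is zero by extensionality.\<close>

lemma dsum_generate:
  assumes "abelian_group M"
  shows "carrier (dsum I M) \<subseteq> generate (add_monoid (dsum I M)) {dsum_incl I M i m |i m. i \<in> I \<and> m \<in> carrier M}"
    (is "_ \<subseteq> ?gen")
proof -
  interpret M: abelian_group M by fact
  interpret D: abelian_group "dsum I M" using assms by (rule dsum_abelian_group)
  have "f \<in> ?gen" if "finite J" "{i \<in> I. f i \<noteq> \<zero>\<^bsub>M\<^esub>} = J" "f \<in> carrier (dsum I M)" for J f
    using that
  proof (induction J arbitrary: f rule: finite_induct)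
    case empty
    then have "f = \<zero>\<^bsub>dsum I M\<^esub>" by (auto simp: dsum_carrier PiE_iff extensional_def fun_eq_iff)
    then show ?case using generate.one[of "add_monoid (dsum I M)"] by (simp del: dsum_simps)
  next
    case (insert j J)
    let ?g = "\<lambda>i\<in>I. if i = j then \<zero>\<^bsub>M\<^esub> else f i"
    have j: "j \<in> I" "f j \<in> carrier M" using insert.prems dsum_carrierD[OF insert.prems(2)] by auto
    have supp: "{i \<in> I. ?g i \<noteq> \<zero>\<^bsub>M\<^esub>} = J" using insert.prems(1) insert.hyps(2) by auto
    then have "?g \<in> carrier (dsum I M)"
      using insert.prems(2) insert.hyps(1) by (auto simp: dsum_carrier)
    then have "?g \<in> ?gen" using insert.IH supp by blast
    moreover have "dsum_incl I M j (f j) \<in> ?gen" using j by (intro generate.incl) blast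
    moreover have "f = dsum_incl I M j (f j) \<oplus>\<^bsub>dsum I M\<^esub> ?g"
      using dsum_carrierD[OF insert.prems(2)] insert.prems(2)
      by (auto simp: dsum_carrier PiE_iff extensional_def fun_eq_iff dsum_incl_def)
    ultimately show ?case using generate.eng[of "dsum_incl I M j (f j)" "add_monoid (dsum I M)" _ ?g] by (simp del: dsum_simps)
  qed
  then show ?thesis by (auto simp: dsum_carrier)
qed

lemma dsum_right_module:
  assumes "right_module S M"
  shows "right_module S (dsum I M)"
proof -
  interpret M: right_module S M by fact
  interpret D: abelian_group "dsum I M" by (rule dsum_abelian_group[OF M.M.abelian_group_axioms])
  have "ract M \<zero>\<^bsub>M\<^esub> s = \<zero>\<^bsub>M\<^esub>" if "s \<in> carrier S" for s
    using additive_zero[OF M.M.abelian_group_axioms M.M.abelian_group_axioms additive_ract[OF assms that]] .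
  then have "ract (dsum I M) f s \<in> carrier (dsum I M)" if "f \<in> carrier (dsum I M)" "s \<in> carrier S" for f s
    using that dsum_carrierD[OF that(1)] fin_supp_map[where G=M and I=I and h=f and H=M and h'="\<lambda>i. ract M (f i) s"]
    by (auto simp: dsum_carrier M.ract_closed cong: conj_cong)
  then show ?thesis
    by unfold_locales
      (auto simp: dsum_carrierD M.ract_closed M.ract_add_left M.ract_add_right M.ract_mult M.ract_one fun_eq_iff restrict_def
        dsum_carrier PiE_iff extensional_def)
qed

lemma dsum_incl_right_linear:
  assumes "right_module S M"
  shows "right_linear S M (dsum I M) (dsum_incl I M i)"
proof -
  interpret M: right_module S M by fact
  have "ract M \<zero>\<^bsub>M\<^esub> s = \<zero>\<^bsub>M\<^esub>" if "s \<in> carrier S" for s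
    using additive_zero[OF M.M.abelian_group_axioms M.M.abelian_group_axioms additive_ract[OF assms that]] .
  then show ?thesis
    using dsum_incl_additive[OF M.M.abelian_group_axioms]
    by (auto simp: right_linear_iff dsum_incl_def fun_eq_iff restrict_def)
qed

lemma dsum_proj_right_linear: "i \<in> I \<Longrightarrow> right_linear S (dsum I M) M (\<lambda>f. f i)"
  by (simp add: right_linear_iff dsum_proj_additive)

lemma dsum_copair_right_linear:
  assumes M: "right_module S M" and G: "right_module S G" and g: "\<And>i. i \<in> I \<Longrightarrow> right_linear S M G (g i)"
  shows "right_linear S (dsum I M) G (\<lambda>f. fsum G I (\<lambda>i. g i (f i)))"
proof -
  interpret M: right_module S M by fact
  interpret G: right_module S G by fact
  note add = right_linear_additive[OF g]
  have "fsum G I (\<lambda>i. g i ((ract (dsum I M) f s) i)) = ract G (fsum G I (\<lambda>i. g i (f i))) s"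
    if f: "f \<in> carrier (dsum I M)" and s: "s \<in> carrier S" for f s
  proof -
    have closed: "(\<lambda>i. g i (f i)) \<in> I \<rightarrow> carrier G"
      using dsum_carrierD[OF f] additive_closed[OF add] by auto
    have fin: "fin_supp G I (\<lambda>i. g i (f i))"
      by (rule fin_supp_map[where G=M and I=I and h=f])
        (use f additive_zero[OF M.M.abelian_group_axioms G.M.abelian_group_axioms add] in \<open>auto simp: dsum_carrier\<close>)
    have "ract G (fsum G I (\<lambda>i. g i (f i))) s = fsum G I (\<lambda>i. ract G (g i (f i)) s)"
      by (rule fsum_additive[OF G.M.abelian_group_axioms G.M.abelian_group_axioms additive_ract[OF G s] fin closed])
    also have "\<dots> = fsum G I (\<lambda>i. g i ((ract (dsum I M) f s) i))"
      by (rule G.M.fsum_cong)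
        (use closed s g dsum_carrierD[OF f] in \<open>auto simp: right_linear_def Pi_iff G.ract_closed\<close>)
    finally show ?thesis by simp
  qed
  then show ?thesis
    using dsum_copair_additive[OF M.M.abelian_group_axioms G.M.abelian_group_axioms add] by (simp add: right_linear_iff)
qed

section \<open>Transport and direct sums of left modules\<close>

lemma transport_left_module:
  assumes "left_module S M" "inj_on j (carrier M)"
  shows "left_module S (transport id g j M)"
proof -
  interpret M: left_module S M by fact
  interpret T: abelian_group "transport id g j M"
    by (rule transport_abelian_group[OF M.M.abelian_group_axioms assms(2)])
  show ?thesis
    by unfold_locales
      (use assms(2) in \<open>auto simp: transport_simps M.lact_closed M.lact_add_right M.lact_add_left M.lact_mult M.lact_one\<close>)
qed

lemma transport_left_linear:
  assumes "left_module S M" "inj_on j (carrier M)"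
  shows "left_linear S M (transport id g j M) j"
    and "left_linear S (transport id g j M) M (inv_into (carrier M) j)"
proof -
  interpret M: left_module S M by fact
  show "left_linear S M (transport id g j M) j" "left_linear S (transport id g j M) M (inv_into (carrier M) j)"
    using assms(2) by (auto simp: left_linear_def transport_simps M.lact_closed)
qed

lemma dsum_left_module:
  assumes "left_module S M"
  shows "left_module S (dsum I M)"
proof -
  interpret M: left_module S M by fact
  interpret D: abelian_group "dsum I M" by (rule dsum_abelian_group[OF M.M.abelian_group_axioms])
  have "lact M s \<zero>\<^bsub>M\<^esub> = \<zero>\<^bsub>M\<^esub>" if "s \<in> carrier S" for s
    using additive_zero[OF M.M.abelian_group_axioms M.M.abelian_group_axioms additive_lact[OF assms that]] .
  then have "lact (dsum I M) s f \<in> carrier (dsum I M)" if "f \<in> carrier (dsum I M)" "s \<in> carrier S" for f s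
    using that dsum_carrierD[OF that(1)] fin_supp_map[where G=M and I=I and h=f and H=M and h'="\<lambda>i. lact M s (f i)"]
    by (auto simp: dsum_carrier M.lact_closed cong: conj_cong)
  then show ?thesis
    by unfold_locales
      (auto simp: dsum_carrierD M.lact_closed M.lact_add_right M.lact_add_left M.lact_mult M.lact_one fun_eq_iff restrict_def
        dsum_carrier PiE_iff extensional_def)
qed

lemma dsum_incl_left_linear:
  assumes "left_module S M"
  shows "left_linear S M (dsum I M) (dsum_incl I M i)"
proof -
  interpret M: left_module S M by fact
  have "lact M s \<zero>\<^bsub>M\<^esub> = \<zero>\<^bsub>M\<^esub>" if "s \<in> carrier S" for s
    using additive_zero[OF M.M.abelian_group_axioms M.M.abelian_group_axioms additive_lact[OF assms that]] .
  then show ?thesis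
    using dsum_incl_additive[OF M.M.abelian_group_axioms]
    by (auto simp: left_linear_iff dsum_incl_def fun_eq_iff restrict_def)
qed

lemma dsum_proj_left_linear: "i \<in> I \<Longrightarrow> left_linear S (dsum I M) M (\<lambda>f. f i)"
  by (simp add: left_linear_iff dsum_proj_additive)

lemma dsum_copair_left_linear:
  assumes M: "left_module S M" and G: "left_module S G" and g: "\<And>i. i \<in> I \<Longrightarrow> left_linear S M G (g i)"
  shows "left_linear S (dsum I M) G (\<lambda>f. fsum G I (\<lambda>i. g i (f i)))"
proof -
  interpret M: left_module S M by fact
  interpret G: left_module S G by fact
  note add = left_linear_additive[OF g]
  have "fsum G I (\<lambda>i. g i ((lact (dsum I M) s f) i)) = lact G s (fsum G I (\<lambda>i. g i (f i)))"
    if f: "f \<in> carrier (dsum I M)" and s: "s \<in> carrier S" for f s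
  proof -
    have closed: "(\<lambda>i. g i (f i)) \<in> I \<rightarrow> carrier G"
      using dsum_carrierD[OF f] additive_closed[OF add] by auto
    have fin: "fin_supp G I (\<lambda>i. g i (f i))"
      by (rule fin_supp_map[where G=M and I=I and h=f])
        (use f additive_zero[OF M.M.abelian_group_axioms G.M.abelian_group_axioms add] in \<open>auto simp: dsum_carrier\<close>)
    have "lact G s (fsum G I (\<lambda>i. g i (f i))) = fsum G I (\<lambda>i. lact G s (g i (f i)))"
      by (rule fsum_additive[OF G.M.abelian_group_axioms G.M.abelian_group_axioms additive_lact[OF G s] fin closed])
    also have "\<dots> = fsum G I (\<lambda>i. g i ((lact (dsum I M) s f) i))"
      by (rule G.M.fsum_cong)
        (use closed s g dsum_carrierD[OF f] in \<open>auto simp: left_linear_def Pi_iff G.lact_closed\<close>)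
    finally show ?thesis by simp
  qed
  then show ?thesis
    using dsum_copair_additive[OF M.M.abelian_group_axioms G.M.abelian_group_axioms add] by (simp add: left_linear_iff)
qed

section \<open>Right comodules: naturality, generation, cofree comodules and lifting\<close>

section \<open>Right comodules\<close>

lemmas right_linearD =
  right_linear_additive additive_closed[OF right_linear_additive] additive_add[OF right_linear_additive]

lemmas left_linearD =
  left_linear_additive additive_closed[OF left_linear_additive] additive_add[OF left_linear_additive]

context coring_over
begin

lemma C: "two_sided R C R" "left_module R C" "right_module R C"
  using two_sided two_sidedD by blast+

lemma Delta: "left_linear R C (C \<boxtimes>\<^bsub>R\<^esub> C) \<Delta>" "right_linear R C (C \<boxtimes>\<^bsub>R\<^esub> C) \<Delta>"
  using Delta_bilinear by (simp_all add: bilinear_def)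

lemma eps: "left_linear R C (regular R) \<epsilon>" "right_linear R C (regular R) \<epsilon>"
  using eps_bilinear by (simp_all add: bilinear_def)

lemma CC: "two_sided R (C \<boxtimes>\<^bsub>R\<^esub> C) R" "left_module R (C \<boxtimes>\<^bsub>R\<^esub> C)" "right_module R (C \<boxtimes>\<^bsub>R\<^esub> C)"
  using tens_two_sided[OF C(1) C(1)] two_sidedD by blast+

lemma RR: "two_sided R (regular R) R" "left_module R (regular R)" "right_module R (regular R)"
  using regular_two_sided[OF ring_axioms] two_sidedD by blast+

lemma MC_right: "right_module R M \<Longrightarrow> right_module R (M \<boxtimes>\<^bsub>R\<^esub> C)"
  by (rule tens_right_module[OF _ C(1)])

lemma MC_pair: "right_module R M \<Longrightarrow> tensor_pair M R C"
  by (rule tensor_pairI[OF _ C(2)])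

lemma MCC_triple: "right_module R M \<Longrightarrow> tensor_triple M R C R C"
  by (rule tensor_tripleI[OF _ C(1,2)])

lemma right_map:
  assumes M: "right_module R M" and N: "right_module R N" and f: "right_linear R M N f"
  shows right_map_linear: "right_linear R (M \<boxtimes>\<^bsub>R\<^esub> C) (N \<boxtimes>\<^bsub>R\<^esub> C) (tens_map N R C f id)"
    and right_map_additive: "additive (M \<boxtimes>\<^bsub>R\<^esub> C) (N \<boxtimes>\<^bsub>R\<^esub> C) (tens_map N R C f id)"
    and right_map_pure: "\<And>m c. \<lbrakk>m \<in> carrier M; c \<in> carrier C\<rbrakk> \<Longrightarrow>
      tens_map N R C f id (pure_tens M R C m c) = pure_tens N R C (f m) c"
proof -
  show "right_linear R (M \<boxtimes>\<^bsub>R\<^esub> C) (N \<boxtimes>\<^bsub>R\<^esub> C) (tens_map N R C f id)"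
    by (rule tens_map_right_linear[OF M C(1) N C(1) f left_linear_id(1) right_linear_id(1)])
  show "additive (M \<boxtimes>\<^bsub>R\<^esub> C) (N \<boxtimes>\<^bsub>R\<^esub> C) (tens_map N R C f id)"
    by (rule tens_map_additive[OF MC_pair[OF M] MC_pair[OF N] f left_linear_id(1)])
  show "tens_map N R C f id (pure_tens M R C m c) = pure_tens N R C (f m) c"
    if "m \<in> carrier M" "c \<in> carrier C" for m c
    using tens_map_pure[OF MC_pair[OF M] MC_pair[OF N] f left_linear_id(1) that] by simp
qed

lemma right_map_comp:
  assumes M: "right_module R M" and N: "right_module R N" and P: "right_module R P"
    and f: "right_linear R M N f" and g: "right_linear R N P g" and t: "t \<in> carrier (M \<boxtimes>\<^bsub>R\<^esub> C)"
  shows "tens_map P R C g id (tens_map N R C f id t) = tens_map P R C (\<lambda>x. g (f x)) id t"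
  using tens_map_comp[OF MC_pair[OF M] MC_pair[OF N] MC_pair[OF P] f left_linear_id(1) g left_linear_id(1) t]
  by (simp add: id_def)

lemma right_map_cong:
  assumes M: "right_module R M" and N: "right_module R N"
    and f: "right_linear R M N f" and g: "right_linear R M N g"
    and "\<And>m. m \<in> carrier M \<Longrightarrow> f m = g m" and t: "t \<in> carrier (M \<boxtimes>\<^bsub>R\<^esub> C)"
  shows "tens_map N R C f id t = tens_map N R C g id t"
  by (rule tens_map_cong[OF MC_pair[OF M] MC_pair[OF N] f left_linear_id(1) g left_linear_id(1) _ refl t])
    (rule assms(5))

lemma right_map_ident:
  assumes M: "right_module R M" and "\<And>m. m \<in> carrier M \<Longrightarrow> f m = m" "t \<in> carrier (M \<boxtimes>\<^bsub>R\<^esub> C)"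
  shows "tens_map M R C f id t = t"
proof -
  interpret M: right_module R M by fact
  interpret T: tensor_pair M R C by (rule MC_pair[OF M])
  have f: "right_linear R M M f" using assms(2) by (auto simp: right_linear_def M.ract_closed)
  show ?thesis
    by (rule T.tens_ext[OF right_map_additive[OF M M f] additive_id(1) _ assms(3)])
      (simp add: right_map_pure[OF M M f] assms(2))
qed

lemma right_counit_natural:
  assumes M: "right_module R M" and V: "right_module R V" and f: "right_linear R M V f"
    and t: "t \<in> carrier (M \<boxtimes>\<^bsub>R\<^esub> C)"
  shows "runit V (tens_map V R (regular R) id \<epsilon> (tens_map V R C f id t))
    = f (runit M (tens_map M R (regular R) id \<epsilon> t))"
proof -
  interpret T: tensor_pair M R C by (rule MC_pair[OF M])
  note eM = tens_map[OF MC_pair[OF M] tensor_pairI[OF M RR(2)] right_linear_id(1) eps(1)]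
  note eV = tens_map[OF MC_pair[OF V] tensor_pairI[OF V RR(2)] right_linear_id(1) eps(1)]
  show ?thesis
    by (rule T.tens_ext[OF additive_comp[OF additive_comp[OF right_map_additive[OF M V f] eV(1)] runit_additive[OF V]]
          additive_comp[OF additive_comp[OF eM(1) runit_additive[OF M]] right_linear_additive[OF f]] _ t])
      (use f left_linearD(2)[OF eps(1)] in
        \<open>simp add: right_map_pure[OF M V f] eM(2) eV(2) runit_pure[OF M] runit_pure[OF V] right_linear_def Pi_iff\<close>)
qed

lemma right_Delta_map:
  assumes M: "right_module R M"
  shows "additive (M \<boxtimes>\<^bsub>R\<^esub> C) (M \<boxtimes>\<^bsub>R\<^esub> (C \<boxtimes>\<^bsub>R\<^esub> C)) (tens_map M R (C \<boxtimes>\<^bsub>R\<^esub> C) id \<Delta>)"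
    and "\<And>m c. \<lbrakk>m \<in> carrier M; c \<in> carrier C\<rbrakk> \<Longrightarrow>
      tens_map M R (C \<boxtimes>\<^bsub>R\<^esub> C) id \<Delta> (pure_tens M R C m c) = pure_tens M R (C \<boxtimes>\<^bsub>R\<^esub> C) m (\<Delta> c)"
  using tens_map[OF MC_pair[OF M] tensor_pairI[OF M CC(2)] right_linear_id(1) Delta(1)] by simp_all

lemma right_map2:
  assumes M: "right_module R M" and N: "right_module R N" and f: "right_linear R M N f"
  shows "additive (M \<boxtimes>\<^bsub>R\<^esub> (C \<boxtimes>\<^bsub>R\<^esub> C)) (N \<boxtimes>\<^bsub>R\<^esub> (C \<boxtimes>\<^bsub>R\<^esub> C)) (tens_map N R (C \<boxtimes>\<^bsub>R\<^esub> C) f id)"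
    and "\<And>m d. \<lbrakk>m \<in> carrier M; d \<in> carrier (C \<boxtimes>\<^bsub>R\<^esub> C)\<rbrakk> \<Longrightarrow>
      tens_map N R (C \<boxtimes>\<^bsub>R\<^esub> C) f id (pure_tens M R (C \<boxtimes>\<^bsub>R\<^esub> C) m d) = pure_tens N R (C \<boxtimes>\<^bsub>R\<^esub> C) (f m) d"
  using tens_map[OF tensor_pairI[OF M CC(2)] tensor_pairI[OF N CC(2)] f left_linear_id(1)] by simp_all

lemma right_Delta_natural:
  assumes M: "right_module R M" and N: "right_module R N" and f: "right_linear R M N f"
    and t: "t \<in> carrier (M \<boxtimes>\<^bsub>R\<^esub> C)"
  shows "tens_map N R (C \<boxtimes>\<^bsub>R\<^esub> C) id \<Delta> (tens_map N R C f id t)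
    = tens_map N R (C \<boxtimes>\<^bsub>R\<^esub> C) f id (tens_map M R (C \<boxtimes>\<^bsub>R\<^esub> C) id \<Delta> t)"
proof -
  interpret T: tensor_pair M R C by (rule MC_pair[OF M])
  note m = right_map_additive[OF M N f] right_map2(1)[OF M N f] right_Delta_map(1)[OF N] right_Delta_map(1)[OF M]
  show ?thesis
    by (rule T.tens_ext[OF additive_comp[OF m(1,3)] additive_comp[OF m(4,2)] _ t])
      (simp add: right_map_pure[OF M N f] right_map2(2)[OF M N f] right_Delta_map(2)[OF N] right_Delta_map(2)[OF M]
        right_linearD(2)[OF f] left_linearD(2)[OF Delta(1)])
qed

lemma right_assoc_natural:
  assumes M: "right_module R M" and N: "right_module R N" and f: "right_linear R M N f"
    and t: "t \<in> carrier ((M \<boxtimes>\<^bsub>R\<^esub> C) \<boxtimes>\<^bsub>R\<^esub> C)"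
  shows "assoc N R C R C (tens_map (N \<boxtimes>\<^bsub>R\<^esub> C) R C (tens_map N R C f id) id t)
    = tens_map N R (C \<boxtimes>\<^bsub>R\<^esub> C) f id (assoc M R C R C t)"
proof -
  interpret M: tensor_triple M R C R C by (rule MCC_triple[OF M])
  interpret N: tensor_triple N R C R C by (rule MCC_triple[OF N])
  note ff = right_map_additive[OF MC_right[OF M] MC_right[OF N] right_map_linear[OF M N f]]
    right_map_pure[OF MC_right[OF M] MC_right[OF N] right_map_linear[OF M N f]]
  show ?thesis
    by (rule M.tens3_ext[OF additive_comp[OF ff(1) N.assoc_additive] additive_comp[OF M.assoc_additive right_map2(1)[OF M N f]] _ t])
      (simp add: ff(2) M.XY.pure_closed M.YZ.pure_closed right_map_pure[OF M N f] right_map2(2)[OF M N f]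
        M.assoc_pure N.assoc_pure right_linearD(2)[OF f])
qed

text \<open>
  The comodule axioms hold on \<open>M\<close> as soon as \<open>M\<close> is generated by images of a comodule under linear
  maps compatible with the coactions.  This covers transport along a bijection, direct sums, and
  the comodule \<open>V \<boxtimes> C\<close>, which is generated by the images of \<open>C\<close> under \<open>c \<mapsto> v \<otimes> c\<close>.
\<close>

lemma right_comodule_generated:
  assumes P: "right_comodule R C \<Delta> \<epsilon> P \<rho>" and M: "right_module R M"
    and \<tau>: "right_linear R M (M \<boxtimes>\<^bsub>R\<^esub> C) \<tau>"
    and \<iota>: "\<And>i. i \<in> I \<Longrightarrow> right_linear R P M (\<iota> i)"
    and \<tau>\<iota>: "\<And>i p. \<lbrakk>i \<in> I; p \<in> carrier P\<rbrakk> \<Longrightarrow> \<tau> (\<iota> i p) = tens_map M R C (\<iota> i) id (\<rho> p)"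
    and gen: "carrier M \<subseteq> generate (add_monoid M) {\<iota> i p |i p. i \<in> I \<and> p \<in> carrier P}"
  shows "right_comodule R C \<Delta> \<epsilon> M \<tau>"
proof -
  interpret P: right_comodule R C \<Delta> \<epsilon> P \<rho> by fact
  interpret M: right_module R M by fact
  note Pm = P.right_module_axioms
  interpret PC: tensor_pair P R C by (rule MC_pair[OF Pm])
  interpret MC: tensor_pair M R C by (rule MC_pair[OF M])
  interpret MCC: tensor_triple M R C R C by (rule MCC_triple[OF M])
  note \<rho> = P.coact_linear
  note closed = right_linearD(2)[OF \<iota>] right_linearD(2)[OF \<rho>]
  have X: "{\<iota> i p |i p. i \<in> I \<and> p \<in> carrier P} \<subseteq> carrier M" using closed(1) by auto
  note eM = tens_map_additive[OF MC_pair[OF M] tensor_pairI[OF M RR(2)] right_linear_id(1) eps(1)]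
  show ?thesis
  proof
    show "right_linear R M (M \<boxtimes>\<^bsub>R\<^esub> C) \<tau>" by fact
  next
    fix m assume m: "m \<in> carrier M"
    show "runit M (tens_map M R (regular R) id \<epsilon> (\<tau> m)) = m"
    proof (rule additive_ext_generate[OF M.M.abelian_group_axioms M.M.abelian_group_axioms
          additive_comp[OF additive_comp[OF right_linear_additive[OF \<tau>] eM] runit_additive[OF M]] additive_id(1) X])
      fix x assume "x \<in> {\<iota> i p |i p. i \<in> I \<and> p \<in> carrier P}"
      then obtain i p where x: "x = \<iota> i p" "i \<in> I" "p \<in> carrier P" by blast
      then show "runit M (tens_map M R (regular R) id \<epsilon> (\<tau> x)) = x"
        using right_counit_natural[OF Pm M \<iota> closed(2)] P.coact_counit by (simp add: \<tau>\<iota>)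
    qed (use m gen in blast)
  next
    fix m assume m: "m \<in> carrier M"
    note \<tau>C = right_map_additive[OF M MC_right[OF M] \<tau>]
    show "assoc M R C R C (tens_map (M \<boxtimes>\<^bsub>R\<^esub> C) R C \<tau> id (\<tau> m)) = tens_map M R (C \<boxtimes>\<^bsub>R\<^esub> C) id \<Delta> (\<tau> m)"
    proof (rule additive_ext_generate[OF M.M.abelian_group_axioms MCC.X_YZ.tens_abelian_group(1)
          additive_comp[OF additive_comp[OF right_linear_additive[OF \<tau>] \<tau>C] MCC.assoc_additive]
          additive_comp[OF right_linear_additive[OF \<tau>] right_Delta_map(1)[OF M]] X])
      fix x assume "x \<in> {\<iota> i p |i p. i \<in> I \<and> p \<in> carrier P}"
      then obtain i p where x: "x = \<iota> i p" and i: "i \<in> I" and p: "p \<in> carrier P" by blast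
      let ?\<iota> = "tens_map M R C (\<iota> i) id"
      note \<iota>C = right_map_linear[OF Pm M \<iota>[OF i]]
      note \<rho>p = closed(2)[OF p]
      note PCm = MC_right[OF Pm] and MCm = MC_right[OF M]
      \<comment> \<open>Compatibility of \<open>\<iota> i\<close> with the coactions, used on both
        legs of the iterated coaction, pulls the computation back to \<open>P\<close>. Naturality of
        re-bracketing and of the comultiplication then reduces the claim to coassociativity of
        \<open>P\<close>.\<close>
      have "tens_map (M \<boxtimes>\<^bsub>R\<^esub> C) R C \<tau> id (?\<iota> (\<rho> p)) = tens_map (M \<boxtimes>\<^bsub>R\<^esub> C) R C (\<lambda>q. \<tau> (\<iota> i q)) id (\<rho> p)"
        by (rule right_map_comp[OF Pm M MCm \<iota>[OF i] \<tau> \<rho>p])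
      also have "\<dots> = tens_map (M \<boxtimes>\<^bsub>R\<^esub> C) R C (\<lambda>q. ?\<iota> (\<rho> q)) id (\<rho> p)"
        by (rule right_map_cong[OF Pm MCm right_linear_comp[OF \<iota>[OF i] \<tau>] right_linear_comp[OF \<rho> \<iota>C] \<tau>\<iota>[OF i] \<rho>p])
      also have "\<dots> = tens_map (M \<boxtimes>\<^bsub>R\<^esub> C) R C ?\<iota> id (tens_map (P \<boxtimes>\<^bsub>R\<^esub> C) R C \<rho> id (\<rho> p))"
        by (rule right_map_comp[OF Pm PCm MCm \<rho> \<iota>C \<rho>p, symmetric])
      finally have "assoc M R C R C (tens_map (M \<boxtimes>\<^bsub>R\<^esub> C) R C \<tau> id (?\<iota> (\<rho> p)))
          = tens_map M R (C \<boxtimes>\<^bsub>R\<^esub> C) (\<iota> i) id (assoc P R C R C (tens_map (P \<boxtimes>\<^bsub>R\<^esub> C) R C \<rho> id (\<rho> p)))"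
        using right_assoc_natural[OF Pm M \<iota>[OF i], of "tens_map (P \<boxtimes>\<^bsub>R\<^esub> C) R C \<rho> id (\<rho> p)"]
          additive_closed[OF right_map_additive[OF Pm PCm \<rho>] \<rho>p] by simp
      also have "\<dots> = tens_map M R (C \<boxtimes>\<^bsub>R\<^esub> C) id \<Delta> (?\<iota> (\<rho> p))"
        using right_Delta_natural[OF Pm M \<iota>[OF i] \<rho>p] P.coact_coassoc[OF p] by simp
      finally show "assoc M R C R C (tens_map (M \<boxtimes>\<^bsub>R\<^esub> C) R C \<tau> id (\<tau> x)) = tens_map M R (C \<boxtimes>\<^bsub>R\<^esub> C) id \<Delta> (\<tau> x)"
        by (simp add: x \<tau>\<iota>[OF i p])
    qed (use m gen in blast)
  qed
qed

lemma right_comodule_self: "right_comodule R C \<Delta> \<epsilon> C \<Delta>"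
  by (intro right_comodule.intro right_comodule_axioms.intro C Delta Delta_coassoc counit_right)

definition cofree_right :: "('s, 'v, 'r) bimod \<Rightarrow> (('v \<times> 'c) \<Rightarrow>\<^sub>0 int) set \<Rightarrow>
    (((('v \<times> 'c) \<Rightarrow>\<^sub>0 int) set \<times> 'c) \<Rightarrow>\<^sub>0 int) set" where
  "cofree_right V t = assoc_inv V R C R C (tens_map V R (C \<boxtimes>\<^bsub>R\<^esub> C) id \<Delta> t)"

lemma cofree_right_comodule:
  assumes V: "right_module R V"
  shows "right_comodule R C \<Delta> \<epsilon> (V \<boxtimes>\<^bsub>R\<^esub> C) (cofree_right V)"
proof (rule right_comodule_generated[OF right_comodule_self MC_right[OF V], where \<iota> = "pure_tens V R C" and I = "carrier V"])
  interpret V: tensor_triple V R C R C by (rule MCC_triple[OF V])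
  show "right_linear R (V \<boxtimes>\<^bsub>R\<^esub> C) ((V \<boxtimes>\<^bsub>R\<^esub> C) \<boxtimes>\<^bsub>R\<^esub> C) (cofree_right V)"
    unfolding cofree_right_def
    by (rule right_linear_comp[OF tens_map_right_linear[OF V C(1) V CC(1) right_linear_id(1) Delta]
          assoc_inv_right_linear[OF V C(1) C(1)]])
  show \<iota>: "right_linear R C (V \<boxtimes>\<^bsub>R\<^esub> C) (pure_tens V R C v)" if "v \<in> carrier V" for v
    by (rule pure_tens_right_linear[OF V C(1) that])
  \<comment> \<open>Re-bracketing v \<otimes> d amounts to inserting \<open>v\<close> in front of
    the first leg of \<open>d\<close>. With d = \<Delta>(c) this says that inserting
    \<open>v\<close> is compatible with the coactions of \<open>C\<close> and of the cofree
    comodule.\<close>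
  have eq: "assoc_inv V R C R C (pure_tens V R (C \<boxtimes>\<^bsub>R\<^esub> C) v d) = tens_map (V \<boxtimes>\<^bsub>R\<^esub> C) R C (pure_tens V R C v) id d"
    if v: "v \<in> carrier V" and d: "d \<in> carrier (C \<boxtimes>\<^bsub>R\<^esub> C)" for v d
  proof (rule V.YZ.tens_ext[OF _ right_map_additive[OF C(3) MC_right[OF V] \<iota>[OF v]] _ d])
    show "additive (C \<boxtimes>\<^bsub>R\<^esub> C) ((V \<boxtimes>\<^bsub>R\<^esub> C) \<boxtimes>\<^bsub>R\<^esub> C) (\<lambda>d. assoc_inv V R C R C (pure_tens V R (C \<boxtimes>\<^bsub>R\<^esub> C) v d))"
      by (rule additive_comp[OF _ V.assoc_inv_additive]) (use v V.X_YZ.balanced_pure in \<open>simp add: balanced_def\<close>)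
  qed (simp add: V.assoc_inv_pure right_map_pure[OF C(3) MC_right[OF V] \<iota>[OF v]] v)
  show "cofree_right V (pure_tens V R C v c) = tens_map (V \<boxtimes>\<^bsub>R\<^esub> C) R C (pure_tens V R C v) id (\<Delta> c)"
    if "v \<in> carrier V" "c \<in> carrier C" for v c
    using that by (simp add: cofree_right_def right_Delta_map(2)[OF V] eq right_linearD(2)[OF Delta(2)])
  show "carrier (V \<boxtimes>\<^bsub>R\<^esub> C) \<subseteq> generate (add_monoid (V \<boxtimes>\<^bsub>R\<^esub> C)) {pure_tens V R C v c |v c. v \<in> carrier V \<and> c \<in> carrier C}"
    by (rule V.XY.tens_generate)
qed

text \<open>Coassociativity of \<open>M\<close> makes the map colinear, and the counit recovers
  \<open>f\<close>: this is the adjunction between forgetting the coaction and forming V \<otimes>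
  C. It supplies both maps of the later lifting problem, the one out of the direct sum and the one
  that sends c to 1 \<otimes> c.\<close>

lemma cofree_right_hom:
  assumes M: "right_comodule R C \<Delta> \<epsilon> M \<tau>" and V: "right_module R V" and f: "right_linear R M V f"
  shows "right_comodule_hom R C M \<tau> (V \<boxtimes>\<^bsub>R\<^esub> C) (cofree_right V) (\<lambda>m. tens_map V R C f id (\<tau> m))"
    and "m \<in> carrier M \<Longrightarrow> runit V (tens_map V R (regular R) id \<epsilon> (tens_map V R C f id (\<tau> m))) = f m"
proof -
  interpret M: right_comodule R C \<Delta> \<epsilon> M \<tau> by fact
  note Mm = M.right_module_axioms and \<tau> = M.coact_linear
  interpret V: tensor_triple V R C R C by (rule MCC_triple[OF V])
  note fC = right_map_linear[OF Mm V f]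
  note Vm = MC_right[OF V] and MCm = MC_right[OF Mm]
  have "cofree_right V (tens_map V R C f id (\<tau> m)) = tens_map (V \<boxtimes>\<^bsub>R\<^esub> C) R C (\<lambda>m. tens_map V R C f id (\<tau> m)) id (\<tau> m)"
    if m: "m \<in> carrier M" for m
  proof -
    note \<tau>m = right_linearD(2)[OF \<tau> m]
    have t: "tens_map (M \<boxtimes>\<^bsub>R\<^esub> C) R C \<tau> id (\<tau> m) \<in> carrier ((M \<boxtimes>\<^bsub>R\<^esub> C) \<boxtimes>\<^bsub>R\<^esub> C)"
      by (rule additive_closed[OF right_map_additive[OF Mm MCm \<tau>] \<tau>m])
    have "tens_map V R (C \<boxtimes>\<^bsub>R\<^esub> C) id \<Delta> (tens_map V R C f id (\<tau> m))
        = tens_map V R (C \<boxtimes>\<^bsub>R\<^esub> C) f id (assoc M R C R C (tens_map (M \<boxtimes>\<^bsub>R\<^esub> C) R C \<tau> id (\<tau> m)))"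
      by (simp add: right_Delta_natural[OF Mm V f \<tau>m] M.coact_coassoc[OF m])
    also have "\<dots> = assoc V R C R C (tens_map (V \<boxtimes>\<^bsub>R\<^esub> C) R C (tens_map V R C f id) id (tens_map (M \<boxtimes>\<^bsub>R\<^esub> C) R C \<tau> id (\<tau> m)))"
      by (rule right_assoc_natural[OF Mm V f t, symmetric])
    also have "tens_map (V \<boxtimes>\<^bsub>R\<^esub> C) R C (tens_map V R C f id) id (tens_map (M \<boxtimes>\<^bsub>R\<^esub> C) R C \<tau> id (\<tau> m))
        = tens_map (V \<boxtimes>\<^bsub>R\<^esub> C) R C (\<lambda>m. tens_map V R C f id (\<tau> m)) id (\<tau> m)"
      by (rule right_map_comp[OF Mm MCm Vm \<tau> fC \<tau>m])
    finally show ?thesis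
      using V.assoc_inv_assoc[OF additive_closed[OF right_map_additive[OF Mm Vm right_linear_comp[OF \<tau> fC]] \<tau>m]]
      by (simp only: cofree_right_def)
  qed
  then show "right_comodule_hom R C M \<tau> (V \<boxtimes>\<^bsub>R\<^esub> C) (cofree_right V) (\<lambda>m. tens_map V R C f id (\<tau> m))"
    using right_linear_comp[OF \<tau> fC] by (simp add: right_comodule_hom_def)
  show "runit V (tens_map V R (regular R) id \<epsilon> (tens_map V R C f id (\<tau> m))) = f m" if "m \<in> carrier M"
    using right_counit_natural[OF Mm V f right_linearD(2)[OF \<tau> that]] M.coact_counit[OF that] by simp
qed

lemma right_comodule_hom_comp:
  assumes M: "right_module R M" and N: "right_module R N" and P: "right_module R P"
    and \<tau>: "right_linear R M (M \<boxtimes>\<^bsub>R\<^esub> C) \<tau>"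
    and f: "right_comodule_hom R C M \<tau> N \<sigma> f" and g: "right_comodule_hom R C N \<sigma> P \<rho> g"
  shows "right_comodule_hom R C M \<tau> P \<rho> (\<lambda>x. g (f x))"
  using f g right_linear_comp[of R M N f P g] right_map_comp[OF M N P] right_linearD(2)[OF \<tau>] right_linearD(2)[of R M N f]
  by (simp add: right_comodule_hom_def)

definition right_transport_coaction :: "('m \<Rightarrow> 'u) \<Rightarrow> ('s, 'm, 'r) bimod \<Rightarrow>
    ('m \<Rightarrow> (('m \<times> 'c) \<Rightarrow>\<^sub>0 int) set) \<Rightarrow> 'u \<Rightarrow> (('u \<times> 'c) \<Rightarrow>\<^sub>0 int) set" where
  "right_transport_coaction j M \<tau> u =
     tens_map (transport (\<lambda>_::unit. undefined) id j M) R C j id (\<tau> (inv_into (carrier M) j u))"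

lemma right_transport_comodule:
  assumes M: "right_comodule R C \<Delta> \<epsilon> M \<tau>" and j: "inj_on j (carrier M)"
  defines "M' \<equiv> transport (\<lambda>_::unit. undefined) id j M" and "\<tau>' \<equiv> right_transport_coaction j M \<tau>"
  shows "right_comodule R C \<Delta> \<epsilon> M' \<tau>'"
    and "right_comodule_hom R C M \<tau> M' \<tau>' j"
    and "right_comodule_hom R C M' \<tau>' M \<tau> (inv_into (carrier M) j)"
proof -
  interpret M: right_comodule R C \<Delta> \<epsilon> M \<tau> by fact
  note Mm = M.right_module_axioms
  have M': "right_module R M'" unfolding M'_def by (rule transport_right_module[OF Mm j])
  have lin: "right_linear R M M' j" "right_linear R M' M (inv_into (carrier M) j)"
    unfolding M'_def by (rule transport_right_linear[OF Mm j])+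
  have \<tau>': "right_linear R M' (M' \<boxtimes>\<^bsub>R\<^esub> C) \<tau>'"
    unfolding \<tau>'_def right_transport_coaction_def M'_def[symmetric]
    by (rule right_linear_comp[OF right_linear_comp[OF lin(2) M.coact_linear] right_map_linear[OF Mm M' lin(1)]])
  have eq: "\<tau>' (j m) = tens_map M' R C j id (\<tau> m)" if "m \<in> carrier M" for m
    using that j by (simp add: \<tau>'_def right_transport_coaction_def M'_def)
  show "right_comodule R C \<Delta> \<epsilon> M' \<tau>'"
  \<comment> \<open>The transported module is the image of the single map \<open>j\<close>, hence an
    index set with one element.\<close>
  proof (rule right_comodule_generated[OF M M' \<tau>', of UNIV "\<lambda>_::unit. j"])
    show "carrier M' \<subseteq> generate (add_monoid M') {j p |i p. (i::unit) \<in> UNIV \<and> p \<in> carrier M}"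
      by (auto simp: M'_def transport_simps intro!: generate.incl)
  qed (use lin eq in auto)
  show "right_comodule_hom R C M \<tau> M' \<tau>' j"
    using lin eq by (simp add: right_comodule_hom_def)
  have "\<tau> (inv_into (carrier M) j u) = tens_map M R C (inv_into (carrier M) j) id (\<tau>' u)" if "u \<in> carrier M'" for u
  proof -
    obtain m where u: "u = j m" and m: "m \<in> carrier M" using \<open>u \<in> carrier M'\<close> by (auto simp: M'_def transport_simps)
    note \<tau>m = right_linearD(2)[OF M.coact_linear m]
    have "tens_map M R C (inv_into (carrier M) j) id (\<tau>' u) = tens_map M R C (\<lambda>m. inv_into (carrier M) j (j m)) id (\<tau> m)"
      by (simp add: u eq[OF m] right_map_comp[OF Mm M' Mm lin \<tau>m])
    also have "\<dots> = \<tau> m" by (rule right_map_ident[OF Mm _ \<tau>m]) (use j in simp)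
    finally show ?thesis using j m by (simp add: u)
  qed
  then show "right_comodule_hom R C M' \<tau>' M \<tau> (inv_into (carrier M) j)"
    using lin by (simp add: right_comodule_hom_def)
qed

text \<open>Projectivity is defined by testing comodules on the type \<open>'u\<close> against
  categorical epimorphisms. The injections \<open>j\<close> and \<open>j'\<close> bring arbitrary
  carriers into \<open>'u\<close>, and a surjective comodule map can be cancelled on the right,
  hence is an epimorphism. The usual lifting along surjections follows by conjugating with the
  transport isomorphisms.\<close>

lemma projective_right_comodule_lift:
  fixes j :: "'m \<Rightarrow> 'u" and j' :: "'n \<Rightarrow> 'u"
    and M :: "('s1, 'm, 'r) bimod" and N :: "('s2, 'n, 'r) bimod"
  assumes proj: "projective_right_comodule TYPE('u) R C \<Delta> \<epsilon> P \<rho>"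
    and M: "right_comodule R C \<Delta> \<epsilon> M \<tau>" and j: "inj_on j (carrier M)"
    and N: "right_comodule R C \<Delta> \<epsilon> N \<sigma>" and j': "inj_on j' (carrier N)"
    and p: "right_comodule_hom R C M \<tau> N \<sigma> p" and surj: "carrier N \<subseteq> p ` carrier M"
    and f: "right_comodule_hom R C P \<rho> N \<sigma> f"
  obtains g where "right_comodule_hom R C P \<rho> M \<tau> g" "\<And>x. x \<in> carrier P \<Longrightarrow> p (g x) = f x"
proof -
  interpret P: right_comodule R C \<Delta> \<epsilon> P \<rho> using proj by (simp add: projective_right_comodule_def)
  interpret M: right_comodule R C \<Delta> \<epsilon> M \<tau> by fact
  interpret N: right_comodule R C \<Delta> \<epsilon> N \<sigma> by fact
  define M' :: "(unit, 'u, 'r) bimod" where "M' = transport (\<lambda>_. undefined) id j M"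
  define N' :: "(unit, 'u, 'r) bimod" where "N' = transport (\<lambda>_. undefined) id j' N"
  let ?\<tau> = "right_transport_coaction j M \<tau>" and ?\<sigma> = "right_transport_coaction j' N \<sigma>"
  let ?i = "inv_into (carrier M) j"
  note M' = right_transport_comodule[OF M j, folded M'_def]
  note N' = right_transport_comodule[OF N j', folded N'_def]
  interpret M': right_comodule R C \<Delta> \<epsilon> M' ?\<tau> by (rule M'(1))
  interpret N': right_comodule R C \<Delta> \<epsilon> N' ?\<sigma> by (rule N'(1))
  note mods = P.right_module_axioms M.right_module_axioms N.right_module_axioms
    M'.right_module_axioms N'.right_module_axioms
  note comp = right_comodule_hom_comp
  have "right_comodule_hom R C M' ?\<tau> N' ?\<sigma> (\<lambda>u. j' (p (?i u)))"
    by (rule comp[OF mods(4,3,5) M'.coact_linear comp[OF mods(4,2,3) M'.coact_linear M'(3) p] N'(2)])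
  moreover have "\<exists>u\<in>carrier M'. n = j' (p (?i u))" if n: "n \<in> carrier N'" for n
  proof -
    obtain m where "m \<in> carrier M" "n = j' (p m)"
      using n surj by (auto simp: N'_def transport_simps)
    then show ?thesis using j by (auto simp: M'_def transport_simps)
  qed
  ultimately have epi: "right_comodule_epi R C \<Delta> \<epsilon> M' ?\<tau> N' ?\<sigma> (\<lambda>u. j' (p (?i u)))"
    unfolding right_comodule_epi_def by metis
  have hom: "right_comodule_hom R C P \<rho> N' ?\<sigma> (\<lambda>x. j' (f x))"
    by (rule comp[OF mods(1,3,5) P.coact_linear f N'(2)])
  obtain g where g: "right_comodule_hom R C P \<rho> M' ?\<tau> g"
    and gf: "\<And>x. x \<in> carrier P \<Longrightarrow> j' (p (?i (g x))) = j' (f x)"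
    using proj[unfolded projective_right_comodule_def, THEN conjunct2, rule_format, OF M'(1) N'(1) epi hom]
    by blast
  have "right_comodule_hom R C P \<rho> M \<tau> (\<lambda>x. ?i (g x))"
    by (rule comp[OF mods(1,4,2) P.coact_linear g M'(3)])
  moreover have "p (?i (g x)) = f x" if x: "x \<in> carrier P" for x
  proof -
    have "p (?i (g x)) \<in> carrier N" "f x \<in> carrier N"
      using x f p g M'(3) by (auto simp: right_comodule_hom_def right_linear_def Pi_iff)
    then show ?thesis using gf[OF x] j' by (simp add: inj_on_eq_iff)
  qed
  ultimately show ?thesis using that by blast
qed

text \<open>An element of the tensor product of the direct sum with \<open>C\<close> is a coset, not
  a family of elements of M \<otimes> C, so the coaction cannot be written coordinatewise. It is
  assembled from the coactions of the summands, pushed forward along the inclusions.\<close>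

definition dsum_right_coaction :: "'i set \<Rightarrow> ('s, 'm, 'r) bimod \<Rightarrow> ('m \<Rightarrow> (('m \<times> 'c) \<Rightarrow>\<^sub>0 int) set) \<Rightarrow>
    ('i \<Rightarrow> 'm) \<Rightarrow> ((('i \<Rightarrow> 'm) \<times> 'c) \<Rightarrow>\<^sub>0 int) set" where
  "dsum_right_coaction I M \<tau> f =
     fsum (dsum I M \<boxtimes>\<^bsub>R\<^esub> C) I (\<lambda>i. tens_map (dsum I M) R C (dsum_incl I M i) id (\<tau> (f i)))"

lemma dsum_right_comodule:
  fixes I :: "'i set"
  assumes M: "right_comodule R C \<Delta> \<epsilon> M \<tau>"
  defines "\<delta> \<equiv> dsum_right_coaction I M \<tau>"
  shows "right_comodule R C \<Delta> \<epsilon> (dsum I M) \<delta>"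
    and "\<And>i m. \<lbrakk>i \<in> I; m \<in> carrier M\<rbrakk> \<Longrightarrow> \<delta> (dsum_incl I M i m) = tens_map (dsum I M) R C (dsum_incl I M i) id (\<tau> m)"
    and "\<And>i. i \<in> I \<Longrightarrow> right_comodule_hom R C (dsum I M) \<delta> M \<tau> (\<lambda>f. f i)"
proof -
  interpret M: right_comodule R C \<Delta> \<epsilon> M \<tau> by fact
  note Mm = M.right_module_axioms and \<tau> = M.coact_linear
  note D = dsum_right_module[OF Mm, where I = I] and incl = dsum_incl_right_linear[OF Mm, where I = I]
  interpret D: right_module R "dsum I M" by (rule D)
  interpret DC: tensor_pair "dsum I M" R C by (rule MC_pair[OF D])
  interpret MC: tensor_pair M R C by (rule MC_pair[OF Mm])
  note \<iota>C = right_linear_comp[OF \<tau> right_map_linear[OF Mm D incl]]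
  have \<delta>: "right_linear R (dsum I M) (dsum I M \<boxtimes>\<^bsub>R\<^esub> C) \<delta>"
    unfolding \<delta>_def dsum_right_coaction_def by (rule dsum_copair_right_linear[OF Mm MC_right[OF D] \<iota>C])
  show eq: "\<delta> (dsum_incl I M i m) = tens_map (dsum I M) R C (dsum_incl I M i) id (\<tau> m)"
    if "i \<in> I" "m \<in> carrier M" for i m
    unfolding \<delta>_def dsum_right_coaction_def
    by (rule dsum_copair_incl[OF M.M.abelian_group_axioms DC.tens_abelian_group(1) right_linear_additive[OF \<iota>C] that])
  note gen = dsum_generate[OF M.M.abelian_group_axioms]
  show "right_comodule R C \<Delta> \<epsilon> (dsum I M) \<delta>"
    by (rule right_comodule_generated[OF M D \<delta> incl eq gen])
  show "right_comodule_hom R C (dsum I M) \<delta> M \<tau> (\<lambda>f. f i)" if i: "i \<in> I" for i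
  proof -
    have pr: "right_linear R (dsum I M) M (\<lambda>f. f i)" by (rule dsum_proj_right_linear[OF i])
    have "\<tau> (f i) = tens_map M R C (\<lambda>f. f i) id (\<delta> f)" if f: "f \<in> carrier (dsum I M)" for f
    proof (rule additive_ext_generate[OF D.M.abelian_group_axioms MC.tens_abelian_group(1)
          additive_comp[OF right_linear_additive[OF pr] right_linear_additive[OF \<tau>]]
          additive_comp[OF right_linear_additive[OF \<delta>] right_map_additive[OF D Mm pr]]])
      show "{dsum_incl I M i m |i m. i \<in> I \<and> m \<in> carrier M} \<subseteq> carrier (dsum I M)"
        by (auto intro: dsum_incl_closed[OF M.M.abelian_group_axioms])
      show "f \<in> generate (add_monoid (dsum I M)) {dsum_incl I M i m |i m. i \<in> I \<and> m \<in> carrier M}"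
        using subsetD[OF gen f] .
      fix x assume "x \<in> {dsum_incl I M i m |i m. i \<in> I \<and> m \<in> carrier M}"
      then obtain l m where x: "x = dsum_incl I M l m" "l \<in> I" and m: "m \<in> carrier M" by blast
      note \<tau>m = right_linearD(2)[OF \<tau> m]
      have "tens_map M R C (\<lambda>f. f i) id (\<delta> x) = tens_map M R C (\<lambda>m. dsum_incl I M l m i) id (\<tau> m)"
        by (simp add: x eq m right_map_comp[OF Mm D Mm incl pr \<tau>m])
      also have "\<dots> = \<tau> (dsum_incl I M l m i)"
      \<comment> \<open>Inclusion of the summand \<open>l\<close> followed by projection to the
        coordinate \<open>i\<close> is the identity or zero; the zero map tensored with
        \<open>C\<close> is zero.\<close>
      proof (cases "l = i")
        case True
        then show ?thesis using i by (simp add: dsum_incl_def right_map_ident[OF Mm _ \<tau>m])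
      next
        case False
        have z: "right_linear R M M (\<lambda>m. \<zero>\<^bsub>M\<^esub>)"
          using right_linear_comp[OF incl[of l] pr] False i by (simp add: dsum_incl_def)
        have "tens_map M R C (\<lambda>m. \<zero>\<^bsub>M\<^esub>) id w = \<zero>\<^bsub>M \<boxtimes>\<^bsub>R\<^esub> C\<^esub>" if "w \<in> carrier (M \<boxtimes>\<^bsub>R\<^esub> C)" for w
        proof (rule MC.tens_ext[OF right_map_additive[OF Mm Mm z] _ _ that])
          interpret T: abelian_group "M \<boxtimes>\<^bsub>R\<^esub> C" by (rule MC.tens_abelian_group)
          show "additive (M \<boxtimes>\<^bsub>R\<^esub> C) (M \<boxtimes>\<^bsub>R\<^esub> C) (\<lambda>w. \<zero>\<^bsub>M \<boxtimes>\<^bsub>R\<^esub> C\<^esub>)" by (simp add: additive_def)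
          fix c assume "c \<in> carrier C"
          then have "additive M (M \<boxtimes>\<^bsub>R\<^esub> C) (\<lambda>m. pure_tens M R C m c)"
            using MC.balanced_pure by (simp add: balanced_def)
          from additive_zero[OF M.M.abelian_group_axioms T.abelian_group_axioms this]
          show "tens_map M R C (\<lambda>m. \<zero>\<^bsub>M\<^esub>) id (pure_tens M R C m c) = \<zero>\<^bsub>M \<boxtimes>\<^bsub>R\<^esub> C\<^esub>" if "m \<in> carrier M" for m
            using that \<open>c \<in> carrier C\<close> by (simp add: right_map_pure[OF Mm Mm z])
        qed
        moreover have "\<tau> \<zero>\<^bsub>M\<^esub> = \<zero>\<^bsub>M \<boxtimes>\<^bsub>R\<^esub> C\<^esub>"
          by (rule additive_zero[OF M.M.abelian_group_axioms MC.tens_abelian_group(1) right_linear_additive[OF \<tau>]])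
        ultimately show ?thesis using False i \<tau>m by (simp add: dsum_incl_def)
      qed
      finally show "\<tau> (x i) = tens_map M R C (\<lambda>f. f i) id (\<delta> x)" by (simp add: x)
    qed
    then show ?thesis using pr by (simp add: right_comodule_hom_def)
  qed
qed

text \<open>The family \<open>g\<close> amounts to one linear map \<open>G\<close> out of the direct
  sum, hence to a colinear map into the cofree comodule on \<open>V\<close>, and \<open>gen\<close>
  expresses that this map is onto. Lifting the colinear map that belongs to \<open>h\<close> yields
  a map into the direct sum. Its coordinates are colinear, and only finitely many of them are
  nonzero at each element of \<open>C\<close>.\<close>

lemma projective_right_colinear_family:
  fixes j :: "('i \<Rightarrow> 'p) \<Rightarrow> 'u" and j' :: "(('v \<times> 'c) \<Rightarrow>\<^sub>0 int) set \<Rightarrow> 'u"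
    and P :: "('s1, 'p, 'r) bimod" and V :: "('s2, 'v, 'r) bimod"
  assumes proj: "projective_right_comodule TYPE('u) R C \<Delta> \<epsilon> C \<Delta>"
    and P: "right_comodule R C \<Delta> \<epsilon> P \<rho>" and V: "right_module R V"
    and j: "inj_on j (carrier (dsum I P))" and j': "inj_on j' (carrier (V \<boxtimes>\<^bsub>R\<^esub> C))"
    and g: "\<And>i. i \<in> I \<Longrightarrow> right_linear R P V (g i)"
    and gen: "carrier (V \<boxtimes>\<^bsub>R\<^esub> C) \<subseteq> generate (add_monoid (V \<boxtimes>\<^bsub>R\<^esub> C))
      {tens_map V R C (g i) id (\<rho> p) |i p. i \<in> I \<and> p \<in> carrier P}"
    and h: "right_linear R C V h"
  obtains \<sigma> where "\<And>i. i \<in> I \<Longrightarrow> right_comodule_hom R C C \<Delta> P \<rho> (\<sigma> i)"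
    "\<And>c. c \<in> carrier C \<Longrightarrow> fin_supp P I (\<lambda>i. \<sigma> i c)"
    "\<And>c. c \<in> carrier C \<Longrightarrow> fsum V I (\<lambda>i. g i (\<sigma> i c)) = h c"
proof -
  interpret P: right_comodule R C \<Delta> \<epsilon> P \<rho> by fact
  note Pm = P.right_module_axioms
  note D = dsum_right_module[OF Pm, where I = I] and incl = dsum_incl_right_linear[OF Pm, where I = I]
  let ?\<delta> = "dsum_right_coaction I P \<rho>"
  note \<delta> = dsum_right_comodule[OF P, where I = I]
  interpret D: right_comodule R C \<Delta> \<epsilon> "dsum I P" ?\<delta> by (rule \<delta>(1))
  interpret V: right_module R V by (rule V)
  interpret VC: tensor_pair V R C by (rule MC_pair[OF V])
  define G where "G f = fsum V I (\<lambda>i. g i (f i))" for f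
  have G: "right_linear R (dsum I P) V G"
    unfolding G_def by (rule dsum_copair_right_linear[OF Pm V g])
  have G_incl: "G (dsum_incl I P i x) = g i x" if "i \<in> I" "x \<in> carrier P" for i x
    unfolding G_def
    by (rule dsum_copair_incl[OF P.M.abelian_group_axioms V.M.abelian_group_axioms right_linear_additive[OF g] that])
  let ?p = "\<lambda>f. tens_map V R C G id (?\<delta> f)"
  note p = cofree_right_hom[OF \<delta>(1) V G]
  note f = cofree_right_hom[OF right_comodule_self V h]
  have "generate (add_monoid (V \<boxtimes>\<^bsub>R\<^esub> C)) {tens_map V R C (g i) id (\<rho> p) |i p. i \<in> I \<and> p \<in> carrier P}
      \<subseteq> ?p ` carrier (dsum I P)"
  proof (rule generate_subset_image[OF D.M.abelian_group_axioms VC.tens_abelian_group(1)])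
    show "additive (dsum I P) (V \<boxtimes>\<^bsub>R\<^esub> C) ?p"
      using p(1) right_linear_additive by (auto simp: right_comodule_hom_def)
    \<comment> \<open>On the summand with index \<open>i\<close> the map \<open>?p\<close> is the
      coaction followed by \<open>g i\<close> on the first leg, so it attains exactly the generators
      that occur in \<open>gen\<close>.\<close>
    have "tens_map V R C (g i) id (\<rho> x) = ?p (dsum_incl I P i x)" if i: "i \<in> I" and x: "x \<in> carrier P" for i x
    proof -
      note \<rho>x = right_linearD(2)[OF P.coact_linear x]
      have "?p (dsum_incl I P i x) = tens_map V R C (\<lambda>x. G (dsum_incl I P i x)) id (\<rho> x)"
        by (simp add: \<delta>(2)[OF i x] right_map_comp[OF Pm D V incl G \<rho>x])
      also have "\<dots> = tens_map V R C (g i) id (\<rho> x)"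
        by (rule right_map_cong[OF Pm V right_linear_comp[OF incl G] g[OF i] G_incl[OF i] \<rho>x])
      finally show ?thesis by simp
    qed
    then show "{tens_map V R C (g i) id (\<rho> p) |i p. i \<in> I \<and> p \<in> carrier P} \<subseteq> ?p ` carrier (dsum I P)"
      by (auto intro!: image_eqI[OF _ dsum_incl_closed[OF P.M.abelian_group_axioms]])
  qed
  with gen have surj: "carrier (V \<boxtimes>\<^bsub>R\<^esub> C) \<subseteq> ?p ` carrier (dsum I P)" by blast
  obtain s where s: "right_comodule_hom R C C \<Delta> (dsum I P) ?\<delta> s"
    and ps: "\<And>c. c \<in> carrier C \<Longrightarrow> ?p (s c) = tens_map V R C h id (\<Delta> c)"
    using projective_right_comodule_lift[OF proj \<delta>(1) j cofree_right_comodule[OF V] j' p(1) surj f(1)] by blast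
  have sD: "s c \<in> carrier (dsum I P)" if "c \<in> carrier C" for c
    using s that by (auto simp: right_comodule_hom_def right_linear_def)
  show thesis
  proof (rule that[of "\<lambda>i c. s c i"])
    show "right_comodule_hom R C C \<Delta> P \<rho> (\<lambda>c. s c i)" if "i \<in> I" for i
      by (rule right_comodule_hom_comp[OF C(3) D Pm Delta(2) s \<delta>(3)[OF that]])
    show "fin_supp P I (\<lambda>i. s c i)" if "c \<in> carrier C" for c
      using sD[OF that] by (simp add: dsum_carrier)
    \<comment> \<open>Applying the counit to the lifting equation turns its left side into
      \<open>G (s c)\<close> and its right side into \<open>h c\<close>.\<close>
    show "fsum V I (\<lambda>i. g i (s c i)) = h c" if c: "c \<in> carrier C" for c
      using p(2)[OF sD[OF c]] f(2)[OF c] ps[OF c] by (simp add: G_def)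
  qed
qed

section \<open>Left comodules, by reflection of the right-handed arguments\<close>

subsection \<open>Left comodules\<close>

lemma CM_left: "left_module R M \<Longrightarrow> left_module R (C \<boxtimes>\<^bsub>R\<^esub> M)"
  by (rule tens_left_module[OF C(1)])

lemma CM_pair: "left_module R M \<Longrightarrow> tensor_pair C R M"
  by (rule tensor_pairI[OF C(3)])

lemma CCM_triple: "left_module R M \<Longrightarrow> tensor_triple C R C R M"
  by (rule tensor_tripleI[OF C(3,1)])

lemma left_map:
  assumes M: "left_module R M" and N: "left_module R N" and f: "left_linear R M N f"
  shows left_map_linear: "left_linear R (C \<boxtimes>\<^bsub>R\<^esub> M) (C \<boxtimes>\<^bsub>R\<^esub> N) (tens_map C R N id f)"
    and left_map_additive: "additive (C \<boxtimes>\<^bsub>R\<^esub> M) (C \<boxtimes>\<^bsub>R\<^esub> N) (tens_map C R N id f)"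
    and left_map_pure: "\<And>m c. \<lbrakk>m \<in> carrier M; c \<in> carrier C\<rbrakk> \<Longrightarrow>
      tens_map C R N id f (pure_tens C R M c m) = pure_tens C R N c (f m)"
proof -
  show "left_linear R (C \<boxtimes>\<^bsub>R\<^esub> M) (C \<boxtimes>\<^bsub>R\<^esub> N) (tens_map C R N id f)"
    by (rule tens_map_left_linear[OF C(1) M C(1) N left_linear_id(1) right_linear_id(1) f])
  show "additive (C \<boxtimes>\<^bsub>R\<^esub> M) (C \<boxtimes>\<^bsub>R\<^esub> N) (tens_map C R N id f)"
    by (rule tens_map_additive[OF CM_pair[OF M] CM_pair[OF N] right_linear_id(1) f])
  show "tens_map C R N id f (pure_tens C R M c m) = pure_tens C R N c (f m)"
    if "m \<in> carrier M" "c \<in> carrier C" for m c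
    using tens_map_pure[OF CM_pair[OF M] CM_pair[OF N] right_linear_id(1) f that(2,1)] by simp
qed

lemma left_map_comp:
  assumes M: "left_module R M" and N: "left_module R N" and P: "left_module R P"
    and f: "left_linear R M N f" and g: "left_linear R N P g" and t: "t \<in> carrier (C \<boxtimes>\<^bsub>R\<^esub> M)"
  shows "tens_map C R P id g (tens_map C R N id f t) = tens_map C R P id (\<lambda>x. g (f x)) t"
  using tens_map_comp[OF CM_pair[OF M] CM_pair[OF N] CM_pair[OF P] right_linear_id(1) f right_linear_id(1) g t]
  by (simp add: id_def)

lemma left_map_cong:
  assumes M: "left_module R M" and N: "left_module R N"
    and f: "left_linear R M N f" and g: "left_linear R M N g"
    and "\<And>m. m \<in> carrier M \<Longrightarrow> f m = g m" and t: "t \<in> carrier (C \<boxtimes>\<^bsub>R\<^esub> M)"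
  shows "tens_map C R N id f t = tens_map C R N id g t"
  by (rule tens_map_cong[OF CM_pair[OF M] CM_pair[OF N] right_linear_id(1) f right_linear_id(1) g refl _ t])
    (rule assms(5))

lemma left_map_ident:
  assumes M: "left_module R M" and "\<And>m. m \<in> carrier M \<Longrightarrow> f m = m" "t \<in> carrier (C \<boxtimes>\<^bsub>R\<^esub> M)"
  shows "tens_map C R M id f t = t"
proof -
  interpret M: left_module R M by fact
  interpret T: tensor_pair C R M by (rule CM_pair[OF M])
  have f: "left_linear R M M f" using assms(2) by (auto simp: left_linear_def M.lact_closed)
  show ?thesis
    by (rule T.tens_ext[OF left_map_additive[OF M M f] additive_id(1) _ assms(3)])
      (simp add: left_map_pure[OF M M f] assms(2))
qed

lemma left_counit_natural:
  assumes M: "left_module R M" and V: "left_module R V" and f: "left_linear R M V f"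
    and t: "t \<in> carrier (C \<boxtimes>\<^bsub>R\<^esub> M)"
  shows "lunit V (tens_map (regular R) R V \<epsilon> id (tens_map C R V id f t))
    = f (lunit M (tens_map (regular R) R M \<epsilon> id t))"
proof -
  interpret T: tensor_pair C R M by (rule CM_pair[OF M])
  note eM = tens_map[OF CM_pair[OF M] tensor_pairI[OF RR(3) M] eps(2) left_linear_id(1)]
  note eV = tens_map[OF CM_pair[OF V] tensor_pairI[OF RR(3) V] eps(2) left_linear_id(1)]
  show ?thesis
    by (rule T.tens_ext[OF additive_comp[OF additive_comp[OF left_map_additive[OF M V f] eV(1)] lunit_additive[OF V]]
          additive_comp[OF additive_comp[OF eM(1) lunit_additive[OF M]] left_linear_additive[OF f]] _ t])
      (use f right_linearD(2)[OF eps(2)] in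
        \<open>simp add: left_map_pure[OF M V f] eM(2) eV(2) lunit_pure[OF M] lunit_pure[OF V] left_linear_def Pi_iff\<close>)
qed

lemma left_Delta_map:
  assumes M: "left_module R M"
  shows "additive (C \<boxtimes>\<^bsub>R\<^esub> M) ((C \<boxtimes>\<^bsub>R\<^esub> C) \<boxtimes>\<^bsub>R\<^esub> M) (tens_map (C \<boxtimes>\<^bsub>R\<^esub> C) R M \<Delta> id)"
    and "\<And>m c. \<lbrakk>m \<in> carrier M; c \<in> carrier C\<rbrakk> \<Longrightarrow>
      tens_map (C \<boxtimes>\<^bsub>R\<^esub> C) R M \<Delta> id (pure_tens C R M c m) = pure_tens (C \<boxtimes>\<^bsub>R\<^esub> C) R M (\<Delta> c) m"
  using tens_map[OF CM_pair[OF M] tensor_pairI[OF CC(3) M] Delta(2) left_linear_id(1)] by simp_all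

lemma left_map2:
  assumes M: "left_module R M" and N: "left_module R N" and f: "left_linear R M N f"
  shows "additive ((C \<boxtimes>\<^bsub>R\<^esub> C) \<boxtimes>\<^bsub>R\<^esub> M) ((C \<boxtimes>\<^bsub>R\<^esub> C) \<boxtimes>\<^bsub>R\<^esub> N) (tens_map (C \<boxtimes>\<^bsub>R\<^esub> C) R N id f)"
    and "\<And>m d. \<lbrakk>m \<in> carrier M; d \<in> carrier (C \<boxtimes>\<^bsub>R\<^esub> C)\<rbrakk> \<Longrightarrow>
      tens_map (C \<boxtimes>\<^bsub>R\<^esub> C) R N id f (pure_tens (C \<boxtimes>\<^bsub>R\<^esub> C) R M d m) = pure_tens (C \<boxtimes>\<^bsub>R\<^esub> C) R N d (f m)"
  using tens_map[OF tensor_pairI[OF CC(3) M] tensor_pairI[OF CC(3) N] right_linear_id(1) f] by simp_all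

lemma left_Delta_natural:
  assumes M: "left_module R M" and N: "left_module R N" and f: "left_linear R M N f"
    and t: "t \<in> carrier (C \<boxtimes>\<^bsub>R\<^esub> M)"
  shows "tens_map (C \<boxtimes>\<^bsub>R\<^esub> C) R N \<Delta> id (tens_map C R N id f t)
    = tens_map (C \<boxtimes>\<^bsub>R\<^esub> C) R N id f (tens_map (C \<boxtimes>\<^bsub>R\<^esub> C) R M \<Delta> id t)"
proof -
  interpret T: tensor_pair C R M by (rule CM_pair[OF M])
  note m = left_map_additive[OF M N f] left_map2(1)[OF M N f] left_Delta_map(1)[OF N] left_Delta_map(1)[OF M]
  show ?thesis
    by (rule T.tens_ext[OF additive_comp[OF m(1,3)] additive_comp[OF m(4,2)] _ t])
      (simp add: left_map_pure[OF M N f] left_map2(2)[OF M N f] left_Delta_map(2)[OF N] left_Delta_map(2)[OF M]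
        left_linearD(2)[OF f] right_linearD(2)[OF Delta(2)])
qed

lemma left_assoc_natural:
  assumes M: "left_module R M" and N: "left_module R N" and f: "left_linear R M N f"
    and t: "t \<in> carrier (C \<boxtimes>\<^bsub>R\<^esub> (C \<boxtimes>\<^bsub>R\<^esub> M))"
  shows "assoc_inv C R C R N (tens_map C R (C \<boxtimes>\<^bsub>R\<^esub> N) id (tens_map C R N id f) t)
    = tens_map (C \<boxtimes>\<^bsub>R\<^esub> C) R N id f (assoc_inv C R C R M t)"
proof -
  interpret M: tensor_triple C R C R M by (rule CCM_triple[OF M])
  interpret N: tensor_triple C R C R N by (rule CCM_triple[OF N])
  note ff = left_map_additive[OF CM_left[OF M] CM_left[OF N] left_map_linear[OF M N f]]
    left_map_pure[OF CM_left[OF M] CM_left[OF N] left_map_linear[OF M N f]]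
  show ?thesis
    by (rule M.tens3_ext'[OF additive_comp[OF ff(1) N.assoc_inv_additive] additive_comp[OF M.assoc_inv_additive left_map2(1)[OF M N f]] _ t])
      (simp add: ff(2) M.YZ.pure_closed M.XY.pure_closed left_map_pure[OF M N f] left_map2(2)[OF M N f]
        M.assoc_inv_pure N.assoc_inv_pure left_linearD(2)[OF f])
qed

text \<open>In the reflected argument naturality is applied to the iterated coaction, which lives in
  C \<otimes> (C \<otimes> M). Re-bracketing therefore has to start from there, opposite to the
  direction chosen in the comodule axiom.\<close>

lemma left_coassoc_inv:
  assumes M: "left_comodule R C \<Delta> \<epsilon> M \<tau>" and m: "m \<in> carrier M"
  shows "assoc_inv C R C R M (tens_map C R (C \<boxtimes>\<^bsub>R\<^esub> M) id \<tau> (\<tau> m)) = tens_map (C \<boxtimes>\<^bsub>R\<^esub> C) R M \<Delta> id (\<tau> m)"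
proof -
  interpret M: left_comodule R C \<Delta> \<epsilon> M \<tau> by fact
  interpret T: tensor_triple C R C R M by (rule CCM_triple[OF M.left_module_axioms])
  show ?thesis
    using T.assoc_inv_assoc[OF additive_closed[OF left_Delta_map(1)[OF M.left_module_axioms]
          left_linearD(2)[OF M.coact_linear m]]] M.coact_coassoc[OF m] by simp
qed

text \<open>The axioms are carried along the generating maps as in
  \<open>right_comodule_generated\<close>. Coassociativity is first established with
  \<open>assoc_inv\<close>, where naturality applies to the iterated coaction, and converted to the
  required form at the end.\<close>

lemma left_comodule_generated:
  assumes P: "left_comodule R C \<Delta> \<epsilon> P \<rho>" and M: "left_module R M"
    and \<tau>: "left_linear R M (C \<boxtimes>\<^bsub>R\<^esub> M) \<tau>"
    and \<iota>: "\<And>i. i \<in> I \<Longrightarrow> left_linear R P M (\<iota> i)"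
    and \<tau>\<iota>: "\<And>i p. \<lbrakk>i \<in> I; p \<in> carrier P\<rbrakk> \<Longrightarrow> \<tau> (\<iota> i p) = tens_map C R M id (\<iota> i) (\<rho> p)"
    and gen: "carrier M \<subseteq> generate (add_monoid M) {\<iota> i p |i p. i \<in> I \<and> p \<in> carrier P}"
  shows "left_comodule R C \<Delta> \<epsilon> M \<tau>"
proof -
  interpret P: left_comodule R C \<Delta> \<epsilon> P \<rho> by fact
  interpret M: left_module R M by fact
  note Pm = P.left_module_axioms
  interpret CP: tensor_pair C R P by (rule CM_pair[OF Pm])
  interpret CM: tensor_pair C R M by (rule CM_pair[OF M])
  interpret CMC: tensor_triple C R C R M by (rule CCM_triple[OF M])
  note \<rho> = P.coact_linear
  note closed = left_linearD(2)[OF \<iota>] left_linearD(2)[OF \<rho>]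
  have X: "{\<iota> i p |i p. i \<in> I \<and> p \<in> carrier P} \<subseteq> carrier M" using closed(1) by auto
  note eM = tens_map_additive[OF CM_pair[OF M] tensor_pairI[OF RR(3) M] eps(2) left_linear_id(1)]
  show ?thesis
  proof
    show "left_linear R M (C \<boxtimes>\<^bsub>R\<^esub> M) \<tau>" by fact
  next
    fix m assume m: "m \<in> carrier M"
    show "lunit M (tens_map (regular R) R M \<epsilon> id (\<tau> m)) = m"
    proof (rule additive_ext_generate[OF M.M.abelian_group_axioms M.M.abelian_group_axioms
          additive_comp[OF additive_comp[OF left_linear_additive[OF \<tau>] eM] lunit_additive[OF M]] additive_id(1) X])
      fix x assume "x \<in> {\<iota> i p |i p. i \<in> I \<and> p \<in> carrier P}"
      then obtain i p where x: "x = \<iota> i p" "i \<in> I" "p \<in> carrier P" by blast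
      then show "lunit M (tens_map (regular R) R M \<epsilon> id (\<tau> x)) = x"
        using left_counit_natural[OF Pm M \<iota> closed(2)] P.coact_counit by (simp add: \<tau>\<iota>)
    qed (use m gen in blast)
  next
    fix m assume m: "m \<in> carrier M"
    note \<tau>C = left_map_additive[OF M CM_left[OF M] \<tau>]
    have "assoc_inv C R C R M (tens_map C R (C \<boxtimes>\<^bsub>R\<^esub> M) id \<tau> (\<tau> m)) = tens_map (C \<boxtimes>\<^bsub>R\<^esub> C) R M \<Delta> id (\<tau> m)"
    proof (rule additive_ext_generate[OF M.M.abelian_group_axioms CMC.XYZ.tens_abelian_group(1)
          additive_comp[OF additive_comp[OF left_linear_additive[OF \<tau>] \<tau>C] CMC.assoc_inv_additive]
          additive_comp[OF left_linear_additive[OF \<tau>] left_Delta_map(1)[OF M]] X])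
      fix x assume "x \<in> {\<iota> i p |i p. i \<in> I \<and> p \<in> carrier P}"
      then obtain i p where x: "x = \<iota> i p" and i: "i \<in> I" and p: "p \<in> carrier P" by blast
      let ?\<iota> = "tens_map C R M id (\<iota> i)"
      note \<iota>C = left_map_linear[OF Pm M \<iota>[OF i]]
      note \<rho>p = closed(2)[OF p]
      note CPm = CM_left[OF Pm] and CMm = CM_left[OF M]
      have "tens_map C R (C \<boxtimes>\<^bsub>R\<^esub> M) id \<tau> (?\<iota> (\<rho> p)) = tens_map C R (C \<boxtimes>\<^bsub>R\<^esub> M) id (\<lambda>q. \<tau> (\<iota> i q)) (\<rho> p)"
        by (rule left_map_comp[OF Pm M CMm \<iota>[OF i] \<tau> \<rho>p])
      also have "\<dots> = tens_map C R (C \<boxtimes>\<^bsub>R\<^esub> M) id (\<lambda>q. ?\<iota> (\<rho> q)) (\<rho> p)"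
        by (rule left_map_cong[OF Pm CMm left_linear_comp[OF \<iota>[OF i] \<tau>] left_linear_comp[OF \<rho> \<iota>C] \<tau>\<iota>[OF i] \<rho>p])
      also have "\<dots> = tens_map C R (C \<boxtimes>\<^bsub>R\<^esub> M) id ?\<iota> (tens_map C R (C \<boxtimes>\<^bsub>R\<^esub> P) id \<rho> (\<rho> p))"
        by (rule left_map_comp[OF Pm CPm CMm \<rho> \<iota>C \<rho>p, symmetric])
      finally have "assoc_inv C R C R M (tens_map C R (C \<boxtimes>\<^bsub>R\<^esub> M) id \<tau> (?\<iota> (\<rho> p)))
          = tens_map (C \<boxtimes>\<^bsub>R\<^esub> C) R M id (\<iota> i) (assoc_inv C R C R P (tens_map C R (C \<boxtimes>\<^bsub>R\<^esub> P) id \<rho> (\<rho> p)))"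
        using left_assoc_natural[OF Pm M \<iota>[OF i], of "tens_map C R (C \<boxtimes>\<^bsub>R\<^esub> P) id \<rho> (\<rho> p)"]
          additive_closed[OF left_map_additive[OF Pm CPm \<rho>] \<rho>p] by simp
      also have "\<dots> = tens_map (C \<boxtimes>\<^bsub>R\<^esub> C) R M \<Delta> id (?\<iota> (\<rho> p))"
        using left_Delta_natural[OF Pm M \<iota>[OF i] \<rho>p] left_coassoc_inv[OF P p] by simp
      finally show "assoc_inv C R C R M (tens_map C R (C \<boxtimes>\<^bsub>R\<^esub> M) id \<tau> (\<tau> x)) = tens_map (C \<boxtimes>\<^bsub>R\<^esub> C) R M \<Delta> id (\<tau> x)"
        by (simp add: x \<tau>\<iota>[OF i p])
    qed (use m gen in blast)
    then show "assoc C R C R M (tens_map (C \<boxtimes>\<^bsub>R\<^esub> C) R M \<Delta> id (\<tau> m)) = tens_map C R (C \<boxtimes>\<^bsub>R\<^esub> M) id \<tau> (\<tau> m)"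
      using CMC.assoc_assoc_inv[OF additive_closed[OF \<tau>C left_linearD(2)[OF \<tau> m]]] by simp
  qed
qed

lemma left_comodule_self: "left_comodule R C \<Delta> \<epsilon> C \<Delta>"
  by (intro left_comodule.intro left_comodule_axioms.intro C Delta Delta_coassoc counit_left)

definition cofree_left :: "('r, 'v, 's) bimod \<Rightarrow> (('c \<times> 'v) \<Rightarrow>\<^sub>0 int) set \<Rightarrow>
    (('c \<times> (('c \<times> 'v) \<Rightarrow>\<^sub>0 int) set) \<Rightarrow>\<^sub>0 int) set" where
  "cofree_left V t = assoc C R C R V (tens_map (C \<boxtimes>\<^bsub>R\<^esub> C) R V \<Delta> id t)"

lemma cofree_left_comodule:
  assumes V: "left_module R V"
  shows "left_comodule R C \<Delta> \<epsilon> (C \<boxtimes>\<^bsub>R\<^esub> V) (cofree_left V)"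
proof (rule left_comodule_generated[OF left_comodule_self CM_left[OF V], where \<iota> = "\<lambda>v c. pure_tens C R V c v" and I = "carrier V"])
  interpret V: tensor_triple C R C R V by (rule CCM_triple[OF V])
  show "left_linear R (C \<boxtimes>\<^bsub>R\<^esub> V) (C \<boxtimes>\<^bsub>R\<^esub> (C \<boxtimes>\<^bsub>R\<^esub> V)) (cofree_left V)"
    unfolding cofree_left_def
    by (rule left_linear_comp[OF tens_map_left_linear[OF C(1) V CC(1) V Delta left_linear_id(1)]
          assoc_left_linear[OF C(1) C(1) V]])
  show \<iota>: "left_linear R C (C \<boxtimes>\<^bsub>R\<^esub> V) (\<lambda>c. pure_tens C R V c v)" if "v \<in> carrier V" for v
    by (rule pure_tens_left_linear[OF C(1) V that])
  have eq: "assoc C R C R V (pure_tens (C \<boxtimes>\<^bsub>R\<^esub> C) R V d v) = tens_map C R (C \<boxtimes>\<^bsub>R\<^esub> V) id (\<lambda>c. pure_tens C R V c v) d"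
    if v: "v \<in> carrier V" and d: "d \<in> carrier (C \<boxtimes>\<^bsub>R\<^esub> C)" for v d
  proof (rule V.XY.tens_ext[OF _ left_map_additive[OF C(2) CM_left[OF V] \<iota>[OF v]] _ d])
    show "additive (C \<boxtimes>\<^bsub>R\<^esub> C) (C \<boxtimes>\<^bsub>R\<^esub> (C \<boxtimes>\<^bsub>R\<^esub> V)) (\<lambda>d. assoc C R C R V (pure_tens (C \<boxtimes>\<^bsub>R\<^esub> C) R V d v))"
      by (rule additive_comp[OF _ V.assoc_additive]) (use v V.XYZ.balanced_pure in \<open>simp add: balanced_def\<close>)
  qed (simp add: V.assoc_pure left_map_pure[OF C(2) CM_left[OF V] \<iota>[OF v]] v)
  show "cofree_left V (pure_tens C R V c v) = tens_map C R (C \<boxtimes>\<^bsub>R\<^esub> V) id (\<lambda>c. pure_tens C R V c v) (\<Delta> c)"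
    if "v \<in> carrier V" "c \<in> carrier C" for v c
    using that by (simp add: cofree_left_def left_Delta_map(2)[OF V] eq left_linearD(2)[OF Delta(1)])
  show "carrier (C \<boxtimes>\<^bsub>R\<^esub> V) \<subseteq> generate (add_monoid (C \<boxtimes>\<^bsub>R\<^esub> V)) {pure_tens C R V c v |v c. v \<in> carrier V \<and> c \<in> carrier C}"
    \<comment> \<open>The two generating sets differ only in the order of their bound
      variables.\<close>
    by (rule subset_trans[OF V.YZ.tens_generate], rule equalityD1, rule arg_cong[where f="generate _"]) blast
qed

lemma cofree_left_hom:
  assumes M: "left_comodule R C \<Delta> \<epsilon> M \<tau>" and V: "left_module R V" and f: "left_linear R M V f"
  shows "left_comodule_hom R C M \<tau> (C \<boxtimes>\<^bsub>R\<^esub> V) (cofree_left V) (\<lambda>m. tens_map C R V id f (\<tau> m))"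
    and "m \<in> carrier M \<Longrightarrow> lunit V (tens_map (regular R) R V \<epsilon> id (tens_map C R V id f (\<tau> m))) = f m"
proof -
  interpret M: left_comodule R C \<Delta> \<epsilon> M \<tau> by fact
  note Mm = M.left_module_axioms and \<tau> = M.coact_linear
  interpret V: tensor_triple C R C R V by (rule CCM_triple[OF V])
  note fC = left_map_linear[OF Mm V f]
  note Vm = CM_left[OF V] and CMm = CM_left[OF Mm]
  have "cofree_left V (tens_map C R V id f (\<tau> m)) = tens_map C R (C \<boxtimes>\<^bsub>R\<^esub> V) id (\<lambda>m. tens_map C R V id f (\<tau> m)) (\<tau> m)"
    if m: "m \<in> carrier M" for m
  proof -
    note \<tau>m = left_linearD(2)[OF \<tau> m]
    have t: "tens_map C R (C \<boxtimes>\<^bsub>R\<^esub> M) id \<tau> (\<tau> m) \<in> carrier (C \<boxtimes>\<^bsub>R\<^esub> (C \<boxtimes>\<^bsub>R\<^esub> M))"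
      by (rule additive_closed[OF left_map_additive[OF Mm CMm \<tau>] \<tau>m])
    have "tens_map (C \<boxtimes>\<^bsub>R\<^esub> C) R V \<Delta> id (tens_map C R V id f (\<tau> m))
        = tens_map (C \<boxtimes>\<^bsub>R\<^esub> C) R V id f (assoc_inv C R C R M (tens_map C R (C \<boxtimes>\<^bsub>R\<^esub> M) id \<tau> (\<tau> m)))"
      by (simp add: left_Delta_natural[OF Mm V f \<tau>m] left_coassoc_inv[OF M m])
    also have "\<dots> = assoc_inv C R C R V (tens_map C R (C \<boxtimes>\<^bsub>R\<^esub> V) id (tens_map C R V id f) (tens_map C R (C \<boxtimes>\<^bsub>R\<^esub> M) id \<tau> (\<tau> m)))"
      by (rule left_assoc_natural[OF Mm V f t, symmetric])
    also have "tens_map C R (C \<boxtimes>\<^bsub>R\<^esub> V) id (tens_map C R V id f) (tens_map C R (C \<boxtimes>\<^bsub>R\<^esub> M) id \<tau> (\<tau> m))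
        = tens_map C R (C \<boxtimes>\<^bsub>R\<^esub> V) id (\<lambda>m. tens_map C R V id f (\<tau> m)) (\<tau> m)"
      by (rule left_map_comp[OF Mm CMm Vm \<tau> fC \<tau>m])
    finally show ?thesis
      using V.assoc_assoc_inv[OF additive_closed[OF left_map_additive[OF Mm Vm left_linear_comp[OF \<tau> fC]] \<tau>m]]
      by (simp only: cofree_left_def)
  qed
  then show "left_comodule_hom R C M \<tau> (C \<boxtimes>\<^bsub>R\<^esub> V) (cofree_left V) (\<lambda>m. tens_map C R V id f (\<tau> m))"
    using left_linear_comp[OF \<tau> fC] by (simp add: left_comodule_hom_def)
  show "lunit V (tens_map (regular R) R V \<epsilon> id (tens_map C R V id f (\<tau> m))) = f m" if "m \<in> carrier M"
    using left_counit_natural[OF Mm V f left_linearD(2)[OF \<tau> that]] M.coact_counit[OF that] by simp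
qed

lemma left_comodule_hom_comp:
  assumes M: "left_module R M" and N: "left_module R N" and P: "left_module R P"
    and \<tau>: "left_linear R M (C \<boxtimes>\<^bsub>R\<^esub> M) \<tau>"
    and f: "left_comodule_hom R C M \<tau> N \<sigma> f" and g: "left_comodule_hom R C N \<sigma> P \<rho> g"
  shows "left_comodule_hom R C M \<tau> P \<rho> (\<lambda>x. g (f x))"
  using f g left_linear_comp[of R M N f P g] left_map_comp[OF M N P] left_linearD(2)[OF \<tau>] left_linearD(2)[of R M N f]
  by (simp add: left_comodule_hom_def)

definition left_transport_coaction :: "('m \<Rightarrow> 'u) \<Rightarrow> ('r, 'm, 's) bimod \<Rightarrow>
    ('m \<Rightarrow> (('c \<times> 'm) \<Rightarrow>\<^sub>0 int) set) \<Rightarrow> 'u \<Rightarrow> (('c \<times> 'u) \<Rightarrow>\<^sub>0 int) set" where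
  "left_transport_coaction j M \<tau> u =
     tens_map C R (transport id (\<lambda>_::unit. undefined) j M) id j (\<tau> (inv_into (carrier M) j u))"

lemma left_transport_comodule:
  assumes M: "left_comodule R C \<Delta> \<epsilon> M \<tau>" and j: "inj_on j (carrier M)"
  defines "M' \<equiv> transport id (\<lambda>_::unit. undefined) j M" and "\<tau>' \<equiv> left_transport_coaction j M \<tau>"
  shows "left_comodule R C \<Delta> \<epsilon> M' \<tau>'"
    and "left_comodule_hom R C M \<tau> M' \<tau>' j"
    and "left_comodule_hom R C M' \<tau>' M \<tau> (inv_into (carrier M) j)"
proof -
  interpret M: left_comodule R C \<Delta> \<epsilon> M \<tau> by fact
  note Mm = M.left_module_axioms
  have M': "left_module R M'" unfolding M'_def by (rule transport_left_module[OF Mm j])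
  have lin: "left_linear R M M' j" "left_linear R M' M (inv_into (carrier M) j)"
    unfolding M'_def by (rule transport_left_linear[OF Mm j])+
  have \<tau>': "left_linear R M' (C \<boxtimes>\<^bsub>R\<^esub> M') \<tau>'"
    unfolding \<tau>'_def left_transport_coaction_def M'_def[symmetric]
    by (rule left_linear_comp[OF left_linear_comp[OF lin(2) M.coact_linear] left_map_linear[OF Mm M' lin(1)]])
  have eq: "\<tau>' (j m) = tens_map C R M' id j (\<tau> m)" if "m \<in> carrier M" for m
    using that j by (simp add: \<tau>'_def left_transport_coaction_def M'_def)
  show "left_comodule R C \<Delta> \<epsilon> M' \<tau>'"
  proof (rule left_comodule_generated[OF M M' \<tau>', of UNIV "\<lambda>_::unit. j"])
    show "carrier M' \<subseteq> generate (add_monoid M') {j p |i p. (i::unit) \<in> UNIV \<and> p \<in> carrier M}"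
      by (auto simp: M'_def transport_simps intro!: generate.incl)
  qed (use lin eq in auto)
  show "left_comodule_hom R C M \<tau> M' \<tau>' j"
    using lin eq by (simp add: left_comodule_hom_def)
  have "\<tau> (inv_into (carrier M) j u) = tens_map C R M id (inv_into (carrier M) j) (\<tau>' u)" if "u \<in> carrier M'" for u
  proof -
    obtain m where u: "u = j m" and m: "m \<in> carrier M" using \<open>u \<in> carrier M'\<close> by (auto simp: M'_def transport_simps)
    note \<tau>m = left_linearD(2)[OF M.coact_linear m]
    have "tens_map C R M id (inv_into (carrier M) j) (\<tau>' u) = tens_map C R M id (\<lambda>m. inv_into (carrier M) j (j m)) (\<tau> m)"
      by (simp add: u eq[OF m] left_map_comp[OF Mm M' Mm lin \<tau>m])
    also have "\<dots> = \<tau> m" by (rule left_map_ident[OF Mm _ \<tau>m]) (use j in simp)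
    finally show ?thesis using j m by (simp add: u)
  qed
  then show "left_comodule_hom R C M' \<tau>' M \<tau> (inv_into (carrier M) j)"
    using lin by (simp add: left_comodule_hom_def)
qed

lemma projective_left_comodule_lift:
  fixes j :: "'m \<Rightarrow> 'u" and j' :: "'n \<Rightarrow> 'u"
    and M :: "('r, 'm, 's1) bimod" and N :: "('r, 'n, 's2) bimod"
  assumes proj: "projective_left_comodule TYPE('u) R C \<Delta> \<epsilon> P \<rho>"
    and M: "left_comodule R C \<Delta> \<epsilon> M \<tau>" and j: "inj_on j (carrier M)"
    and N: "left_comodule R C \<Delta> \<epsilon> N \<sigma>" and j': "inj_on j' (carrier N)"
    and p: "left_comodule_hom R C M \<tau> N \<sigma> p" and surj: "carrier N \<subseteq> p ` carrier M"
    and f: "left_comodule_hom R C P \<rho> N \<sigma> f"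
  obtains g where "left_comodule_hom R C P \<rho> M \<tau> g" "\<And>x. x \<in> carrier P \<Longrightarrow> p (g x) = f x"
proof -
  interpret P: left_comodule R C \<Delta> \<epsilon> P \<rho> using proj by (simp add: projective_left_comodule_def)
  interpret M: left_comodule R C \<Delta> \<epsilon> M \<tau> by fact
  interpret N: left_comodule R C \<Delta> \<epsilon> N \<sigma> by fact
  define M' :: "('r, 'u, unit) bimod" where "M' = transport id (\<lambda>_. undefined) j M"
  define N' :: "('r, 'u, unit) bimod" where "N' = transport id (\<lambda>_. undefined) j' N"
  let ?\<tau> = "left_transport_coaction j M \<tau>" and ?\<sigma> = "left_transport_coaction j' N \<sigma>"
  let ?i = "inv_into (carrier M) j"
  note M' = left_transport_comodule[OF M j, folded M'_def]
  note N' = left_transport_comodule[OF N j', folded N'_def]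
  interpret M': left_comodule R C \<Delta> \<epsilon> M' ?\<tau> by (rule M'(1))
  interpret N': left_comodule R C \<Delta> \<epsilon> N' ?\<sigma> by (rule N'(1))
  note mods = P.left_module_axioms M.left_module_axioms N.left_module_axioms
    M'.left_module_axioms N'.left_module_axioms
  note comp = left_comodule_hom_comp
  have "left_comodule_hom R C M' ?\<tau> N' ?\<sigma> (\<lambda>u. j' (p (?i u)))"
    by (rule comp[OF mods(4,3,5) M'.coact_linear comp[OF mods(4,2,3) M'.coact_linear M'(3) p] N'(2)])
  moreover have "\<exists>u\<in>carrier M'. n = j' (p (?i u))" if n: "n \<in> carrier N'" for n
  proof -
    obtain m where "m \<in> carrier M" "n = j' (p m)"
      using n surj by (auto simp: N'_def transport_simps)
    then show ?thesis using j by (auto simp: M'_def transport_simps)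
  qed
  ultimately have epi: "left_comodule_epi R C \<Delta> \<epsilon> M' ?\<tau> N' ?\<sigma> (\<lambda>u. j' (p (?i u)))"
    unfolding left_comodule_epi_def by metis
  have hom: "left_comodule_hom R C P \<rho> N' ?\<sigma> (\<lambda>x. j' (f x))"
    by (rule comp[OF mods(1,3,5) P.coact_linear f N'(2)])
  obtain g where g: "left_comodule_hom R C P \<rho> M' ?\<tau> g"
    and gf: "\<And>x. x \<in> carrier P \<Longrightarrow> j' (p (?i (g x))) = j' (f x)"
    using proj[unfolded projective_left_comodule_def, THEN conjunct2, rule_format, OF M'(1) N'(1) epi hom]
    by blast
  have "left_comodule_hom R C P \<rho> M \<tau> (\<lambda>x. ?i (g x))"
    by (rule comp[OF mods(1,4,2) P.coact_linear g M'(3)])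
  moreover have "p (?i (g x)) = f x" if x: "x \<in> carrier P" for x
  proof -
    have "p (?i (g x)) \<in> carrier N" "f x \<in> carrier N"
      using x f p g M'(3) by (auto simp: left_comodule_hom_def left_linear_def Pi_iff)
    then show ?thesis using gf[OF x] j' by (simp add: inj_on_eq_iff)
  qed
  ultimately show ?thesis using that by blast
qed

definition dsum_left_coaction :: "'i set \<Rightarrow> ('r, 'm, 's) bimod \<Rightarrow> ('m \<Rightarrow> (('c \<times> 'm) \<Rightarrow>\<^sub>0 int) set) \<Rightarrow>
    ('i \<Rightarrow> 'm) \<Rightarrow> (('c \<times> ('i \<Rightarrow> 'm)) \<Rightarrow>\<^sub>0 int) set" where
  "dsum_left_coaction I M \<tau> f =
     fsum (C \<boxtimes>\<^bsub>R\<^esub> (dsum I M)) I (\<lambda>i. tens_map C R (dsum I M) id (dsum_incl I M i) (\<tau> (f i)))"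

lemma dsum_left_comodule:
  fixes I :: "'i set"
  assumes M: "left_comodule R C \<Delta> \<epsilon> M \<tau>"
  defines "\<delta> \<equiv> dsum_left_coaction I M \<tau>"
  shows "left_comodule R C \<Delta> \<epsilon> (dsum I M) \<delta>"
    and "\<And>i m. \<lbrakk>i \<in> I; m \<in> carrier M\<rbrakk> \<Longrightarrow> \<delta> (dsum_incl I M i m) = tens_map C R (dsum I M) id (dsum_incl I M i) (\<tau> m)"
    and "\<And>i. i \<in> I \<Longrightarrow> left_comodule_hom R C (dsum I M) \<delta> M \<tau> (\<lambda>f. f i)"
proof -
  interpret M: left_comodule R C \<Delta> \<epsilon> M \<tau> by fact
  note Mm = M.left_module_axioms and \<tau> = M.coact_linear
  note D = dsum_left_module[OF Mm, where I = I] and incl = dsum_incl_left_linear[OF Mm, where I = I]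
  interpret D: left_module R "dsum I M" by (rule D)
  interpret CD: tensor_pair C R "dsum I M" by (rule CM_pair[OF D])
  interpret CM: tensor_pair C R M by (rule CM_pair[OF Mm])
  note \<iota>C = left_linear_comp[OF \<tau> left_map_linear[OF Mm D incl]]
  have \<delta>: "left_linear R (dsum I M) (C \<boxtimes>\<^bsub>R\<^esub> (dsum I M)) \<delta>"
    unfolding \<delta>_def dsum_left_coaction_def by (rule dsum_copair_left_linear[OF Mm CM_left[OF D] \<iota>C])
  show eq: "\<delta> (dsum_incl I M i m) = tens_map C R (dsum I M) id (dsum_incl I M i) (\<tau> m)"
    if "i \<in> I" "m \<in> carrier M" for i m
    unfolding \<delta>_def dsum_left_coaction_def
    by (rule dsum_copair_incl[OF M.M.abelian_group_axioms CD.tens_abelian_group(1) left_linear_additive[OF \<iota>C] that])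
  note gen = dsum_generate[OF M.M.abelian_group_axioms]
  show "left_comodule R C \<Delta> \<epsilon> (dsum I M) \<delta>"
    by (rule left_comodule_generated[OF M D \<delta> incl eq gen])
  show "left_comodule_hom R C (dsum I M) \<delta> M \<tau> (\<lambda>f. f i)" if i: "i \<in> I" for i
  proof -
    have pr: "left_linear R (dsum I M) M (\<lambda>f. f i)" by (rule dsum_proj_left_linear[OF i])
    have "\<tau> (f i) = tens_map C R M id (\<lambda>f. f i) (\<delta> f)" if f: "f \<in> carrier (dsum I M)" for f
    proof (rule additive_ext_generate[OF D.M.abelian_group_axioms CM.tens_abelian_group(1)
          additive_comp[OF left_linear_additive[OF pr] left_linear_additive[OF \<tau>]]
          additive_comp[OF left_linear_additive[OF \<delta>] left_map_additive[OF D Mm pr]]])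
      show "{dsum_incl I M i m |i m. i \<in> I \<and> m \<in> carrier M} \<subseteq> carrier (dsum I M)"
        by (auto intro: dsum_incl_closed[OF M.M.abelian_group_axioms])
      show "f \<in> generate (add_monoid (dsum I M)) {dsum_incl I M i m |i m. i \<in> I \<and> m \<in> carrier M}"
        using subsetD[OF gen f] .
      fix x assume "x \<in> {dsum_incl I M i m |i m. i \<in> I \<and> m \<in> carrier M}"
      then obtain l m where x: "x = dsum_incl I M l m" "l \<in> I" and m: "m \<in> carrier M" by blast
      note \<tau>m = left_linearD(2)[OF \<tau> m]
      have "tens_map C R M id (\<lambda>f. f i) (\<delta> x) = tens_map C R M id (\<lambda>m. dsum_incl I M l m i) (\<tau> m)"
        by (simp add: x eq m left_map_comp[OF Mm D Mm incl pr \<tau>m])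
      also have "\<dots> = \<tau> (dsum_incl I M l m i)"
      proof (cases "l = i")
        case True
        then show ?thesis using i by (simp add: dsum_incl_def left_map_ident[OF Mm _ \<tau>m])
      next
        case False
        have z: "left_linear R M M (\<lambda>m. \<zero>\<^bsub>M\<^esub>)"
          using left_linear_comp[OF incl[of l] pr] False i by (simp add: dsum_incl_def)
        have "tens_map C R M id (\<lambda>m. \<zero>\<^bsub>M\<^esub>) w = \<zero>\<^bsub>C \<boxtimes>\<^bsub>R\<^esub> M\<^esub>" if "w \<in> carrier (C \<boxtimes>\<^bsub>R\<^esub> M)" for w
        proof (rule CM.tens_ext[OF left_map_additive[OF Mm Mm z] _ _ that])
          interpret T: abelian_group "C \<boxtimes>\<^bsub>R\<^esub> M" by (rule CM.tens_abelian_group)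
          show "additive (C \<boxtimes>\<^bsub>R\<^esub> M) (C \<boxtimes>\<^bsub>R\<^esub> M) (\<lambda>w. \<zero>\<^bsub>C \<boxtimes>\<^bsub>R\<^esub> M\<^esub>)" by (simp add: additive_def)
          fix c assume "c \<in> carrier C"
          then have "additive M (C \<boxtimes>\<^bsub>R\<^esub> M) (\<lambda>m. pure_tens C R M c m)"
            using CM.balanced_pure by (simp add: balanced_def)
          from additive_zero[OF M.M.abelian_group_axioms T.abelian_group_axioms this]
          show "tens_map C R M id (\<lambda>m. \<zero>\<^bsub>M\<^esub>) (pure_tens C R M c m) = \<zero>\<^bsub>C \<boxtimes>\<^bsub>R\<^esub> M\<^esub>" if "m \<in> carrier M" for m
            using that \<open>c \<in> carrier C\<close> by (simp add: left_map_pure[OF Mm Mm z])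
        qed
        moreover have "\<tau> \<zero>\<^bsub>M\<^esub> = \<zero>\<^bsub>C \<boxtimes>\<^bsub>R\<^esub> M\<^esub>"
          by (rule additive_zero[OF M.M.abelian_group_axioms CM.tens_abelian_group(1) left_linear_additive[OF \<tau>]])
        ultimately show ?thesis using False i \<tau>m by (simp add: dsum_incl_def)
      qed
      finally show "\<tau> (x i) = tens_map C R M id (\<lambda>f. f i) (\<delta> x)" by (simp add: x)
    qed
    then show ?thesis using pr by (simp add: left_comodule_hom_def)
  qed
qed

text \<open>For left comodules the cofree comodule is C \<otimes> V. In the application the
  generators therefore have to be exhibited in C \<otimes> A, although the canonical map takes its
  values in A \<otimes> C.\<close>

lemma projective_left_colinear_family:
  fixes j :: "('i \<Rightarrow> 'p) \<Rightarrow> 'u" and j' :: "(('c \<times> 'v) \<Rightarrow>\<^sub>0 int) set \<Rightarrow> 'u"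
    and P :: "('r, 'p, 's1) bimod" and V :: "('r, 'v, 's2) bimod"
  assumes proj: "projective_left_comodule TYPE('u) R C \<Delta> \<epsilon> C \<Delta>"
    and P: "left_comodule R C \<Delta> \<epsilon> P \<rho>" and V: "left_module R V"
    and j: "inj_on j (carrier (dsum I P))" and j': "inj_on j' (carrier (C \<boxtimes>\<^bsub>R\<^esub> V))"
    and g: "\<And>i. i \<in> I \<Longrightarrow> left_linear R P V (g i)"
    and gen: "carrier (C \<boxtimes>\<^bsub>R\<^esub> V) \<subseteq> generate (add_monoid (C \<boxtimes>\<^bsub>R\<^esub> V))
      {tens_map C R V id (g i) (\<rho> p) |i p. i \<in> I \<and> p \<in> carrier P}"
    and h: "left_linear R C V h"
  obtains \<sigma> where "\<And>i. i \<in> I \<Longrightarrow> left_comodule_hom R C C \<Delta> P \<rho> (\<sigma> i)"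
    "\<And>c. c \<in> carrier C \<Longrightarrow> fin_supp P I (\<lambda>i. \<sigma> i c)"
    "\<And>c. c \<in> carrier C \<Longrightarrow> fsum V I (\<lambda>i. g i (\<sigma> i c)) = h c"
proof -
  interpret P: left_comodule R C \<Delta> \<epsilon> P \<rho> by fact
  note Pm = P.left_module_axioms
  note D = dsum_left_module[OF Pm, where I = I] and incl = dsum_incl_left_linear[OF Pm, where I = I]
  let ?\<delta> = "dsum_left_coaction I P \<rho>"
  note \<delta> = dsum_left_comodule[OF P, where I = I]
  interpret D: left_comodule R C \<Delta> \<epsilon> "dsum I P" ?\<delta> by (rule \<delta>(1))
  interpret V: left_module R V by (rule V)
  interpret CV: tensor_pair C R V by (rule CM_pair[OF V])
  define G where "G f = fsum V I (\<lambda>i. g i (f i))" for f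
  have G: "left_linear R (dsum I P) V G"
    unfolding G_def by (rule dsum_copair_left_linear[OF Pm V g])
  have G_incl: "G (dsum_incl I P i x) = g i x" if "i \<in> I" "x \<in> carrier P" for i x
    unfolding G_def
    by (rule dsum_copair_incl[OF P.M.abelian_group_axioms V.M.abelian_group_axioms left_linear_additive[OF g] that])
  let ?p = "\<lambda>f. tens_map C R V id G (?\<delta> f)"
  note p = cofree_left_hom[OF \<delta>(1) V G]
  note f = cofree_left_hom[OF left_comodule_self V h]
  have "generate (add_monoid (C \<boxtimes>\<^bsub>R\<^esub> V)) {tens_map C R V id (g i) (\<rho> p) |i p. i \<in> I \<and> p \<in> carrier P}
      \<subseteq> ?p ` carrier (dsum I P)"
  proof (rule generate_subset_image[OF D.M.abelian_group_axioms CV.tens_abelian_group(1)])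
    show "additive (dsum I P) (C \<boxtimes>\<^bsub>R\<^esub> V) ?p"
      using p(1) left_linear_additive by (auto simp: left_comodule_hom_def)
    have "tens_map C R V id (g i) (\<rho> x) = ?p (dsum_incl I P i x)" if i: "i \<in> I" and x: "x \<in> carrier P" for i x
    proof -
      note \<rho>x = left_linearD(2)[OF P.coact_linear x]
      have "?p (dsum_incl I P i x) = tens_map C R V id (\<lambda>x. G (dsum_incl I P i x)) (\<rho> x)"
        by (simp add: \<delta>(2)[OF i x] left_map_comp[OF Pm D V incl G \<rho>x])
      also have "\<dots> = tens_map C R V id (g i) (\<rho> x)"
        by (rule left_map_cong[OF Pm V left_linear_comp[OF incl G] g[OF i] G_incl[OF i] \<rho>x])
      finally show ?thesis by simp
    qed
    then show "{tens_map C R V id (g i) (\<rho> p) |i p. i \<in> I \<and> p \<in> carrier P} \<subseteq> ?p ` carrier (dsum I P)"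
      by (auto intro!: image_eqI[OF _ dsum_incl_closed[OF P.M.abelian_group_axioms]])
  qed
  with gen have surj: "carrier (C \<boxtimes>\<^bsub>R\<^esub> V) \<subseteq> ?p ` carrier (dsum I P)" by blast
  obtain s where s: "left_comodule_hom R C C \<Delta> (dsum I P) ?\<delta> s"
    and ps: "\<And>c. c \<in> carrier C \<Longrightarrow> ?p (s c) = tens_map C R V id h (\<Delta> c)"
    using projective_left_comodule_lift[OF proj \<delta>(1) j cofree_left_comodule[OF V] j' p(1) surj f(1)] by blast
  have sD: "s c \<in> carrier (dsum I P)" if "c \<in> carrier C" for c
    using s that by (auto simp: left_comodule_hom_def left_linear_def)
  show thesis
  proof (rule that[of "\<lambda>i c. s c i"])
    show "left_comodule_hom R C C \<Delta> P \<rho> (\<lambda>c. s c i)" if "i \<in> I" for i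
      by (rule left_comodule_hom_comp[OF C(2) D Pm Delta(1) s \<delta>(3)[OF that]])
    show "fin_supp P I (\<lambda>i. s c i)" if "c \<in> carrier C" for c
      using sD[OF that] by (simp add: dsum_carrier)
    show "fsum V I (\<lambda>i. g i (s c i)) = h c" if c: "c \<in> carrier C" for c
      using p(2)[OF sD[OF c]] f(2)[OF c] ps[OF c] by (simp add: G_def)
  qed
qed

end

section \<open>The ring underlying A and the coactions given by a grouplike element\<close>

section \<open>Entwining structures with a grouplike element\<close>

text \<open>Finite support is required at every argument: where the support is infinite the sum has
  the default value zero, and additivity could break down between such arguments and others.\<close>

lemma fsum_family_additive:
  assumes G: "abelian_group G" and H: "abelian_group H"
    and h: "\<And>x. x \<in> I \<Longrightarrow> additive G H (h x)" and fin: "\<And>v. v \<in> carrier G \<Longrightarrow> fin_supp H I (\<lambda>x. h x v)"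
  shows "additive G H (\<lambda>v. fsum H I (\<lambda>x. h x v))"
proof (rule additiveI)
  interpret G: abelian_group G by fact
  interpret H: abelian_group H by fact
  have closed: "(\<lambda>x. h x v) \<in> I \<rightarrow> carrier H" if "v \<in> carrier G" for v
    using additive_closed[OF h that] by auto
  show "fsum H I (\<lambda>x. h x v) \<in> carrier H" if "v \<in> carrier G" for v
    by (rule H.fsum_closed[OF closed[OF that]])
  fix v w assume vw: "v \<in> carrier G" "w \<in> carrier G"
  have "fsum H I (\<lambda>x. h x (v \<oplus>\<^bsub>G\<^esub> w)) = fsum H I (\<lambda>x. h x v \<oplus>\<^bsub>H\<^esub> h x w)"
    by (rule H.fsum_cong[OF closed]) (use vw additive_add[OF h] in auto)
  also have "\<dots> = fsum H I (\<lambda>x. h x v) \<oplus>\<^bsub>H\<^esub> fsum H I (\<lambda>x. h x w)"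
    by (rule H.fsum_add[OF fin[OF vw(1)] fin[OF vw(2)] closed[OF vw(1)] closed[OF vw(2)]])
  finally show "fsum H I (\<lambda>x. h x (v \<oplus>\<^bsub>G\<^esub> w)) = fsum H I (\<lambda>x. h x v) \<oplus>\<^bsub>H\<^esub> fsum H I (\<lambda>x. h x w)" .
qed

text \<open>The support at a sum lies in the union of the supports at the summands, so finiteness
  only has to be known at pure tensors.\<close>

lemma (in tensor_pair) tens_fin_supp:
  assumes H: "abelian_group H" and h: "\<And>x. x \<in> I \<Longrightarrow> additive (M \<boxtimes>\<^bsub>S\<^esub> N) H (h x)"
    and pure: "\<And>m n. m \<in> carrier M \<Longrightarrow> n \<in> carrier N \<Longrightarrow> fin_supp H I (\<lambda>x. h x (pure_tens M S N m n))"
    and t: "t \<in> carrier (M \<boxtimes>\<^bsub>S\<^esub> N)"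
  shows "fin_supp H I (\<lambda>x. h x t)"
  using t
proof (induction t rule: tens_induct)
  case (add t t')
  interpret H: abelian_group H by fact
  have "{x \<in> I. h x (t \<oplus>\<^bsub>M \<boxtimes>\<^bsub>S\<^esub> N\<^esub> t') \<noteq> \<zero>\<^bsub>H\<^esub>} \<subseteq> {x \<in> I. h x t \<noteq> \<zero>\<^bsub>H\<^esub>} \<union> {x \<in> I. h x t' \<noteq> \<zero>\<^bsub>H\<^esub>}"
    using additive_add[OF h] add(1,2) by auto
  then show ?case using add(3,4) finite_subset by blast
qed (rule pure)

lemma balanced_lift:
  assumes "tensor_pair M S N" "abelian_group G" "balanced M S N G \<beta>"
  shows "additive (M \<boxtimes>\<^bsub>S\<^esub> N) G (tens_lift G \<beta>)"
    and "\<And>m n. \<lbrakk>m \<in> carrier M; n \<in> carrier N\<rbrakk> \<Longrightarrow> tens_lift G \<beta> (pure_tens M S N m n) = \<beta> m n"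
  using tensor_pair.tens_lift_additive[OF assms] tensor_pair.tens_lift_pure[OF assms] by blast+

lemma ring_of_simps [simp]:
  "carrier (ring_of R A \<mu> \<eta>) = carrier A" "zero (ring_of R A \<mu> \<eta>) = zero A"
  "add (ring_of R A \<mu> \<eta>) = add A" "one (ring_of R A \<mu> \<eta>) = \<eta> \<one>\<^bsub>R\<^esub>"
  by (simp_all add: ring_of_def)

text \<open>This collects what the left-handed and the right-handed half of the theorem share;
  projectivity of \<open>C\<close> is assumed separately in each half.\<close>

locale grouplike_entwining = entwining_structure k R A \<mu> \<eta> C \<Delta> \<epsilon> \<psi>
  for k :: "('k, 'x) ring_scheme" and R :: "('k, 'r) module"
    and A :: "('r, 'a, 'r) bimod" and \<mu> :: "(('a \<times> 'a) \<Rightarrow>\<^sub>0 int) set \<Rightarrow> 'a" and \<eta> :: "'r \<Rightarrow> 'a"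
    and C :: "('r, 'c, 'r) bimod" and \<Delta> :: "'c \<Rightarrow> (('c \<times> 'c) \<Rightarrow>\<^sub>0 int) set" and \<epsilon> :: "'c \<Rightarrow> 'r"
    and \<psi> :: "(('c \<times> 'a) \<Rightarrow>\<^sub>0 int) set \<Rightarrow> (('a \<times> 'c) \<Rightarrow>\<^sub>0 int) set" +
  fixes e :: 'c
  assumes psi_bij: "bij_betw \<psi> (carrier (C \<boxtimes>\<^bsub>R\<^esub> A)) (carrier (A \<boxtimes>\<^bsub>R\<^esub> C))"
    and e_closed: "e \<in> carrier C" and Delta_e: "\<Delta> e = pure_tens C R C e e" and eps_e: "\<epsilon> e = \<one>\<^bsub>R\<^esub>"
begin

abbreviation mul (infixl \<open>\<star>\<close> 70) where "a \<star> b \<equiv> a \<otimes>\<^bsub>ring_of R A \<mu> \<eta>\<^esub> b"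

lemma mul_eq: "a \<star> b = \<mu> (pure_tens A R A a b)"
  by (simp add: ring_of_def)

lemma A: "two_sided R A R" "left_module R A" "right_module R A"
  using A.two_sided two_sidedD by blast+

lemmas C = C.C

sublocale AA: tensor_pair A R A by (rule tensor_pairI[OF A(3,2)])
sublocale AC: tensor_pair A R C by (rule tensor_pairI[OF A(3) C(2)])
sublocale CA: tensor_pair C R A by (rule tensor_pairI[OF C(3) A(2)])

lemma A_group: "abelian_group A" by (rule A.M.abelian_group_axioms)

lemma AC_group: "abelian_group (A \<boxtimes>\<^bsub>R\<^esub> C)" by (rule AC.tens_abelian_group)

lemma CA_group: "abelian_group (C \<boxtimes>\<^bsub>R\<^esub> A)" by (rule CA.tens_abelian_group)

lemma AC_two_sided: "two_sided R (A \<boxtimes>\<^bsub>R\<^esub> C) R" by (rule tens_two_sided[OF A(1) C(1)])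

lemma CA_two_sided: "two_sided R (C \<boxtimes>\<^bsub>R\<^esub> A) R" by (rule tens_two_sided[OF C(1) A(1)])

lemma mu: "left_linear R (A \<boxtimes>\<^bsub>R\<^esub> A) A \<mu>" "right_linear R (A \<boxtimes>\<^bsub>R\<^esub> A) A \<mu>" "additive (A \<boxtimes>\<^bsub>R\<^esub> A) A \<mu>"
  using A.mu_bilinear left_linear_additive by (auto simp: bilinear_def)

lemma eta: "left_linear R (regular R) A \<eta>" "right_linear R (regular R) A \<eta>"
  using A.eta_bilinear by (auto simp: bilinear_def)

lemma eta_closed: "r \<in> carrier R \<Longrightarrow> \<eta> r \<in> carrier A"
  using left_linearD(2)[OF eta(1)] by simp

lemma balanced_mul: "balanced A R A A (\<star>)"
  unfolding mul_eq by (rule balanced_compose[OF AA.balanced_pure mu(3)])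

lemma mul_additive_right: "a \<in> carrier A \<Longrightarrow> additive A A (\<lambda>b. a \<star> b)"
  and mul_additive_left: "b \<in> carrier A \<Longrightarrow> additive A A (\<lambda>a. a \<star> b)"
  and mul_ract: "\<lbrakk>a \<in> carrier A; r \<in> carrier R; b \<in> carrier A\<rbrakk> \<Longrightarrow> ract A a r \<star> b = a \<star> lact A r b"
  using balanced_mul by (simp_all add: balanced_def)

lemma mul_closed [simp]: "a \<in> carrier A \<Longrightarrow> b \<in> carrier A \<Longrightarrow> a \<star> b \<in> carrier A"
  using additive_closed[OF mul_additive_right] by blast

lemma mul_right_linear: "a \<in> carrier A \<Longrightarrow> right_linear R A A (\<lambda>b. a \<star> b)"
  unfolding mul_eq by (rule right_linear_comp[OF pure_tens_right_linear[OF A(3,1)] mu(2)])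

lemma mul_left_linear: "b \<in> carrier A \<Longrightarrow> left_linear R A A (\<lambda>a. a \<star> b)"
  unfolding mul_eq by (rule left_linear_comp[OF pure_tens_left_linear[OF A(1,2)] mu(1)])

lemma mul_assoc:
  assumes "a \<in> carrier A" "b \<in> carrier A" "c \<in> carrier A"
  shows "(a \<star> b) \<star> c = a \<star> (b \<star> c)"
proof -
  interpret T: tensor_triple A R A R A by (rule tensor_tripleI[OF A(3,1,2)])
  let ?t = "pure_tens (A \<boxtimes>\<^bsub>R\<^esub> A) R A (pure_tens A R A a b) c"
  have t: "?t \<in> carrier ((A \<boxtimes>\<^bsub>R\<^esub> A) \<boxtimes>\<^bsub>R\<^esub> A)"
    using assms by (intro T.XYZ.pure_closed AA.pure_closed)
  have "tens_map A R A \<mu> id ?t = pure_tens A R A (a \<star> b) c"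
    using assms tens_map_pure[OF T.XYZ.tensor_pair_axioms AA.tensor_pair_axioms mu(2) left_linear_id(1)]
    by (simp add: mul_eq AA.pure_closed)
  moreover have "tens_map A R A id \<mu> (assoc A R A R A ?t) = pure_tens A R A a (b \<star> c)"
    using assms tens_map_pure[OF T.X_YZ.tensor_pair_axioms AA.tensor_pair_axioms right_linear_id(1) mu(1)]
    by (simp add: T.assoc_pure mul_eq AA.pure_closed)
  ultimately show ?thesis
    using A.mu_assoc[OF t] by (simp add: mul_eq)
qed

text \<open>The unit axiom evaluated at r \<otimes> a. With its mirror image \<open>mul_eta\<close>
  it shows that \<open>R\<close> acts on \<open>A\<close> through \<eta>, which later turns the
  product of \<eta>(\<epsilon>(c)) with an element of \<open>A\<close> into the counit
  formula.\<close>

lemma eta_mul: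
  assumes "r \<in> carrier R" "a \<in> carrier A"
  shows "\<eta> r \<star> a = lact A r a"
proof -
  interpret T: tensor_pair "regular R" R A by (rule tensor_pairI[OF C.RR(3) A(2)])
  show ?thesis
    using assms A.mu_unit_left[OF T.pure_closed[of r a]] lunit_pure[OF A(2), of r a]
      tens_map_pure[OF T.tensor_pair_axioms AA.tensor_pair_axioms eta(2) left_linear_id(1)]
    by (simp add: mul_eq)
qed

lemma mul_eta:
  assumes "r \<in> carrier R" "a \<in> carrier A"
  shows "a \<star> \<eta> r = ract A a r"
proof -
  interpret T: tensor_pair A R "regular R" by (rule tensor_pairI[OF A(3) C.RR(2)])
  show ?thesis
    using assms A.mu_unit_right[OF T.pure_closed[of a r]] runit_pure[OF A(3), of a r]
      tens_map_pure[OF T.tensor_pair_axioms AA.tensor_pair_axioms right_linear_id(1) eta(1)]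
    by (simp add: mul_eq)
qed

lemma one_closed: "\<eta> \<one>\<^bsub>R\<^esub> \<in> carrier A"
  by (rule eta_closed[OF A.one_closed])

lemma ring_ring_of: "ring (ring_of R A \<mu> \<eta>)"
proof -
  have g: "abelian_group (ring_of R A \<mu> \<eta>)"
    by (rule abelian_groupI)
      (use A.M.a_assoc A.M.a_comm A.M.add.l_inv_ex in \<open>auto simp del: mul_eq\<close>)
  show ?thesis
  proof (rule ringI[OF g])
    show "Group.monoid (ring_of R A \<mu> \<eta>)"
      by (rule monoidI) (simp_all add: one_closed mul_assoc eta_mul mul_eta A.lact_one A.ract_one)
  qed (simp_all add: additive_add[OF mul_additive_left] additive_add[OF mul_additive_right])
qed

section \<open>The left and right A-actions on A \<otimes> C\<close>

abbreviation act_left where "act_left a \<equiv> tens_map A R C (\<lambda>x. a \<star> x) id"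

text \<open>The action (a' \<otimes> c) a = a' \<psi>(c \<otimes> a) is the one that makes A
  \<otimes> C an entwined module and \<psi> a right A-linear map.\<close>

definition act_right where
  "act_right a = tens_lift (A \<boxtimes>\<^bsub>R\<^esub> C) (\<lambda>a' c. act_left a' (\<psi> (pure_tens C R A c a)))"

lemma psi: "left_linear R (C \<boxtimes>\<^bsub>R\<^esub> A) (A \<boxtimes>\<^bsub>R\<^esub> C) \<psi>" "right_linear R (C \<boxtimes>\<^bsub>R\<^esub> A) (A \<boxtimes>\<^bsub>R\<^esub> C) \<psi>"
    "additive (C \<boxtimes>\<^bsub>R\<^esub> A) (A \<boxtimes>\<^bsub>R\<^esub> C) \<psi>"
  using psi_bilinear left_linear_additive by (auto simp: bilinear_def)

lemmas psi_closed = additive_closed[OF psi(3)]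

lemma psi_pure_closed: "\<lbrakk>c \<in> carrier C; a \<in> carrier A\<rbrakk> \<Longrightarrow> \<psi> (pure_tens C R A c a) \<in> carrier (A \<boxtimes>\<^bsub>R\<^esub> C)"
  by (intro psi_closed CA.pure_closed)

lemma act_left_additive: "a \<in> carrier A \<Longrightarrow> additive (A \<boxtimes>\<^bsub>R\<^esub> C) (A \<boxtimes>\<^bsub>R\<^esub> C) (act_left a)"
  and act_left_pure: "\<lbrakk>a \<in> carrier A; x \<in> carrier A; c \<in> carrier C\<rbrakk>
    \<Longrightarrow> act_left a (pure_tens A R C x c) = pure_tens A R C (a \<star> x) c"
  by (rule C.right_map_additive[OF A(3,3) mul_right_linear] C.right_map_pure[OF A(3,3) mul_right_linear]; assumption)+

lemmas act_left_closed = additive_closed[OF act_left_additive]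

lemma act_left_additive':
  assumes w: "w \<in> carrier (A \<boxtimes>\<^bsub>R\<^esub> C)"
  shows "additive A (A \<boxtimes>\<^bsub>R\<^esub> C) (\<lambda>a. act_left a w)"
proof (rule additiveI)
  show "act_left a w \<in> carrier (A \<boxtimes>\<^bsub>R\<^esub> C)" if "a \<in> carrier A" for a
    using that w by (rule act_left_closed)
  fix a b assume ab: "a \<in> carrier A" "b \<in> carrier A"
  then have "additive (A \<boxtimes>\<^bsub>R\<^esub> C) (A \<boxtimes>\<^bsub>R\<^esub> C) (\<lambda>w. act_left a w \<oplus>\<^bsub>A \<boxtimes>\<^bsub>R\<^esub> C\<^esub> act_left b w)"
    by (intro additive_plus AC_group act_left_additive)
  from AC.tens_ext[OF act_left_additive[OF A.M.a_closed[OF ab]] this _ w]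
  show "act_left (a \<oplus>\<^bsub>A\<^esub> b) w = act_left a w \<oplus>\<^bsub>A \<boxtimes>\<^bsub>R\<^esub> C\<^esub> act_left b w"
    using ab by (simp add: act_left_pure additive_add[OF mul_additive_left] AC.pure_add_left)
qed

lemma act_left_ract:
  assumes "a \<in> carrier A" "r \<in> carrier R" and w: "w \<in> carrier (A \<boxtimes>\<^bsub>R\<^esub> C)"
  shows "act_left (ract A a r) w = act_left a (lact (A \<boxtimes>\<^bsub>R\<^esub> C) r w)"
  by (rule AC.tens_ext[OF act_left_additive additive_comp[OF tens_lact_additive[OF A(1) C(2)] act_left_additive] _ w])
    (use assms in \<open>simp_all add: A.ract_closed A.lact_closed act_left_pure tens_lact_pure[OF A(1) C(2)] mul_ract\<close>)

text \<open>The general map \<open>f\<close> is kept because the same balancing argument yields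
  \<open>act_right\<close> and, further on, the auxiliary maps in both coinvariance proofs.\<close>

lemma balanced_act_left:
  assumes "left_module R N" "left_linear R N (A \<boxtimes>\<^bsub>R\<^esub> C) f"
  shows "balanced A R N (A \<boxtimes>\<^bsub>R\<^esub> C) (\<lambda>a n. act_left a (f n))"
proof (rule balancedI)
  show "additive N (A \<boxtimes>\<^bsub>R\<^esub> C) (\<lambda>n. act_left a (f n))" if "a \<in> carrier A" for a
    by (rule additive_comp[OF left_linear_additive[OF assms(2)] act_left_additive[OF that]])
  show "additive A (A \<boxtimes>\<^bsub>R\<^esub> C) (\<lambda>a. act_left a (f n))" if "n \<in> carrier N" for n
    by (rule act_left_additive'[OF left_linearD(2)[OF assms(2) that]])
  show "act_left (ract A a r) (f n) = act_left a (f (lact N r n))"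
    if "a \<in> carrier A" "r \<in> carrier R" "n \<in> carrier N" for a r n
    using that act_left_ract left_linearD(2)[OF assms(2)] assms(2) by (simp add: left_linear_def)
qed

lemma act_right_additive: "a \<in> carrier A \<Longrightarrow> additive (A \<boxtimes>\<^bsub>R\<^esub> C) (A \<boxtimes>\<^bsub>R\<^esub> C) (act_right a)"
  and act_right_pure: "\<lbrakk>a \<in> carrier A; a' \<in> carrier A; c \<in> carrier C\<rbrakk>
    \<Longrightarrow> act_right a (pure_tens A R C a' c) = act_left a' (\<psi> (pure_tens C R A c a))"
  unfolding act_right_def
  by (rule balanced_lift(1)[OF AC.tensor_pair_axioms AC_group balanced_act_left[OF C(2) left_linear_comp[OF pure_tens_left_linear[OF C(1) A(2)] psi(1)]]]
      balanced_lift(2)[OF AC.tensor_pair_axioms AC_group balanced_act_left[OF C(2) left_linear_comp[OF pure_tens_left_linear[OF C(1) A(2)] psi(1)]]];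
      assumption)+

text \<open>This is \<open>psi_mu\<close> read on elements, and it expresses right A-linearity of
  \<psi>. The long composite of constraints in that axiom is identified with
  \<open>act_right\<close> by evaluating its parts on pure tensors.\<close>

lemma psi_mul:
  assumes c: "c \<in> carrier C" and a: "a \<in> carrier A" "a' \<in> carrier A"
  shows "\<psi> (pure_tens C R A c (a \<star> a')) = act_right a' (\<psi> (pure_tens C R A c a))"
proof -
  interpret CAA: tensor_triple C R A R A by (rule tensor_tripleI[OF C(3) A(1,2)])
  interpret ACA: tensor_triple A R C R A by (rule tensor_tripleI[OF A(3) C(1) A(2)])
  interpret AAC: tensor_triple A R A R C by (rule tensor_tripleI[OF A(3,1) C(2)])
  note m = tens_map[OF CAA.XYZ.tensor_pair_axioms ACA.XYZ.tensor_pair_axioms psi(2) left_linear_id(1)]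
    tens_map[OF ACA.X_YZ.tensor_pair_axioms AAC.X_YZ.tensor_pair_axioms right_linear_id(1) psi(1)]
    tens_map[OF AAC.XYZ.tensor_pair_axioms AC.tensor_pair_axioms mu(2) left_linear_id(1)]
    tens_map[OF CAA.X_YZ.tensor_pair_axioms CA.tensor_pair_axioms right_linear_id(1) mu(1)]
  \<comment> \<open>Multiplying the first two of three legs, after re-bracketing, is left
    multiplication by \<open>x\<close> on A \<otimes> C.\<close>
  have left: "tens_map A R C \<mu> id (assoc_inv A R A R C (pure_tens A R (A \<boxtimes>\<^bsub>R\<^esub> C) x w)) = act_left x w"
    if x: "x \<in> carrier A" and w: "w \<in> carrier (A \<boxtimes>\<^bsub>R\<^esub> C)" for x w
  proof -
    have add: "additive (A \<boxtimes>\<^bsub>R\<^esub> C) (A \<boxtimes>\<^bsub>R\<^esub> C)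
        (\<lambda>w. tens_map A R C \<mu> id (assoc_inv A R A R C (pure_tens A R (A \<boxtimes>\<^bsub>R\<^esub> C) x w)))"
      by (rule additive_comp[OF additive_comp[OF _ AAC.assoc_inv_additive] m(5)])
        (use AAC.X_YZ.balanced_pure x in \<open>simp add: balanced_def\<close>)
    show ?thesis
      by (rule AC.tens_ext[OF add act_left_additive[OF x] _ w]) (simp add: AAC.assoc_inv_pure x m(6) AA.pure_closed act_left_pure mul_eq[symmetric] del: ring_of_simps)
  qed
  \<comment> \<open>What \<open>psi_mu\<close> applies after its first application of \<psi>, with
    \<open>a'\<close> held fixed, is the right action of \<open>a'\<close>.\<close>
  have right: "tens_map A R C \<mu> id (assoc_inv A R A R C (tens_map A R (A \<boxtimes>\<^bsub>R\<^esub> C) id \<psi>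
      (assoc A R C R A (pure_tens (A \<boxtimes>\<^bsub>R\<^esub> C) R A v a')))) = act_right a' v" if v: "v \<in> carrier (A \<boxtimes>\<^bsub>R\<^esub> C)" for v
  proof -
    have add: "additive (A \<boxtimes>\<^bsub>R\<^esub> C) (A \<boxtimes>\<^bsub>R\<^esub> C) (\<lambda>v. tens_map A R C \<mu> id (assoc_inv A R A R C
        (tens_map A R (A \<boxtimes>\<^bsub>R\<^esub> C) id \<psi> (assoc A R C R A (pure_tens (A \<boxtimes>\<^bsub>R\<^esub> C) R A v a')))))"
      by (rule additive_comp[OF additive_comp[OF additive_comp[OF additive_comp[OF _ ACA.assoc_additive] m(3)]
              AAC.assoc_inv_additive] m(5)])
        (use ACA.XYZ.balanced_pure a in \<open>simp add: balanced_def\<close>)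
    show ?thesis
      by (rule AC.tens_ext[OF add act_right_additive[OF a(2)] _ v]) (simp add: ACA.assoc_pure a m(4) CA.pure_closed psi_closed left act_right_pure)
  qed
  show ?thesis
    using psi_mu[OF CAA.XYZ.pure_closed[OF CA.pure_closed[OF c a(1)] a(2)]] c a right[OF psi_pure_closed[OF c a(1)]]
    by (simp add: m CA.pure_closed AA.pure_closed CAA.assoc_pure mul_eq)
qed

abbreviation A_eps where "A_eps w \<equiv> runit A (tens_map A R (regular R) id \<epsilon> w)"

abbreviation eps_A where "eps_A t \<equiv> lunit A (tens_map (regular R) R A \<epsilon> id t)"

lemma A_eps: "additive (A \<boxtimes>\<^bsub>R\<^esub> C) A A_eps"
    "\<lbrakk>a \<in> carrier A; c \<in> carrier C\<rbrakk> \<Longrightarrow> A_eps (pure_tens A R C a c) = ract A a (\<epsilon> c)"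
proof -
  note m = tens_map[OF AC.tensor_pair_axioms tensor_pairI[OF A(3) C.RR(2)] right_linear_id(1) C.eps(1)]
  show "additive (A \<boxtimes>\<^bsub>R\<^esub> C) A A_eps" by (rule additive_comp[OF m(1) runit_additive[OF A(3)]])
  show "\<lbrakk>a \<in> carrier A; c \<in> carrier C\<rbrakk> \<Longrightarrow> A_eps (pure_tens A R C a c) = ract A a (\<epsilon> c)"
    using left_linearD(2)[OF C.eps(1)] by (simp add: m(2) runit_pure[OF A(3)])
qed

lemma eps_A: "additive (C \<boxtimes>\<^bsub>R\<^esub> A) A eps_A"
    "\<lbrakk>c \<in> carrier C; a \<in> carrier A\<rbrakk> \<Longrightarrow> eps_A (pure_tens C R A c a) = lact A (\<epsilon> c) a"
proof -
  note m = tens_map[OF CA.tensor_pair_axioms tensor_pairI[OF C.RR(3) A(2)] C.eps(2) left_linear_id(1)]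
  show "additive (C \<boxtimes>\<^bsub>R\<^esub> A) A eps_A" by (rule additive_comp[OF m(1) lunit_additive[OF A(2)]])
  show "\<lbrakk>c \<in> carrier C; a \<in> carrier A\<rbrakk> \<Longrightarrow> eps_A (pure_tens C R A c a) = lact A (\<epsilon> c) a"
    using left_linearD(2)[OF C.eps(1)] by (simp add: m(2) lunit_pure[OF A(2)])
qed

abbreviation coact (\<open>\<tau>\<close>) where "\<tau> \<equiv> regular_coaction R A C \<psi> e"

lemma coact_eq: "\<tau> a = \<psi> (pure_tens C R A e a)"
  by (simp add: regular_coaction_def)

lemma coact_linear: "right_linear R A (A \<boxtimes>\<^bsub>R\<^esub> C) \<tau>"
  unfolding coact_eq[abs_def] by (rule right_linear_comp[OF pure_tens_right_linear[OF C(3) A(1) e_closed] psi(2)])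

lemmas coact_closed = right_linearD(2)[OF coact_linear]

lemma coact_mul: "\<lbrakk>a \<in> carrier A; a' \<in> carrier A\<rbrakk> \<Longrightarrow> \<tau> (a \<star> a') = act_right a' (\<tau> a)"
  by (simp add: coact_eq psi_mul e_closed)

text \<open>The right side is the value of the canonical map at a \<otimes> a'. So that map is a
  \<otimes> a' to (a \<otimes> e) a', which ties it to right A-linear maps.\<close>

lemma act_right_e: "\<lbrakk>a \<in> carrier A; a' \<in> carrier A\<rbrakk> \<Longrightarrow> act_right a' (pure_tens A R C a e) = act_left a (\<tau> a')"
  by (simp add: coact_eq act_right_pure e_closed)

lemma A_eps_coact: "a \<in> carrier A \<Longrightarrow> A_eps (\<tau> a) = a"
  using psi_counit[OF CA.pure_closed[OF e_closed]] eps_A(2)[OF e_closed] by (simp add: coact_eq eps_e A.lact_one)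

lemma A_eps_e: "a \<in> carrier A \<Longrightarrow> A_eps (pure_tens A R C a e) = a"
  by (simp add: A_eps(2) e_closed eps_e A.ract_one)

text \<open>Coassociativity is \<open>psi_Delta\<close> at e \<otimes> a. Since \<Delta>(e) = e
  \<otimes> e, both occurrences of \<psi> on the iterated side receive \<open>e\<close> as their
  first argument and so become \<open>\<tau>\<close>.\<close>

lemma right_comodule_A: "right_comodule R C \<Delta> \<epsilon> A \<tau>"
proof (intro right_comodule.intro right_comodule_axioms.intro A(3) coact_linear A_eps_coact)
  fix a assume a: "a \<in> carrier A"
  interpret CAC: tensor_triple C R A R C by (rule tensor_tripleI[OF C(3) A(1) C(2)])
  interpret ACC: tensor_triple A R C R C by (rule tensor_tripleI[OF A(3) C(1) C(2)])
  interpret CCA: tensor_triple C R C R A by (rule tensor_tripleI[OF C(3) C(1) A(2)])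
  note m = tens_map[OF CA.tensor_pair_axioms CCA.XYZ.tensor_pair_axioms C.Delta(2) left_linear_id(1)]
    tens_map[OF CCA.X_YZ.tensor_pair_axioms CAC.X_YZ.tensor_pair_axioms right_linear_id(1) psi(1)]
    tens_map[OF CAC.XYZ.tensor_pair_axioms ACC.XYZ.tensor_pair_axioms psi(2) left_linear_id(1)]
  note coC = C.right_map_additive[OF A(3) ACC.XY_right coact_linear] C.right_map_pure[OF A(3) ACC.XY_right coact_linear]
  have w: "tens_map (A \<boxtimes>\<^bsub>R\<^esub> C) R C \<psi> id (assoc_inv C R A R C (pure_tens C R (A \<boxtimes>\<^bsub>R\<^esub> C) e w))
      = tens_map (A \<boxtimes>\<^bsub>R\<^esub> C) R C \<tau> id w" if w: "w \<in> carrier (A \<boxtimes>\<^bsub>R\<^esub> C)" for w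
  proof -
    have add: "additive (A \<boxtimes>\<^bsub>R\<^esub> C) ((A \<boxtimes>\<^bsub>R\<^esub> C) \<boxtimes>\<^bsub>R\<^esub> C)
        (\<lambda>w. tens_map (A \<boxtimes>\<^bsub>R\<^esub> C) R C \<psi> id (assoc_inv C R A R C (pure_tens C R (A \<boxtimes>\<^bsub>R\<^esub> C) e w)))"
      by (rule additive_comp[OF additive_comp[OF _ CAC.assoc_inv_additive] m(5)])
        (use CAC.X_YZ.balanced_pure e_closed in \<open>simp add: balanced_def\<close>)
    show ?thesis
      by (rule AC.tens_ext[OF add coC(1) _ w]) (simp add: CAC.assoc_inv_pure e_closed m(6) CA.pure_closed coC(2) coact_eq)
  qed
  show "assoc A R C R C (tens_map (A \<boxtimes>\<^bsub>R\<^esub> C) R C \<tau> id (\<tau> a)) = tens_map A R (C \<boxtimes>\<^bsub>R\<^esub> C) id \<Delta> (\<tau> a)"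
    using psi_Delta[OF CA.pure_closed[OF e_closed a]] w[OF coact_closed[OF a]] a
    by (simp add: m e_closed Delta_e CCA.assoc_pure CA.pure_closed coact_eq)
qed

text \<open>Under the correspondence between linear maps into \<open>A\<close> and colinear maps
  into the cofree comodule, this map belongs to c \<mapsto> 1 \<otimes> c on the right and to c
  \<mapsto> c \<otimes> 1 on the left.\<close>

lemma coact_eps: "left_linear R C A (\<lambda>c. \<eta> (\<epsilon> c))" "right_linear R C A (\<lambda>c. \<eta> (\<epsilon> c))"
  by (rule left_linear_comp[OF C.eps(1) eta(1)] right_linear_comp[OF C.eps(2) eta(2)])+

abbreviation act_CA where "act_CA a \<equiv> tens_map C R A id (\<lambda>x. x \<star> a)"

lemma act_CA_additive: "a \<in> carrier A \<Longrightarrow> additive (C \<boxtimes>\<^bsub>R\<^esub> A) (C \<boxtimes>\<^bsub>R\<^esub> A) (act_CA a)"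
  and act_CA_pure: "\<lbrakk>a \<in> carrier A; x \<in> carrier A; c \<in> carrier C\<rbrakk>
    \<Longrightarrow> act_CA a (pure_tens C R A c x) = pure_tens C R A c (x \<star> a)"
  by (rule C.left_map_additive[OF A(2,2) mul_left_linear] C.left_map_pure[OF A(2,2) mul_left_linear]; assumption)+

lemma psi_act:
  assumes a: "a \<in> carrier A" and t: "t \<in> carrier (C \<boxtimes>\<^bsub>R\<^esub> A)"
  shows "\<psi> (act_CA a t) = act_right a (\<psi> t)"
  by (rule CA.tens_ext[OF additive_comp[OF act_CA_additive[OF a] psi(3)] additive_comp[OF psi(3) act_right_additive[OF a]] _ t])
    (simp add: act_CA_pure a psi_mul)

section \<open>The inverse entwining map and the left coaction on A\<close>

definition psi_inv where "psi_inv = inv_into (carrier (C \<boxtimes>\<^bsub>R\<^esub> A)) \<psi>"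

lemma psi_inv [simp]:
  "w \<in> carrier (A \<boxtimes>\<^bsub>R\<^esub> C) \<Longrightarrow> psi_inv w \<in> carrier (C \<boxtimes>\<^bsub>R\<^esub> A)"
  "w \<in> carrier (A \<boxtimes>\<^bsub>R\<^esub> C) \<Longrightarrow> \<psi> (psi_inv w) = w"
  "t \<in> carrier (C \<boxtimes>\<^bsub>R\<^esub> A) \<Longrightarrow> psi_inv (\<psi> t) = t"
  using psi_bij unfolding psi_inv_def bij_betw_def
  by (auto simp: inv_into_into f_inv_into_f simp del: bij_betw_inv_into_left)

lemma psi_inv_additive: "additive (A \<boxtimes>\<^bsub>R\<^esub> C) (C \<boxtimes>\<^bsub>R\<^esub> A) psi_inv"
proof (rule additiveI)
  interpret T: abelian_group "C \<boxtimes>\<^bsub>R\<^esub> A" by (rule CA_group)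
  fix v w assume vw: "v \<in> carrier (A \<boxtimes>\<^bsub>R\<^esub> C)" "w \<in> carrier (A \<boxtimes>\<^bsub>R\<^esub> C)"
  then have "psi_inv (\<psi> (psi_inv v \<oplus>\<^bsub>C \<boxtimes>\<^bsub>R\<^esub> A\<^esub> psi_inv w)) = psi_inv (v \<oplus>\<^bsub>A \<boxtimes>\<^bsub>R\<^esub> C\<^esub> w)"
    by (simp add: additive_add[OF psi(3)])
  then show "psi_inv (v \<oplus>\<^bsub>A \<boxtimes>\<^bsub>R\<^esub> C\<^esub> w) = psi_inv v \<oplus>\<^bsub>C \<boxtimes>\<^bsub>R\<^esub> A\<^esub> psi_inv w"
    using vw by simp
qed simp

lemma psi_inv_linear: "left_linear R (A \<boxtimes>\<^bsub>R\<^esub> C) (C \<boxtimes>\<^bsub>R\<^esub> A) psi_inv" "right_linear R (A \<boxtimes>\<^bsub>R\<^esub> C) (C \<boxtimes>\<^bsub>R\<^esub> A) psi_inv"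
proof -
  interpret CA': two_sided R "C \<boxtimes>\<^bsub>R\<^esub> A" R by (rule CA_two_sided)
  have "psi_inv (lact (A \<boxtimes>\<^bsub>R\<^esub> C) r w) = psi_inv (\<psi> (lact (C \<boxtimes>\<^bsub>R\<^esub> A) r (psi_inv w)))"
    "psi_inv (ract (A \<boxtimes>\<^bsub>R\<^esub> C) w r) = psi_inv (\<psi> (ract (C \<boxtimes>\<^bsub>R\<^esub> A) (psi_inv w) r))"
    if "r \<in> carrier R" "w \<in> carrier (A \<boxtimes>\<^bsub>R\<^esub> C)" for r w
    using psi(1,2) that by (simp_all add: left_linear_def right_linear_def)
  then show "left_linear R (A \<boxtimes>\<^bsub>R\<^esub> C) (C \<boxtimes>\<^bsub>R\<^esub> A) psi_inv" "right_linear R (A \<boxtimes>\<^bsub>R\<^esub> C) (C \<boxtimes>\<^bsub>R\<^esub> A) psi_inv"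
    by (simp_all add: left_linear_iff right_linear_iff psi_inv_additive CA'.lact_closed CA'.ract_closed)
qed

lemma psi_inv_act:
  "\<lbrakk>a \<in> carrier A; w \<in> carrier (A \<boxtimes>\<^bsub>R\<^esub> C)\<rbrakk> \<Longrightarrow> psi_inv (act_right a w) = act_CA a (psi_inv w)"
  using psi_act[of a "psi_inv w"] psi_inv(3)[of "act_CA a (psi_inv w)"] additive_closed[OF act_CA_additive]
  by simp

text \<open>After applying \<psi> to the first two legs both sides become a \<otimes> e \<otimes> e,
  by \<open>psi_Delta\<close> and because \<open>e\<close> is grouplike. That application is
  injective, its inverse being induced by \<open>psi_inv\<close>. The identity carries both the left
  comodule structure on \<open>A\<close> and the coinvariance of the coefficients in the
  right-handed case.\<close>

lemma Delta_psi_inv: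
  assumes t: "t \<in> carrier (C \<boxtimes>\<^bsub>R\<^esub> A)" and a: "a \<in> carrier A" and \<psi>t: "\<psi> t = pure_tens A R C a e"
  shows "tens_map C R (A \<boxtimes>\<^bsub>R\<^esub> C) id \<psi> (assoc C R C R A (tens_map (C \<boxtimes>\<^bsub>R\<^esub> C) R A \<Delta> id t))
    = assoc C R A R C (pure_tens (C \<boxtimes>\<^bsub>R\<^esub> A) R C t e)"
proof -
  interpret CAC: tensor_triple C R A R C by (rule tensor_tripleI[OF C(3) A(1) C(2)])
  interpret ACC: tensor_triple A R C R C by (rule tensor_tripleI[OF A(3) C(1) C(2)])
  interpret CCA: tensor_triple C R C R A by (rule tensor_tripleI[OF C(3) C(1) A(2)])
  note m = tens_map[OF CA.tensor_pair_axioms CCA.XYZ.tensor_pair_axioms C.Delta(2) left_linear_id(1)]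
    tens_map[OF CCA.X_YZ.tensor_pair_axioms CAC.X_YZ.tensor_pair_axioms right_linear_id(1) psi(1)]
    tens_map[OF CAC.XYZ.tensor_pair_axioms ACC.XYZ.tensor_pair_axioms psi(2) left_linear_id(1)]
  let ?u = "tens_map C R (A \<boxtimes>\<^bsub>R\<^esub> C) id \<psi> (assoc C R C R A (tens_map (C \<boxtimes>\<^bsub>R\<^esub> C) R A \<Delta> id t))"
  let ?\<psi>C = "tens_map (A \<boxtimes>\<^bsub>R\<^esub> C) R C \<psi> id"
  have u: "?u \<in> carrier (C \<boxtimes>\<^bsub>R\<^esub> (A \<boxtimes>\<^bsub>R\<^esub> C))"
    by (rule additive_closed[OF additive_comp[OF additive_comp[OF m(1) CCA.assoc_additive] m(3)] t])
  have u': "assoc_inv C R A R C ?u \<in> carrier ((C \<boxtimes>\<^bsub>R\<^esub> A) \<boxtimes>\<^bsub>R\<^esub> C)"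
    by (rule additive_closed[OF CAC.assoc_inv_additive u])
  have te: "pure_tens (C \<boxtimes>\<^bsub>R\<^esub> A) R C t e \<in> carrier ((C \<boxtimes>\<^bsub>R\<^esub> A) \<boxtimes>\<^bsub>R\<^esub> C)"
    by (rule CAC.XYZ.pure_closed[OF t e_closed])
  have "assoc A R C R C (?\<psi>C (assoc_inv C R A R C ?u)) = pure_tens A R (C \<boxtimes>\<^bsub>R\<^esub> C) a (pure_tens C R C e e)"
    using psi_Delta[OF t] C.right_Delta_map(2)[OF A(3) a e_closed] by (simp add: \<psi>t Delta_e)
  also have "\<dots> = assoc A R C R C (?\<psi>C (pure_tens (C \<boxtimes>\<^bsub>R\<^esub> A) R C t e))"
    using a t e_closed by (simp add: m(6) \<psi>t ACC.assoc_pure)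
  finally have "assoc_inv A R C R C (assoc A R C R C (?\<psi>C (assoc_inv C R A R C ?u)))
      = assoc_inv A R C R C (assoc A R C R C (?\<psi>C (pure_tens (C \<boxtimes>\<^bsub>R\<^esub> A) R C t e)))"
    by (rule arg_cong)
  then have eq: "?\<psi>C (assoc_inv C R A R C ?u) = ?\<psi>C (pure_tens (C \<boxtimes>\<^bsub>R\<^esub> A) R C t e)"
    unfolding ACC.assoc_inv_assoc[OF additive_closed[OF m(5) u']]
      ACC.assoc_inv_assoc[OF additive_closed[OF m(5) te]] .
  have inj: "tens_map (C \<boxtimes>\<^bsub>R\<^esub> A) R C psi_inv id (?\<psi>C s) = s" if s: "s \<in> carrier ((C \<boxtimes>\<^bsub>R\<^esub> A) \<boxtimes>\<^bsub>R\<^esub> C)" for s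
  proof -
    note mods = CAC.XY_right ACC.XY_right
    show ?thesis
      by (rule trans[OF C.right_map_comp[OF mods mods(1) psi(2) psi_inv_linear(2) s] C.right_map_ident[OF mods(1) _ s]])
        (rule psi_inv(3))
  qed
  have "assoc_inv C R A R C ?u = pure_tens (C \<boxtimes>\<^bsub>R\<^esub> A) R C t e"
    using arg_cong[OF eq, of "tens_map (C \<boxtimes>\<^bsub>R\<^esub> A) R C psi_inv id"] unfolding inj[OF u'] inj[OF te] .
  then show ?thesis using CAC.assoc_assoc_inv[OF u] by simp
qed

definition coact_left where "coact_left a = psi_inv (pure_tens A R C a e)"

lemma coact_left_closed: "a \<in> carrier A \<Longrightarrow> coact_left a \<in> carrier (C \<boxtimes>\<^bsub>R\<^esub> A)"
  by (simp add: coact_left_def AC.pure_closed e_closed)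

lemma psi_coact_left: "a \<in> carrier A \<Longrightarrow> \<psi> (coact_left a) = pure_tens A R C a e"
  by (simp add: coact_left_def AC.pure_closed e_closed)

lemma eps_A_coact_left: "a \<in> carrier A \<Longrightarrow> eps_A (coact_left a) = a"
  using psi_counit[OF coact_left_closed] by (simp add: psi_coact_left A_eps_e)

lemma coact_left_linear: "left_linear R A (C \<boxtimes>\<^bsub>R\<^esub> A) coact_left"
  unfolding coact_left_def[abs_def]
  by (rule left_linear_comp[OF pure_tens_left_linear[OF A(1) C(2) e_closed] psi_inv_linear(1)])

text \<open>Coassociativity is compared after \<psi> has been applied to the last two legs, which is
  injective. There both sides are the coaction of \<open>a\<close> with \<open>e\<close> appended:
  one by \<open>Delta_psi_inv\<close>, the other because \<psi> undoes the inner coaction.\<close>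

lemma left_comodule_A: "left_comodule R C \<Delta> \<epsilon> A coact_left"
proof (intro left_comodule.intro left_comodule_axioms.intro A(2) coact_left_linear eps_A_coact_left)
  fix a assume a: "a \<in> carrier A"
  interpret CAC: tensor_triple C R A R C by (rule tensor_tripleI[OF C(3) A(1) C(2)])
  interpret CCA: tensor_triple C R C R A by (rule tensor_tripleI[OF C(3) C(1) A(2)])
  let ?C\<psi> = "tens_map C R (A \<boxtimes>\<^bsub>R\<^esub> C) id \<psi>"
  have AC: "left_module R (A \<boxtimes>\<^bsub>R\<^esub> C)" and CA: "left_module R (C \<boxtimes>\<^bsub>R\<^esub> A)"
    using AC_two_sided CA_two_sided two_sidedD by blast+
  note C\<psi> = C.left_map_additive[OF CA AC psi(1)] C.left_map_pure[OF CA AC psi(1)]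
  note co = C.left_map_additive[OF A(2) CA coact_left_linear] C.left_map_pure[OF A(2) CA coact_left_linear]
  have eq: "?C\<psi> (tens_map C R (C \<boxtimes>\<^bsub>R\<^esub> A) id coact_left t) = assoc C R A R C (pure_tens (C \<boxtimes>\<^bsub>R\<^esub> A) R C t e)"
    if t: "t \<in> carrier (C \<boxtimes>\<^bsub>R\<^esub> A)" for t
  proof -
    have add: "additive (C \<boxtimes>\<^bsub>R\<^esub> A) (C \<boxtimes>\<^bsub>R\<^esub> (A \<boxtimes>\<^bsub>R\<^esub> C)) (\<lambda>t. assoc C R A R C (pure_tens (C \<boxtimes>\<^bsub>R\<^esub> A) R C t e))"
      by (rule additive_comp[OF _ CAC.assoc_additive]) (use CAC.XYZ.balanced_pure e_closed in \<open>simp add: balanced_def\<close>)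
    show ?thesis
      by (rule CA.tens_ext[OF additive_comp[OF co(1) C\<psi>(1)] add _ t]) (simp add: co(2) C\<psi>(2) coact_left_closed psi_coact_left CAC.assoc_pure e_closed)
  qed
  have inj: "tens_map C R (C \<boxtimes>\<^bsub>R\<^esub> A) id psi_inv (?C\<psi> s) = s" if s: "s \<in> carrier (C \<boxtimes>\<^bsub>R\<^esub> (C \<boxtimes>\<^bsub>R\<^esub> A))" for s
    by (rule trans[OF C.left_map_comp[OF CA AC CA psi(1) psi_inv_linear(1) s] C.left_map_ident[OF CA _ s]])
      (rule psi_inv(3))
  note t = coact_left_closed[OF a]
  have "?C\<psi> (assoc C R C R A (tens_map (C \<boxtimes>\<^bsub>R\<^esub> C) R A \<Delta> id (coact_left a)))
      = ?C\<psi> (tens_map C R (C \<boxtimes>\<^bsub>R\<^esub> A) id coact_left (coact_left a))"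
    by (simp add: Delta_psi_inv[OF t a psi_coact_left[OF a]] eq[OF t])
  then show "assoc C R C R A (tens_map (C \<boxtimes>\<^bsub>R\<^esub> C) R A \<Delta> id (coact_left a))
      = tens_map C R (C \<boxtimes>\<^bsub>R\<^esub> A) id coact_left (coact_left a)"
    using inj[OF additive_closed[OF co(1) t]]
      inj[OF additive_closed[OF CCA.assoc_additive additive_closed[OF C.left_Delta_map(1)[OF A(2)] t]]] by simp
qed

end

section \<open>Injections of direct sums and tensor products into the test type\<close>

section \<open>Encodings into the test type\<close>

text \<open>The finitely many keys are listed in an arbitrarily chosen order together with their
  coefficients, coded as natural numbers. The set of entries alone already determines the formal
  sum, so the chosen order is harmless.\<close>

lemma frag_encoding: "\<exists>j :: (('x \<times> 'y) \<Rightarrow>\<^sub>0 int) \<Rightarrow> ('x \<times> 'y \<times> nat) list. inj j"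
proof -
  let ?entry = "\<lambda>u p. (fst p, snd p, to_nat (Poly_Mapping.lookup u p))"
  define j :: "(('x \<times> 'y) \<Rightarrow>\<^sub>0 int) \<Rightarrow> ('x \<times> 'y \<times> nat) list"
    where "j u = map (?entry u) (SOME ps. set ps = Poly_Mapping.keys u)" for u
  have set_j: "set (j u) = ?entry u ` Poly_Mapping.keys u" for u
    unfolding j_def set_map by (rule arg_cong[where f = "\<lambda>X. ?entry u ` X"], rule someI_ex[OF finite_list[OF finite_keys]])
  \<comment> \<open>Coefficients are compared at keys of \<open>u\<close> only; keys of
    \<open>v\<close> follow by symmetry, and at all other places both coefficients vanish.\<close>
  have le: "Poly_Mapping.lookup v p = Poly_Mapping.lookup u p" if "j u = j v" "p \<in> Poly_Mapping.keys u" for u v p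
  proof -
    have "?entry u p \<in> ?entry v ` Poly_Mapping.keys v" using that set_j[of u] set_j[of v] by auto
    then show ?thesis by (auto simp: prod_eq_iff inj_eq[OF inj_to_nat])
  qed
  have "inj j"
  proof (rule injI, rule poly_mapping_eqI)
    fix u v p assume eq: "j u = j v"
    consider "p \<in> Poly_Mapping.keys u" | "p \<in> Poly_Mapping.keys v"
      | "p \<notin> Poly_Mapping.keys u" "p \<notin> Poly_Mapping.keys v" by blast
    then show "Poly_Mapping.lookup u p = Poly_Mapping.lookup v p"
    proof cases
      case 3
      then show ?thesis by (simp add: in_keys_iff)
    qed (rule le[OF eq, symmetric] le[OF eq[symmetric]]; assumption)+
  qed
  then show ?thesis by blast
qed

text \<open>A coset is encoded through a chosen representative, from which it can be
  recovered.\<close>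

lemma (in tensor_pair) tens_encoding:
  "\<exists>j :: (('m \<times> 'n) \<Rightarrow>\<^sub>0 int) set \<Rightarrow> ('m \<times> 'n \<times> nat) list. inj_on j (carrier (M \<boxtimes>\<^bsub>S\<^esub> N))"
proof -
  interpret K: normal "tens_kernel M S N" "tens_free M N" by (rule tens_kernel_normal)
  obtain j :: "(('m \<times> 'n) \<Rightarrow>\<^sub>0 int) \<Rightarrow> ('m \<times> 'n \<times> nat) list" where j: "inj j"
    using frag_encoding by blast
  have coset: "t = tens_kernel M S N #>\<^bsub>tens_free M N\<^esub> (SOME u. u \<in> t)" if t: "t \<in> carrier (M \<boxtimes>\<^bsub>S\<^esub> N)" for t
  proof -
    obtain w where w: "t = tens_kernel M S N #>\<^bsub>tens_free M N\<^esub> w" "w \<in> carrier (tens_free M N)"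
      using t by (auto simp: tens_cosets)
    have "w \<in> t" using K.rcos_self[OF w(2) K.subgroup_axioms] w(1) by simp
    then have "(SOME u. u \<in> t) \<in> t" by (rule someI)
    then show ?thesis using K.repr_independence[OF _ w(2) K.subgroup_axioms] w(1) by metis
  qed
  have "inj_on (\<lambda>t. j (SOME u. u \<in> t)) (carrier (M \<boxtimes>\<^bsub>S\<^esub> N))"
  proof (rule inj_onI)
    fix t t' assume t: "t \<in> carrier (M \<boxtimes>\<^bsub>S\<^esub> N)" "t' \<in> carrier (M \<boxtimes>\<^bsub>S\<^esub> N)"
      and "j (SOME u. u \<in> t) = j (SOME u. u \<in> t')"
    then have "(SOME u. u \<in> t) = (SOME u. u \<in> t')" using j by (simp add: inj_eq)
    then show "t = t'" using coset[OF t(1)] coset[OF t(2)] by simp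
  qed
  then show ?thesis by blast
qed

text \<open>An element is recovered from its graph over the finite support: elsewhere on
  \<open>I\<close> it is zero, and outside \<open>I\<close> it is fixed by extensionality.\<close>

lemma dsum_encoding:
  "\<exists>j :: ('i \<Rightarrow> 'm) \<Rightarrow> ('i \<times> 'm) list. inj_on j (carrier (dsum I M))"
proof -
  let ?supp = "\<lambda>f. {i \<in> I. f i \<noteq> \<zero>\<^bsub>M\<^esub>}"
  define j :: "('i \<Rightarrow> 'm) \<Rightarrow> ('i \<times> 'm) list" where "j f = map (\<lambda>i. (i, f i)) (SOME l. set l = ?supp f)" for f
  have set_j: "set (j f) = (\<lambda>i. (i, f i)) ` ?supp f" if "f \<in> carrier (dsum I M)" for f
    using someI_ex[OF finite_list, of "?supp f"] that by (simp add: j_def dsum_carrier)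
  have "inj_on j (carrier (dsum I M))"
  proof (rule inj_onI)
    fix f g assume fg: "f \<in> carrier (dsum I M)" "g \<in> carrier (dsum I M)" and jfg: "j f = j g"
    have eq: "(\<lambda>i. (i, f i)) ` ?supp f = (\<lambda>i. (i, g i)) ` ?supp g"
      unfolding set_j[OF fg(1), symmetric] set_j[OF fg(2), symmetric] jfg ..
    have "f i = g i" if "i \<in> I" for i
    proof -
      have "(i, f i) \<in> (\<lambda>i. (i, g i)) ` ?supp g \<or> (i, g i) \<in> (\<lambda>i. (i, f i)) ` ?supp f
          \<or> f i = \<zero>\<^bsub>M\<^esub> \<and> g i = \<zero>\<^bsub>M\<^esub>"
        unfolding eq using eq that by blast
      then show ?thesis by auto
    qed
    then show "f = g" using fg by (intro extensionalityI[of f I g]) (auto simp: dsum_carrier PiE_iff)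
  qed
  then show ?thesis by blast
qed

lemma inj_on_compose: "inj_on j X \<Longrightarrow> inj h \<Longrightarrow> inj_on (\<lambda>x. h (j x)) X"
  using comp_inj_on[of j X h] inj_on_subset[of h UNIV] by (simp add: comp_def)

text \<open>An entry of the test type has room for one element of \<open>'a\<close> only, so the two
  components of the pairs go into two consecutive lists. These have equal length, hence the total
  length shows where to split.\<close>

lemma inj_pair_list:
  "inj (\<lambda>l :: ('x \<times> 'x) list. map (\<lambda>p. (undefined, fst p, undefined, 0::nat)) l
      @ map (\<lambda>p. (undefined, snd p, undefined, 0)) l)"
  (is "inj (\<lambda>l. map ?f l @ map ?g l)")
proof (rule injI)
  fix l l' assume eq: "map ?f l @ map ?g l = map ?f l' @ map ?g l'"
  then have "length (map ?f l @ map ?g l) = length (map ?f l' @ map ?g l')" by simp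
  then have len: "length l = length l'" by simp
  with eq have "map ?f l = map ?f l' \<and> map ?g l = map ?g l'"
    by (simp add: append_eq_append_conv)
  with len show "l = l'"
    by (induction l l' rule: list_induct2) (auto simp: prod_eq_iff)
qed

section \<open>Coinvariants, the ring B and the canonical map\<close>

section \<open>Coinvariants and the canonical map\<close>

context grouplike_entwining
begin

abbreviation B where "B \<equiv> coinvariant_ring R A \<mu> \<eta> C \<psi> e"

abbreviation A_reg where "A_reg \<equiv> regular (ring_of R A \<mu> \<eta>)"

abbreviation can_map where "can_map \<equiv> can R A \<mu> \<eta> C \<psi> e"

lemma B_simps [simp]:
  "mult B = mult (ring_of R A \<mu> \<eta>)" "add B = add A" "zero B = zero A" "one B = \<eta> \<one>\<^bsub>R\<^esub>"
  by (simp_all add: coinvariant_ring_def ring_of_def)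

lemma B_carrier: "b \<in> carrier B \<longleftrightarrow> b \<in> carrier A \<and> \<tau> b = pure_tens A R C b e"
  by (simp add: coinvariant_ring_def coinvariants_def)

lemma B_subset: "b \<in> carrier B \<Longrightarrow> b \<in> carrier A"
  by (simp add: B_carrier)

lemma additive_A_reg [simp]: "additive A_reg G f = additive A G f" "additive H A_reg h = additive H A h"
  by (simp_all add: additive_def)

lemma additive_B: "additive G A f \<Longrightarrow> (\<And>x. x \<in> carrier G \<Longrightarrow> f x \<in> carrier B) \<Longrightarrow> additive G B f"
  by (auto simp: additive_def)

lemma pure_e_additive: "additive A (A \<boxtimes>\<^bsub>R\<^esub> C) (\<lambda>a. pure_tens A R C a e)"
  using AC.balanced_pure e_closed by (simp add: balanced_def)

lemma act_left_e: "\<lbrakk>a \<in> carrier A; b \<in> carrier B\<rbrakk> \<Longrightarrow> act_left a (\<tau> b) = pure_tens A R C (a \<star> b) e"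
  using B_carrier e_closed by (simp add: act_left_pure)

lemma act_left_mul:
  assumes "a \<in> carrier A" "b \<in> carrier A" and w: "w \<in> carrier (A \<boxtimes>\<^bsub>R\<^esub> C)"
  shows "act_left (a \<star> b) w = act_left a (act_left b w)"
  by (rule AC.tens_ext[OF act_left_additive additive_comp[OF act_left_additive act_left_additive] _ w])
    (use assms in \<open>simp_all add: act_left_pure mul_assoc\<close>)

text \<open>Since \<tau>(b) = b \<otimes> e, right A-linearity of \<open>\<tau>\<close> gives
  \<tau>(b a) = (b \<otimes> e) a, which is b \<tau>(a). This left B-linearity makes the canonical
  map balanced over \<open>B\<close>, and the case of two coinvariants gives closure under
  products.\<close>

lemma coact_coinvariant_mul:
  assumes "b \<in> carrier B" "a \<in> carrier A"
  shows "\<tau> (b \<star> a) = act_left b (\<tau> a)"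
  using assms act_right_e[OF B_subset[OF assms(1)] assms(2)] coact_mul[of b a] by (simp add: B_carrier)

lemma ring_B: "ring B"
proof -
  interpret AR: ring "ring_of R A \<mu> \<eta>" by (rule ring_ring_of)
  have add: "additive A (A \<boxtimes>\<^bsub>R\<^esub> C) \<tau>" by (rule right_linear_additive[OF coact_linear])
  \<comment> \<open>\<open>psi_unit\<close> at the grouplike element reads \<psi>(e \<otimes> 1) = 1
    \<otimes> e, once the identifications with \<open>R\<close> are evaluated.\<close>
  have "\<eta> \<one>\<^bsub>R\<^esub> \<in> carrier B"
    using psi_unit[OF e_closed]
      tens_map_pure[OF tensor_pairI[OF C(3) C.RR(2)] CA.tensor_pair_axioms right_linear_id(1) eta(1) e_closed]
      tens_map_pure[OF tensor_pairI[OF C.RR(3) C(2)] AC.tensor_pair_axioms eta(2) left_linear_id(1) _ e_closed]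
    by (simp add: B_carrier coact_eq one_closed)
  moreover have "\<zero>\<^bsub>A\<^esub> \<in> carrier B"
    using additive_zero[OF A_group AC_group add] additive_zero[OF A_group AC_group pure_e_additive]
    by (simp add: B_carrier)
  moreover have "\<exists>b'\<in>carrier B. b \<oplus>\<^bsub>A\<^esub> b' = \<zero>\<^bsub>A\<^esub>" "\<exists>b'\<in>carrier B. b' \<oplus>\<^bsub>A\<^esub> b = \<zero>\<^bsub>A\<^esub>"
    if "b \<in> carrier B" for b
    using that additive_minus[OF A_group AC_group add] additive_minus[OF A_group AC_group pure_e_additive]
    by (auto simp: B_carrier A.M.r_neg A.M.l_neg intro!: bexI[of _ "\<ominus>\<^bsub>A\<^esub> b"])
  moreover have "a \<oplus>\<^bsub>A\<^esub> b \<in> carrier B" if "a \<in> carrier B" "b \<in> carrier B" for a b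
    using that additive_add[OF add] additive_add[OF pure_e_additive] by (simp add: B_carrier)
  moreover have "a \<star> b \<in> carrier B" if "a \<in> carrier B" "b \<in> carrier B" for a b
    using coact_coinvariant_mul[OF that(1) B_subset[OF that(2)]] act_left_e[OF B_subset[OF that(1)] that(2)] that
    by (simp add: B_carrier)
  ultimately show ?thesis
    using AR.m_assoc AR.l_distr AR.r_distr AR.l_one AR.r_one A.M.a_assoc A.M.a_comm
    by (intro ringI abelian_groupI monoidI) (auto simp: B_subset)
qed

lemma A_reg_modules: "right_module B A_reg" "left_module B A_reg"
proof -
  interpret R: two_sided "ring_of R A \<mu> \<eta>" A_reg "ring_of R A \<mu> \<eta>"
    by (rule regular_two_sided[OF ring_ring_of])
  interpret B: ring B by (rule ring_B)
  have B: "b \<in> carrier (ring_of R A \<mu> \<eta>)" if "b \<in> carrier B" for b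
    using that by (simp add: B_subset)
  show "right_module B A_reg" "left_module B A_reg"
    by (unfold_locales;
        use B R.ract_closed R.ract_add_left R.ract_add_right R.ract_mult R.ract_one
          R.lact_closed R.lact_add_left R.lact_add_right R.lact_mult R.lact_one in simp)+
qed

sublocale ABA: tensor_pair A_reg B A_reg
  by (rule tensor_pairI[OF A_reg_modules])

lemma can: "additive (A_reg \<boxtimes>\<^bsub>B\<^esub> A_reg) (A \<boxtimes>\<^bsub>R\<^esub> C) can_map"
    "\<lbrakk>a \<in> carrier A; a' \<in> carrier A\<rbrakk> \<Longrightarrow> can_map (pure_tens A_reg B A_reg a a') = act_left a (\<tau> a')"
proof -
  have b: "balanced A_reg B A_reg (A \<boxtimes>\<^bsub>R\<^esub> C) (\<lambda>a a'. act_left a (\<tau> a'))"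
  proof (rule balancedI)
    show "additive A_reg (A \<boxtimes>\<^bsub>R\<^esub> C) (\<lambda>a'. act_left a (\<tau> a'))" if "a \<in> carrier A_reg" for a
      using that additive_comp[OF right_linear_additive[OF coact_linear] act_left_additive] by simp
    show "additive A_reg (A \<boxtimes>\<^bsub>R\<^esub> C) (\<lambda>a. act_left a (\<tau> a'))" if "a' \<in> carrier A_reg" for a'
      using that act_left_additive'[OF coact_closed] by simp
    show "act_left (ract A_reg a b) (\<tau> a') = act_left a (\<tau> (lact A_reg b a'))"
      if "a \<in> carrier A_reg" "b \<in> carrier B" "a' \<in> carrier A_reg" for a b a'
      using that by (simp add: coact_coinvariant_mul act_left_mul B_subset coact_closed)
  qed
  note lift = balanced_lift[OF ABA.tensor_pair_axioms AC_group b]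
  show "additive (A_reg \<boxtimes>\<^bsub>B\<^esub> A_reg) (A \<boxtimes>\<^bsub>R\<^esub> C) can_map"
    unfolding can_def by (rule lift(1))
  show "can_map (pure_tens A_reg B A_reg a a') = act_left a (\<tau> a')" if "a \<in> carrier A" "a' \<in> carrier A"
    unfolding can_def using lift(2)[of a a'] that by simp
qed

section \<open>Dual bases of A over B obtained from colinear maps\<close>

lemma can_injI:
  assumes \<Gamma>: "additive (A \<boxtimes>\<^bsub>R\<^esub> C) (A_reg \<boxtimes>\<^bsub>B\<^esub> A_reg) \<Gamma>"
    and eq: "\<And>a a'. \<lbrakk>a \<in> carrier A; a' \<in> carrier A\<rbrakk> \<Longrightarrow> \<Gamma> (act_left a (\<tau> a')) = pure_tens A_reg B A_reg a a'"
  shows "inj_on can_map (carrier (A_reg \<boxtimes>\<^bsub>B\<^esub> A_reg))"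
proof (rule inj_on_inverseI)
  fix t assume t: "t \<in> carrier (A_reg \<boxtimes>\<^bsub>B\<^esub> A_reg)"
  show "\<Gamma> (can_map t) = t"
    by (rule ABA.tens_ext[OF additive_comp[OF can(1) \<Gamma>] additive_id(1) _ t]) (simp add: can(2) eq)
qed

text \<open>\<open>s x\<close> is the right A-linear extension of a colinear map from
  \<open>C\<close> to \<open>A\<close>, read on A \<otimes> C through \<psi>. The properties listed
  are what remains of its being a morphism of entwined modules: coinvariants go to coinvariants, and
  the values on the image of the canonical map follow by linearity.\<close>

lemma right_dual_basis:
  assumes proj: "projective_right_comodule TYPE(('r, 'a, 'c) test_type) R C \<Delta> \<epsilon> C \<Delta>"
    and surj: "carrier (A \<boxtimes>\<^bsub>R\<^esub> C) \<subseteq> can_map ` carrier (A_reg \<boxtimes>\<^bsub>B\<^esub> A_reg)"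
  obtains s where
    "\<And>x. x \<in> carrier A \<Longrightarrow> additive (A \<boxtimes>\<^bsub>R\<^esub> C) A (s x)"
    "\<And>v. v \<in> carrier (A \<boxtimes>\<^bsub>R\<^esub> C) \<Longrightarrow> fin_supp A (carrier A) (\<lambda>x. s x v)"
    "\<And>x a. \<lbrakk>x \<in> carrier A; a \<in> carrier A\<rbrakk> \<Longrightarrow> s x (pure_tens A R C a e) \<in> carrier B"
    "\<And>x a a'. \<lbrakk>x \<in> carrier A; a \<in> carrier A; a' \<in> carrier A\<rbrakk>
      \<Longrightarrow> s x (act_left a (\<tau> a')) = s x (pure_tens A R C a e) \<star> a'"
    "\<And>a. a \<in> carrier A \<Longrightarrow> fsum A (carrier A) (\<lambda>x. x \<star> s x (pure_tens A R C a e)) = a"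
proof -
  obtain j1 :: "('a \<Rightarrow> 'a) \<Rightarrow> ('a \<times> 'a) list" where j1: "inj_on j1 (carrier (dsum (carrier A) A))"
    using dsum_encoding by blast
  obtain j2 :: "(('a \<times> 'c) \<Rightarrow>\<^sub>0 int) set \<Rightarrow> ('a \<times> 'c \<times> nat) list" where j2: "inj_on j2 (carrier (A \<boxtimes>\<^bsub>R\<^esub> C))"
    using AC.tens_encoding by blast
  \<comment> \<open>The component of the test type that does not occur in A \<otimes> C is filled
    with a constant.\<close>
  have inj: "inj (map (\<lambda>(a, c, n). (undefined :: 'r, a, c, n)) :: ('a \<times> 'c \<times> nat) list \<Rightarrow> ('r, 'a, 'c) test_type)"
    by (rule inj_mapI) (auto simp: inj_def)
  \<comment> \<open>The image of the canonical map is additively generated by the values x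
    \<tau>(a), so its surjectivity becomes the generation hypothesis for the family of left
    multiplications.\<close>
  have gen: "carrier (A \<boxtimes>\<^bsub>R\<^esub> C) \<subseteq> generate (add_monoid (A \<boxtimes>\<^bsub>R\<^esub> C))
      {tens_map A R C (\<lambda>y. x \<star> y) id (\<tau> a) |x a. x \<in> carrier A \<and> a \<in> carrier A}" (is "_ \<subseteq> ?gen")
  proof
    fix v assume "v \<in> carrier (A \<boxtimes>\<^bsub>R\<^esub> C)"
    then obtain t where v: "v = can_map t" and t: "t \<in> carrier (A_reg \<boxtimes>\<^bsub>B\<^esub> A_reg)" using surj by blast
    show "v \<in> ?gen"
      unfolding v using t
    proof (induction t rule: ABA.tens_induct)
      case (pure a a')
      then have a: "a \<in> carrier A" "a' \<in> carrier A" by simp_all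
      then have "act_left a (\<tau> a') \<in> ?gen" by (intro generate.incl) blast
      with a show ?case by (simp only: can(2))
    next
      case (add t t')
      from generate.eng[OF add(3,4)] add(1,2) show ?case by (simp add: additive_add[OF can(1)])
    qed
  qed
  \<comment> \<open>The family lemma is applied to left multiplication by each \<open>x\<close> in
    \<open>A\<close> and to \<eta> \<epsilon>; the injections into the test type supply the
    encodings it asks for.\<close>
  obtain \<sigma> where hom: "\<And>x. x \<in> carrier A \<Longrightarrow> right_comodule_hom R C C \<Delta> A \<tau> (\<sigma> x)"
    and fin: "\<And>c. c \<in> carrier C \<Longrightarrow> fin_supp A (carrier A) (\<lambda>x. \<sigma> x c)"
    and sum: "\<And>c. c \<in> carrier C \<Longrightarrow> fsum A (carrier A) (\<lambda>x. x \<star> \<sigma> x c) = \<eta> (\<epsilon> c)"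
    using C.projective_right_colinear_family[OF proj right_comodule_A A(3)
        inj_on_compose[OF j1 inj_pair_list] inj_on_compose[OF j2 inj] mul_right_linear gen coact_eps(2)]
    by blast
  have \<sigma>: "right_linear R C A (\<sigma> x)" "\<And>c. c \<in> carrier C \<Longrightarrow> \<tau> (\<sigma> x c) = tens_map A R C (\<sigma> x) id (\<Delta> c)"
    if "x \<in> carrier A" for x
    using hom[OF that] by (auto simp: right_comodule_hom_def)
  note \<sigma>_closed = right_linearD(2)[OF \<sigma>(1)]
  \<comment> \<open>The right A-linear extension of \<open>\<sigma> x\<close> from \<open>C\<close>
    to the induced module C \<otimes> A.\<close>
  define m where "m x t = \<mu> (tens_map A R A (\<sigma> x) id t)" for x t
  have m_add: "additive (C \<boxtimes>\<^bsub>R\<^esub> A) A (m x)"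
    and m_pure: "\<And>c a. c \<in> carrier C \<Longrightarrow> a \<in> carrier A \<Longrightarrow> m x (pure_tens C R A c a) = \<sigma> x c \<star> a"
    if x: "x \<in> carrier A" for x
    using tens_map[OF CA.tensor_pair_axioms AA.tensor_pair_axioms \<sigma>(1)[OF x] left_linear_id(1)] additive_comp[OF _ mu(3)]
    by (simp_all add: m_def[abs_def] mul_eq)
  have m_act: "m x (act_CA a t) = m x t \<star> a" if "x \<in> carrier A" "a \<in> carrier A" "t \<in> carrier (C \<boxtimes>\<^bsub>R\<^esub> A)" for x a t
    by (rule CA.tens_ext[OF additive_comp[OF act_CA_additive m_add] additive_comp[OF m_add mul_additive_left] _ that(3)])
      (use that in \<open>simp_all add: act_CA_pure m_pure mul_assoc \<sigma>_closed\<close>)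
  have m_fin: "fin_supp A (carrier A) (\<lambda>x. m x t)" if "t \<in> carrier (C \<boxtimes>\<^bsub>R\<^esub> A)" for t
  proof (rule CA.tens_fin_supp[OF A_group m_add _ that])
    fix c a assume "c \<in> carrier C" "a \<in> carrier A"
    then show "fin_supp A (carrier A) (\<lambda>x. m x (pure_tens C R A c a))"
      by (intro fin_supp_map[OF fin]) (auto simp: m_pure additive_zero[OF A_group A_group mul_additive_left])
  qed
  \<comment> \<open>On pure tensors this is the sum formula for \<open>\<sigma>\<close> multiplied
    by \<open>a\<close> from the right, since \<eta>(\<epsilon>(c)) a is the counit action.\<close>
  have m_sum: "fsum A (carrier A) (\<lambda>x. x \<star> m x t) = eps_A t" if "t \<in> carrier (C \<boxtimes>\<^bsub>R\<^esub> A)" for t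
  proof (rule CA.tens_ext[OF fsum_family_additive[OF CA_group A_group] eps_A(1) _ that])
    show "additive (C \<boxtimes>\<^bsub>R\<^esub> A) A (\<lambda>t. x \<star> m x t)" if "x \<in> carrier A" for x
      by (rule additive_comp[OF m_add[OF that] mul_additive_right[OF that]])
    show "fin_supp A (carrier A) (\<lambda>x. x \<star> m x t)" if "t \<in> carrier (C \<boxtimes>\<^bsub>R\<^esub> A)" for t
      by (rule fin_supp_map[OF m_fin[OF that]]) (simp add: additive_zero[OF A_group A_group mul_additive_right])
  next
    fix c a assume c: "c \<in> carrier C" and a: "a \<in> carrier A"
    have "fsum A (carrier A) (\<lambda>x. x \<star> \<sigma> x c) \<star> a = fsum A (carrier A) (\<lambda>x. x \<star> \<sigma> x c \<star> a)"
      by (rule fsum_additive[OF A_group A_group mul_additive_left[OF a] fin_supp_map[OF fin[OF c]]])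
        (use \<sigma>_closed c in \<open>auto simp: additive_zero[OF A_group A_group mul_additive_right]\<close>)
    also have "\<dots> = fsum A (carrier A) (\<lambda>x. x \<star> m x (pure_tens C R A c a))"
      by (rule A.M.fsum_cong) (use c a \<sigma>_closed in \<open>auto simp: m_pure mul_assoc\<close>)
    finally show "fsum A (carrier A) (\<lambda>x. x \<star> m x (pure_tens C R A c a)) = eps_A (pure_tens C R A c a)"
      using c a left_linearD(2)[OF C.eps(1) c] by (simp add: sum eps_A(2) eta_mul)
  qed
  \<comment> \<open>Extending \<open>\<sigma> x\<close> keeps it colinear, and
    \<open>coact_left a\<close> is the element of C \<otimes> A that corresponds to the coinvariant
    a \<otimes> e.\<close>
  have m_coinv: "m x (coact_left a) \<in> carrier B" if x: "x \<in> carrier A" and a: "a \<in> carrier A" for x a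
  proof -
    interpret CAC: tensor_triple C R A R C by (rule tensor_tripleI[OF C(3) A(1) C(2)])
    interpret CCA: tensor_triple C R C R A by (rule tensor_tripleI[OF C(3) C(1) A(2)])
    \<comment> \<open>\<open>\<Omega>\<close> sends c \<otimes> w to \<sigma>(c) w, with \<sigma>
      short for \<open>\<sigma> x\<close>. It replaces the first leg by its image in
      \<open>A\<close> and multiplies it into the second.\<close>
    define \<Omega> where "\<Omega> = tens_lift (A \<boxtimes>\<^bsub>R\<^esub> C) (\<lambda>c w. act_left (\<sigma> x c) w)"
    have AC: "left_module R (A \<boxtimes>\<^bsub>R\<^esub> C)" using AC_two_sided two_sidedD by blast
    have "balanced C R (A \<boxtimes>\<^bsub>R\<^esub> C) (A \<boxtimes>\<^bsub>R\<^esub> C) (\<lambda>c w. act_left (\<sigma> x c) w)"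
      by (rule balanced_pre[OF balanced_act_left[OF AC left_linear_id(2)] \<sigma>(1)[OF x] left_linear_id(2)])
    note \<Omega> = balanced_lift[OF CAC.X_YZ.tensor_pair_axioms AC_group this, folded \<Omega>_def]
    note C\<psi> = tens_map[OF CCA.X_YZ.tensor_pair_axioms CAC.X_YZ.tensor_pair_axioms right_linear_id(1) psi(1)]
    note \<Delta>A = tens_map[OF CA.tensor_pair_axioms CCA.XYZ.tensor_pair_axioms C.Delta(2) left_linear_id(1)]
    note \<sigma>C = C.right_map_additive[OF C(3) A(3) \<sigma>(1)[OF x]] C.right_map_pure[OF C(3) A(3) \<sigma>(1)[OF x]]
    let ?F = "\<lambda>t. \<Omega> (tens_map C R (A \<boxtimes>\<^bsub>R\<^esub> C) id \<psi> (assoc C R C R A t))"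
    have F: "additive ((C \<boxtimes>\<^bsub>R\<^esub> C) \<boxtimes>\<^bsub>R\<^esub> A) (A \<boxtimes>\<^bsub>R\<^esub> C) ?F"
      by (rule additive_comp[OF additive_comp[OF CCA.assoc_additive C\<psi>(1)] \<Omega>(1)])
    \<comment> \<open>At c \<otimes> c' both sides are \<sigma>(c) \<psi>(c' \<otimes> b).\<close>
    have act: "act_right b (tens_map A R C (\<sigma> x) id d) = ?F (pure_tens (C \<boxtimes>\<^bsub>R\<^esub> C) R A d b)"
      if b: "b \<in> carrier A" and d: "d \<in> carrier (C \<boxtimes>\<^bsub>R\<^esub> C)" for b d
    proof -
      have add: "additive (C \<boxtimes>\<^bsub>R\<^esub> C) ((C \<boxtimes>\<^bsub>R\<^esub> C) \<boxtimes>\<^bsub>R\<^esub> A) (\<lambda>d. pure_tens (C \<boxtimes>\<^bsub>R\<^esub> C) R A d b)"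
        using CCA.XYZ.balanced_pure b by (simp add: balanced_def)
      show ?thesis
        by (rule CCA.XY.tens_ext[OF additive_comp[OF \<sigma>C(1) act_right_additive[OF b]] additive_comp[OF add F] _ d])
          (use b x in \<open>simp add: \<sigma>C(2) act_right_pure \<sigma>_closed CCA.assoc_pure C\<psi>(2) CA.pure_closed \<Omega>(2) psi_closed\<close>)
    qed
    \<comment> \<open>At c \<otimes> a the left side is \<tau>(\<sigma>(c)) acted on by
      \<open>a\<close>, and colinearity of \<open>\<sigma> x\<close> expresses \<tau>(\<sigma>(c))
      through \<Delta>(c).\<close>
    have coact_m: "\<tau> (m x t) = ?F (tens_map (C \<boxtimes>\<^bsub>R\<^esub> C) R A \<Delta> id t)" if t: "t \<in> carrier (C \<boxtimes>\<^bsub>R\<^esub> A)" for t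
      by (rule CA.tens_ext[OF additive_comp[OF m_add[OF x] right_linear_additive[OF coact_linear]] additive_comp[OF \<Delta>A(1) F] _ t])
        (use x in \<open>simp add: m_pure coact_mul \<sigma>_closed \<sigma>(2) act \<Delta>A(2) right_linearD(2)[OF C.Delta(2)]\<close>)
    \<comment> \<open>With \<open>coact_m\<close> this finishes coinvariance: for t =
      \<open>coact_left a\<close>, \<open>Delta_psi_inv\<close> replaces the argument of
      \<open>\<Omega>\<close> by \<open>t\<close> with \<open>e\<close> appended.\<close>
    have \<Omega>_e: "\<Omega> (assoc C R A R C (pure_tens (C \<boxtimes>\<^bsub>R\<^esub> A) R C t e)) = pure_tens A R C (m x t) e"
      if t: "t \<in> carrier (C \<boxtimes>\<^bsub>R\<^esub> A)" for t
    proof -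
      have add: "additive (C \<boxtimes>\<^bsub>R\<^esub> A) ((C \<boxtimes>\<^bsub>R\<^esub> A) \<boxtimes>\<^bsub>R\<^esub> C) (\<lambda>t. pure_tens (C \<boxtimes>\<^bsub>R\<^esub> A) R C t e)"
        using CAC.XYZ.balanced_pure e_closed by (simp add: balanced_def)
      show ?thesis
        by (rule CA.tens_ext[OF additive_comp[OF additive_comp[OF add CAC.assoc_additive] \<Omega>(1)]
              additive_comp[OF m_add[OF x] pure_e_additive] _ t])
          (use x in \<open>simp add: CAC.assoc_pure e_closed AC.pure_closed \<Omega>(2) act_left_pure \<sigma>_closed m_pure\<close>)
    qed
    note t = coact_left_closed[OF a]
    have "\<tau> (m x (coact_left a)) = pure_tens A R C (m x (coact_left a)) e"
      by (simp add: coact_m[OF t] Delta_psi_inv[OF t a psi_coact_left[OF a]] \<Omega>_e[OF t])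
    then show ?thesis using additive_closed[OF m_add[OF x] t] by (simp add: B_carrier)
  qed
  show thesis
  proof (rule that[of "\<lambda>x v. m x (psi_inv v)"])
    show "additive (A \<boxtimes>\<^bsub>R\<^esub> C) A (\<lambda>v. m x (psi_inv v))" if "x \<in> carrier A" for x
      by (rule additive_comp[OF psi_inv_additive m_add[OF that]])
    show "fin_supp A (carrier A) (\<lambda>x. m x (psi_inv v))" if "v \<in> carrier (A \<boxtimes>\<^bsub>R\<^esub> C)" for v
      by (rule m_fin) (simp add: that)
    show "m x (psi_inv (pure_tens A R C a e)) \<in> carrier B" if "x \<in> carrier A" "a \<in> carrier A" for x a
      using m_coinv[OF that] by (simp add: coact_left_def)
    \<comment> \<open>The argument on the left is (a \<otimes> e) a', and both
      \<open>psi_inv\<close> and \<open>m x\<close> are right A-linear.\<close>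
    show "m x (psi_inv (act_left a (\<tau> a'))) = m x (psi_inv (pure_tens A R C a e)) \<star> a'"
      if "x \<in> carrier A" "a \<in> carrier A" "a' \<in> carrier A" for x a a'
      using that psi_inv_act[of a' "pure_tens A R C a e"]
      by (simp add: act_right_e[symmetric] AC.pure_closed e_closed m_act)
    show "fsum A (carrier A) (\<lambda>x. x \<star> m x (psi_inv (pure_tens A R C a e))) = a" if "a \<in> carrier A" for a
      using m_sum[OF coact_left_closed[OF that]] eps_A_coact_left[OF that] by (simp add: coact_left_def)
  qed
qed

text \<open>The extension now takes place on A \<otimes> C itself, as a left A-module induced from
  \<open>C\<close>, so \<open>s x\<close> involves no inverse of \<psi>. The inverse enters through
  the left coaction for which the maps from \<open>C\<close> to \<open>A\<close> are
  colinear.\<close>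

lemma left_dual_basis:
  assumes proj: "projective_left_comodule TYPE(('r, 'a, 'c) test_type) R C \<Delta> \<epsilon> C \<Delta>"
    and surj: "carrier (A \<boxtimes>\<^bsub>R\<^esub> C) \<subseteq> can_map ` carrier (A_reg \<boxtimes>\<^bsub>B\<^esub> A_reg)"
  obtains s where
    "\<And>x. x \<in> carrier A \<Longrightarrow> additive (A \<boxtimes>\<^bsub>R\<^esub> C) A (s x)"
    "\<And>v. v \<in> carrier (A \<boxtimes>\<^bsub>R\<^esub> C) \<Longrightarrow> fin_supp A (carrier A) (\<lambda>x. s x v)"
    "\<And>x a. \<lbrakk>x \<in> carrier A; a \<in> carrier A\<rbrakk> \<Longrightarrow> s x (\<tau> a) \<in> carrier B"
    "\<And>x a a'. \<lbrakk>x \<in> carrier A; a \<in> carrier A; a' \<in> carrier A\<rbrakk>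
      \<Longrightarrow> s x (act_left a (\<tau> a')) = a \<star> s x (\<tau> a')"
    "\<And>a. a \<in> carrier A \<Longrightarrow> fsum A (carrier A) (\<lambda>x. s x (\<tau> a) \<star> x) = a"
proof -
  obtain j1 :: "('a \<Rightarrow> 'a) \<Rightarrow> ('a \<times> 'a) list" where j1: "inj_on j1 (carrier (dsum (carrier A) A))"
    using dsum_encoding by blast
  obtain j2 :: "(('c \<times> 'a) \<Rightarrow>\<^sub>0 int) set \<Rightarrow> ('c \<times> 'a \<times> nat) list" where j2: "inj_on j2 (carrier (C \<boxtimes>\<^bsub>R\<^esub> A))"
    using CA.tens_encoding by blast
  have inj: "inj (map (\<lambda>(c, a, n). (undefined :: 'r, a, c, n)) :: ('c \<times> 'a \<times> nat) list \<Rightarrow> ('r, 'a, 'c) test_type)"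
    by (rule inj_mapI) (auto simp: inj_def)
  \<comment> \<open>The lifting problem lives in C \<otimes> A. \<open>psi_inv\<close> carries the
    value of the canonical map at a \<otimes> x, which is (a \<otimes> e) x, to the left coaction of
    \<open>a\<close> multiplied by \<open>x\<close>.\<close>
  have gen: "carrier (C \<boxtimes>\<^bsub>R\<^esub> A) \<subseteq> generate (add_monoid (C \<boxtimes>\<^bsub>R\<^esub> A))
      {tens_map C R A id (\<lambda>y. y \<star> x) (coact_left a) |x a. x \<in> carrier A \<and> a \<in> carrier A}" (is "_ \<subseteq> ?gen")
  proof
    fix v assume "v \<in> carrier (C \<boxtimes>\<^bsub>R\<^esub> A)"
    then have "\<psi> v \<in> carrier (A \<boxtimes>\<^bsub>R\<^esub> C)" by (rule psi_closed)
    then obtain t where v: "\<psi> v = can_map t" and t: "t \<in> carrier (A_reg \<boxtimes>\<^bsub>B\<^esub> A_reg)" using surj by blast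
    have "psi_inv (can_map t) \<in> ?gen"
      using t
    proof (induction t rule: ABA.tens_induct)
      case (pure a x)
      then have a: "a \<in> carrier A" "x \<in> carrier A" by simp_all
      then have "psi_inv (can_map (pure_tens A_reg B A_reg a x)) = act_CA x (coact_left a)"
        using psi_inv_act[of x "pure_tens A R C a e"]
        by (simp add: can(2) act_right_e[symmetric] AC.pure_closed e_closed coact_left_def)
      moreover have "act_CA x (coact_left a) \<in> ?gen" using a by (intro generate.incl) blast
      ultimately show ?case by (simp only:)
    next
      case (add t t')
      from generate.eng[OF add(3,4)] add(1,2) show ?case
        by (simp add: additive_add[OF can(1)] additive_add[OF psi_inv_additive] additive_closed[OF can(1)])
    qed
    then show "v \<in> ?gen" using v[symmetric] \<open>v \<in> carrier (C \<boxtimes>\<^bsub>R\<^esub> A)\<close> by simp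
  qed
  obtain \<sigma> where hom: "\<And>x. x \<in> carrier A \<Longrightarrow> left_comodule_hom R C C \<Delta> A coact_left (\<sigma> x)"
    and fin: "\<And>c. c \<in> carrier C \<Longrightarrow> fin_supp A (carrier A) (\<lambda>x. \<sigma> x c)"
    and sum: "\<And>c. c \<in> carrier C \<Longrightarrow> fsum A (carrier A) (\<lambda>x. \<sigma> x c \<star> x) = \<eta> (\<epsilon> c)"
    using C.projective_left_colinear_family[OF proj left_comodule_A A(2)
        inj_on_compose[OF j1 inj_pair_list] inj_on_compose[OF j2 inj] mul_left_linear gen coact_eps(1)]
    by blast
  have \<sigma>: "left_linear R C A (\<sigma> x)" "\<And>c. c \<in> carrier C \<Longrightarrow> coact_left (\<sigma> x c) = tens_map C R A id (\<sigma> x) (\<Delta> c)"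
    if "x \<in> carrier A" for x
    using hom[OF that] by (auto simp: left_comodule_hom_def)
  note \<sigma>_closed = left_linearD(2)[OF \<sigma>(1)]
  define s where "s x v = \<mu> (tens_map A R A id (\<sigma> x) v)" for x v
  have s_add: "additive (A \<boxtimes>\<^bsub>R\<^esub> C) A (s x)"
    and s_pure: "\<And>a c. a \<in> carrier A \<Longrightarrow> c \<in> carrier C \<Longrightarrow> s x (pure_tens A R C a c) = a \<star> \<sigma> x c"
    if x: "x \<in> carrier A" for x
    using tens_map[OF AC.tensor_pair_axioms AA.tensor_pair_axioms right_linear_id(1) \<sigma>(1)[OF x]] additive_comp[OF _ mu(3)]
    by (simp_all add: s_def[abs_def] mul_eq)
  have s_act: "s x (act_left a v) = a \<star> s x v" if "x \<in> carrier A" "a \<in> carrier A" "v \<in> carrier (A \<boxtimes>\<^bsub>R\<^esub> C)" for x a v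
    by (rule AC.tens_ext[OF additive_comp[OF act_left_additive s_add] additive_comp[OF s_add mul_additive_right] _ that(3)])
      (use that in \<open>simp_all add: act_left_pure s_pure mul_assoc \<sigma>_closed\<close>)
  have s_fin: "fin_supp A (carrier A) (\<lambda>x. s x v)" if "v \<in> carrier (A \<boxtimes>\<^bsub>R\<^esub> C)" for v
  proof (rule AC.tens_fin_supp[OF A_group s_add _ that])
    fix a c assume "a \<in> carrier A" "c \<in> carrier C"
    then show "fin_supp A (carrier A) (\<lambda>x. s x (pure_tens A R C a c))"
      by (intro fin_supp_map[OF fin]) (auto simp: s_pure additive_zero[OF A_group A_group mul_additive_right])
  qed
  \<comment> \<open>Here the sum formula for \<open>\<sigma>\<close> is multiplied by
    \<open>a\<close> from the left; at v = \<tau>(a) the counit then returns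
    \<open>a\<close>.\<close>
  have s_sum: "fsum A (carrier A) (\<lambda>x. s x v \<star> x) = A_eps v" if "v \<in> carrier (A \<boxtimes>\<^bsub>R\<^esub> C)" for v
  proof (rule AC.tens_ext[OF fsum_family_additive[OF AC_group A_group] A_eps(1) _ that])
    show "additive (A \<boxtimes>\<^bsub>R\<^esub> C) A (\<lambda>v. s x v \<star> x)" if "x \<in> carrier A" for x
      by (rule additive_comp[OF s_add[OF that] mul_additive_left[OF that]])
    show "fin_supp A (carrier A) (\<lambda>x. s x v \<star> x)" if "v \<in> carrier (A \<boxtimes>\<^bsub>R\<^esub> C)" for v
      by (rule fin_supp_map[OF s_fin[OF that]]) (simp add: additive_zero[OF A_group A_group mul_additive_left])
  next
    fix a c assume a: "a \<in> carrier A" and c: "c \<in> carrier C"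
    have "a \<star> fsum A (carrier A) (\<lambda>x. \<sigma> x c \<star> x) = fsum A (carrier A) (\<lambda>x. a \<star> (\<sigma> x c \<star> x))"
      by (rule fsum_additive[OF A_group A_group mul_additive_right[OF a] fin_supp_map[OF fin[OF c]]])
        (use \<sigma>_closed c in \<open>auto simp: additive_zero[OF A_group A_group mul_additive_left]\<close>)
    also have "\<dots> = fsum A (carrier A) (\<lambda>x. s x (pure_tens A R C a c) \<star> x)"
      by (rule A.M.fsum_cong) (use c a \<sigma>_closed in \<open>auto simp: s_pure mul_assoc\<close>)
    finally show "fsum A (carrier A) (\<lambda>x. s x (pure_tens A R C a c) \<star> x) = A_eps (pure_tens A R C a c)"
      using c a left_linearD(2)[OF C.eps(1) c] by (simp add: sum A_eps(2) mul_eta)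
  qed
  \<comment> \<open>Coinvariance comes from coassociativity of \<open>\<tau>\<close> at
    \<open>a\<close>: one map \<open>\<Xi>\<close> is applied to its two sides, and the results are
    the two sides of the claim.\<close>
  have s_coinv: "s x (\<tau> a) \<in> carrier B" if x: "x \<in> carrier A" and a: "a \<in> carrier A" for x a
  proof -
    interpret ACC: tensor_triple A R C R C by (rule tensor_tripleI[OF A(3) C(1) C(2)])
    note \<sigma>C = tens_map_left_linear[OF C(1,2) C(1) A(2) left_linear_id(1) right_linear_id(1) \<sigma>(1)[OF x]]
      C.left_map_pure[OF C(2) A(2) \<sigma>(1)[OF x]]
    \<comment> \<open>With \<sigma> short for \<open>\<sigma> x\<close>, this sends a \<otimes> c
      \<otimes> c' to a \<psi>(c \<otimes> \<sigma>(c')).\<close>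
    define \<Xi> where "\<Xi> = tens_lift (A \<boxtimes>\<^bsub>R\<^esub> C) (\<lambda>a d. act_left a (\<psi> (tens_map C R A id (\<sigma> x) d)))"
    note \<Xi> = balanced_lift[OF ACC.X_YZ.tensor_pair_axioms AC_group
        balanced_act_left[OF C.CC(2) left_linear_comp[OF \<sigma>C(1) psi(1)]], folded \<Xi>_def]
    note A\<Delta> = C.right_Delta_map[OF A(3)]
    note \<tau>C = C.right_map_additive[OF A(3) ACC.XY_right coact_linear] C.right_map_pure[OF A(3) ACC.XY_right coact_linear]
    have \<Xi>_act: "\<Xi> (assoc A R C R C (pure_tens (A \<boxtimes>\<^bsub>R\<^esub> C) R C v c)) = act_right (\<sigma> x c) v"
      if v: "v \<in> carrier (A \<boxtimes>\<^bsub>R\<^esub> C)" and c: "c \<in> carrier C" for v c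
    proof -
      have add: "additive (A \<boxtimes>\<^bsub>R\<^esub> C) ((A \<boxtimes>\<^bsub>R\<^esub> C) \<boxtimes>\<^bsub>R\<^esub> C) (\<lambda>v. pure_tens (A \<boxtimes>\<^bsub>R\<^esub> C) R C v c)"
        using ACC.XYZ.balanced_pure c by (simp add: balanced_def)
      show ?thesis
        by (rule AC.tens_ext[OF additive_comp[OF additive_comp[OF add ACC.assoc_additive] \<Xi>(1)]
              act_right_additive[OF \<sigma>_closed[OF x c]] _ v])
          (use c x in \<open>simp add: ACC.assoc_pure \<Xi>(2) ACC.YZ.pure_closed \<sigma>C(2) act_right_pure \<sigma>_closed\<close>)
    qed
    \<comment> \<open>At a \<otimes> c the left side is \<tau>(a) acted on by \<sigma>(c), that is
      \<tau>(a \<sigma>(c)).\<close>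
    have \<Xi>_coact: "\<Xi> (assoc A R C R C (tens_map (A \<boxtimes>\<^bsub>R\<^esub> C) R C \<tau> id v)) = \<tau> (s x v)"
      if v: "v \<in> carrier (A \<boxtimes>\<^bsub>R\<^esub> C)" for v
      by (rule AC.tens_ext[OF additive_comp[OF additive_comp[OF \<tau>C(1) ACC.assoc_additive] \<Xi>(1)]
            additive_comp[OF s_add[OF x] right_linear_additive[OF coact_linear]] _ v])
        (use x in \<open>simp add: \<tau>C(2) \<Xi>_act coact_closed s_pure coact_mul \<sigma>_closed\<close>)
    \<comment> \<open>Colinearity turns \<Delta>(c) with \<sigma> applied to its second leg into the
      left coaction of \<sigma>(c), and \<psi> sends that to \<sigma>(c) \<otimes> e.\<close>
    have \<Xi>_Delta: "\<Xi> (tens_map A R (C \<boxtimes>\<^bsub>R\<^esub> C) id \<Delta> v) = pure_tens A R C (s x v) e"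
      if v: "v \<in> carrier (A \<boxtimes>\<^bsub>R\<^esub> C)" for v
      by (rule AC.tens_ext[OF additive_comp[OF A\<Delta>(1) \<Xi>(1)] additive_comp[OF s_add[OF x] pure_e_additive] _ v])
        (use x in \<open>simp add: A\<Delta>(2) \<Xi>(2) left_linearD(2)[OF C.Delta(1)] \<sigma>(2)[symmetric] psi_coact_left
            \<sigma>_closed act_left_pure e_closed s_pure\<close>)
    interpret Ac: right_comodule R C \<Delta> \<epsilon> A \<tau> by (rule right_comodule_A)
    have "\<tau> (s x (\<tau> a)) = pure_tens A R C (s x (\<tau> a)) e"
      using \<Xi>_coact[OF coact_closed[OF a]] \<Xi>_Delta[OF coact_closed[OF a]] Ac.coact_coassoc[OF a] by simp
    then show ?thesis using additive_closed[OF s_add[OF x] coact_closed[OF a]] by (simp add: B_carrier)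
  qed
  show thesis
    by (rule that[of s])
      (simp_all add: s_add s_fin s_coinv s_act s_sum coact_closed A_eps_coact)
qed

section \<open>Injectivity of the canonical map and projectivity of A over B\<close>

lemma right_projective_consequences:
  assumes "projective_right_comodule TYPE(('r, 'a, 'c) test_type) R C \<Delta> \<epsilon> C \<Delta>"
    and "carrier (A \<boxtimes>\<^bsub>R\<^esub> C) \<subseteq> can_map ` carrier (A_reg \<boxtimes>\<^bsub>B\<^esub> A_reg)"
  shows can_inj_if_right_projective: "inj_on can_map (carrier (A_reg \<boxtimes>\<^bsub>B\<^esub> A_reg))"
    and projective_right_module_A: "projective_right_module TYPE('u) B A_reg"
proof -
  obtain s where s: "\<And>x. x \<in> carrier A \<Longrightarrow> additive (A \<boxtimes>\<^bsub>R\<^esub> C) A (s x)"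
    and fin: "\<And>v. v \<in> carrier (A \<boxtimes>\<^bsub>R\<^esub> C) \<Longrightarrow> fin_supp A (carrier A) (\<lambda>x. s x v)"
    and sB: "\<And>x a. \<lbrakk>x \<in> carrier A; a \<in> carrier A\<rbrakk> \<Longrightarrow> s x (pure_tens A R C a e) \<in> carrier B"
    and s_can: "\<And>x a a'. \<lbrakk>x \<in> carrier A; a \<in> carrier A; a' \<in> carrier A\<rbrakk>
      \<Longrightarrow> s x (act_left a (\<tau> a')) = s x (pure_tens A R C a e) \<star> a'"
    and sum: "\<And>a. a \<in> carrier A \<Longrightarrow> fsum A (carrier A) (\<lambda>x. x \<star> s x (pure_tens A R C a e)) = a"
    using right_dual_basis[OF assms] by blast
  let ?\<beta> = "\<lambda>x a. s x (pure_tens A R C a e)"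
  have \<beta>_fin: "fin_supp A (carrier A) (\<lambda>x. ?\<beta> x a)" if "a \<in> carrier A" for a
    by (rule fin[OF AC.pure_closed[OF that e_closed]])
  have x\<beta>: "fin_supp A (carrier A) (\<lambda>x. x \<star> ?\<beta> x a)" "(\<lambda>x. x \<star> ?\<beta> x a) \<in> carrier A \<rightarrow> carrier A"
    if "a \<in> carrier A" for a
    using fin_supp_map[OF \<beta>_fin[OF that], of "\<lambda>x. x \<star> ?\<beta> x a" A] sB[OF _ that] B_subset
    by (auto simp: additive_zero[OF A_group A_group mul_additive_right])
  let ?T = "A_reg \<boxtimes>\<^bsub>B\<^esub> A_reg"
  let ?p = "pure_tens A_reg B A_reg"
  note T = ABA.tens_abelian_group(1)
  have p_add: "additive A ?T (?p a)" "additive A ?T (\<lambda>x. ?p x a)" if "a \<in> carrier A" for a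
    using ABA.balanced_pure that by (auto simp: balanced_def)
  show "inj_on can_map (carrier ?T)"
  proof (rule can_injI)
    show "additive (A \<boxtimes>\<^bsub>R\<^esub> C) ?T (\<lambda>v. fsum ?T (carrier A) (\<lambda>x. ?p x (s x v)))"
    proof (rule fsum_family_additive[OF AC_group T])
      show "additive (A \<boxtimes>\<^bsub>R\<^esub> C) ?T (\<lambda>v. ?p x (s x v))" if "x \<in> carrier A" for x
        by (rule additive_comp[OF s[OF that] p_add(1)[OF that]])
      show "fin_supp ?T (carrier A) (\<lambda>x. ?p x (s x v))" if "v \<in> carrier (A \<boxtimes>\<^bsub>R\<^esub> C)" for v
        by (rule fin_supp_map[OF fin[OF that]]) (simp add: additive_zero[OF A_group T p_add(1)])
    qed
    fix a a' assume a: "a \<in> carrier A" "a' \<in> carrier A"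
    have "?p (fsum A (carrier A) (\<lambda>x. x \<star> ?\<beta> x a)) a' = fsum ?T (carrier A) (\<lambda>x. ?p (x \<star> ?\<beta> x a) a')"
      by (rule fsum_additive[OF A_group T p_add(2)[OF a(2)] x\<beta>[OF a(1)]])
    also have "\<dots> = fsum ?T (carrier A) (\<lambda>x. ?p x (s x (act_left a (\<tau> a'))))"
    proof (rule abelian_group.fsum_cong[OF T])
      show "(\<lambda>x. ?p (x \<star> ?\<beta> x a) a') \<in> carrier A \<rightarrow> carrier ?T"
        using x\<beta>(2)[OF a(1)] additive_closed[OF p_add(2)[OF a(2)]] by auto
      \<comment> \<open>The coefficient \<open>?\<beta> x a\<close> lies in \<open>B\<close>, so it
        may cross the tensor sign to the factor \<open>a'\<close>, where \<open>s_can\<close>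
        absorbs it.\<close>
      show "?p (x \<star> ?\<beta> x a) a' = ?p x (s x (act_left a (\<tau> a')))" if "x \<in> carrier A" for x
        using ABA.pure_balanced[of x "?\<beta> x a" a'] that a sB by (simp add: s_can)
    qed
    finally show "fsum ?T (carrier A) (\<lambda>x. ?p x (s x (act_left a (\<tau> a')))) = ?p a a'"
      using a by (simp add: sum)
  qed
  show "projective_right_module TYPE('u) B A_reg"
    unfolding projective_right_module_def
  proof (intro conjI allI impI)
    show "right_module B A_reg" by (rule A_reg_modules)
    fix M N :: "(unit, 'u, 'a) bimod" and p f
    assume M: "right_module B M" and N: "right_module B N"
      and p: "right_linear B M N p" and surj: "p ` carrier M = carrier N" and f: "right_linear B A_reg N f"
    interpret M: right_module B M by fact
    interpret N: right_module B N by fact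
    \<comment> \<open>The dual basis is indexed by all of \<open>A\<close>, so the values
      \<open>f x\<close> are lifted one at a time. Linearity of the lift comes from the
      coefficients, not from the choice of \<open>q\<close>. This lifts along every surjection,
      hence \<open>'u\<close> is arbitrary.\<close>
    have "\<exists>m. m \<in> carrier M \<and> p m = f x" if "x \<in> carrier A" for x
    proof -
      have "f x \<in> p ` carrier M" unfolding surj by (rule right_linearD(2)[OF f]) (simp add: that)
      then show ?thesis by (auto simp: image_iff)
    qed
    then obtain q where q: "\<And>x. x \<in> carrier A \<Longrightarrow> q x \<in> carrier M" "\<And>x. x \<in> carrier A \<Longrightarrow> p (q x) = f x"
      by metis
    let ?h = "\<lambda>x a. ract M (q x) (?\<beta> x a)"
    define g where "g a = fsum M (carrier A) (\<lambda>x. ?h x a)" for a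
    have \<beta>_add: "additive A B (?\<beta> x)" if "x \<in> carrier A" for x
      by (rule additive_B[OF additive_comp[OF pure_e_additive s[OF that]] sB[OF that]])
    have h_add: "additive A M (?h x)" if "x \<in> carrier A" for x
      by (rule additive_comp[OF \<beta>_add[OF that] additive_ract'[OF M q(1)[OF that]]])
    have B_group: "abelian_group B" using ring_B by (rule ring.is_abelian_group)
    have h_fin: "fin_supp M (carrier A) (\<lambda>x. ?h x a)" if "a \<in> carrier A" for a
      by (rule fin_supp_map[OF \<beta>_fin[OF that]])
        (use additive_zero[OF B_group M.M.abelian_group_axioms additive_ract'[OF M q(1)]] in simp)
    have h_closed: "(\<lambda>x. ?h x a) \<in> carrier A \<rightarrow> carrier M" if "a \<in> carrier A" for a
      using additive_closed[OF h_add that] by auto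
    have g_add: "additive A M g"
      unfolding g_def by (rule fsum_family_additive[OF A_group M.M.abelian_group_axioms h_add h_fin])
    \<comment> \<open>For \<open>b\<close> in \<open>B\<close> the value of the canonical map at a
      \<otimes> b is ab \<otimes> e, so \<open>s_can\<close> yields right B-linearity of each
      coefficient \<open>?\<beta> x\<close>.\<close>
    have "g (a \<star> b) = ract M (g a) b" if a: "a \<in> carrier A" and b: "b \<in> carrier B" for a b
    proof -
      have "ract M (g a) b = fsum M (carrier A) (\<lambda>x. ract M (?h x a) b)"
        unfolding g_def
        by (rule fsum_additive[OF M.M.abelian_group_axioms M.M.abelian_group_axioms additive_ract[OF M b] h_fin[OF a] h_closed[OF a]])
      also have "\<dots> = g (a \<star> b)"
        unfolding g_def
      proof (rule M.M.fsum_cong)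
        show "(\<lambda>x. ract M (?h x a) b) \<in> carrier A \<rightarrow> carrier M"
          using h_closed[OF a] M.ract_closed[OF b] by auto
        show "ract M (?h x a) b = ?h x (a \<star> b)" if "x \<in> carrier A" for x
          using s_can[OF that a B_subset[OF b]] M.ract_mult[OF sB[OF that a] b q(1)[OF that]]
          by (simp add: act_left_e[OF a b])
      qed
      finally show ?thesis by simp
    qed
    with g_add have "right_linear B A_reg M g" by (simp add: right_linear_iff)
    \<comment> \<open>By linearity p(g(a)) is the sum of the f(x) \<beta>_x(a), which is
      \<open>f\<close> of the expansion of \<open>a\<close> in the dual basis.\<close>
    moreover have "p (g a) = f a" if a: "a \<in> carrier A" for a
    proof -
      have f_add: "additive A N f" using right_linear_additive[OF f] by simp
      have "p (g a) = fsum N (carrier A) (\<lambda>x. p (?h x a))"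
        unfolding g_def
        by (rule fsum_additive[OF M.M.abelian_group_axioms N.M.abelian_group_axioms right_linear_additive[OF p] h_fin[OF a] h_closed[OF a]])
      also have "\<dots> = fsum N (carrier A) (\<lambda>x. f (x \<star> ?\<beta> x a))"
      proof (rule N.M.fsum_cong)
        show "(\<lambda>x. p (?h x a)) \<in> carrier A \<rightarrow> carrier N"
          using h_closed[OF a] right_linearD(2)[OF p] by auto
        show "p (?h x a) = f (x \<star> ?\<beta> x a)" if "x \<in> carrier A" for x
          using p f q that sB[OF that a] by (simp add: right_linear_def)
      qed
      also have "\<dots> = f a"
        using fsum_additive[OF A_group N.M.abelian_group_axioms f_add x\<beta>[OF a]] sum[OF a] by simp
      finally show ?thesis .
    qed
    ultimately show "\<exists>g. right_linear B A_reg M g \<and> (\<forall>x\<in>carrier A_reg. p (g x) = f x)"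
      by auto
  qed
qed

text \<open>The coefficients now stand to the left of the basis elements. In the inverse of the
  canonical map they cross from the second factor over \<open>B\<close> to the first.\<close>

lemma left_projective_consequences:
  assumes "projective_left_comodule TYPE(('r, 'a, 'c) test_type) R C \<Delta> \<epsilon> C \<Delta>"
    and "carrier (A \<boxtimes>\<^bsub>R\<^esub> C) \<subseteq> can_map ` carrier (A_reg \<boxtimes>\<^bsub>B\<^esub> A_reg)"
  shows can_inj_if_left_projective: "inj_on can_map (carrier (A_reg \<boxtimes>\<^bsub>B\<^esub> A_reg))"
    and projective_left_module_A: "projective_left_module TYPE('u) B A_reg"
proof -
  obtain s where s: "\<And>x. x \<in> carrier A \<Longrightarrow> additive (A \<boxtimes>\<^bsub>R\<^esub> C) A (s x)"
    and fin: "\<And>v. v \<in> carrier (A \<boxtimes>\<^bsub>R\<^esub> C) \<Longrightarrow> fin_supp A (carrier A) (\<lambda>x. s x v)"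
    and sB: "\<And>x a. \<lbrakk>x \<in> carrier A; a \<in> carrier A\<rbrakk> \<Longrightarrow> s x (\<tau> a) \<in> carrier B"
    and s_can: "\<And>x a a'. \<lbrakk>x \<in> carrier A; a \<in> carrier A; a' \<in> carrier A\<rbrakk>
      \<Longrightarrow> s x (act_left a (\<tau> a')) = a \<star> s x (\<tau> a')"
    and sum: "\<And>a. a \<in> carrier A \<Longrightarrow> fsum A (carrier A) (\<lambda>x. s x (\<tau> a) \<star> x) = a"
    using left_dual_basis[OF assms] by blast
  let ?\<beta> = "\<lambda>x a. s x (\<tau> a)"
  have \<beta>_fin: "fin_supp A (carrier A) (\<lambda>x. ?\<beta> x a)" if "a \<in> carrier A" for a
    by (rule fin[OF coact_closed[OF that]])
  have \<beta>x: "fin_supp A (carrier A) (\<lambda>x. ?\<beta> x a \<star> x)" "(\<lambda>x. ?\<beta> x a \<star> x) \<in> carrier A \<rightarrow> carrier A"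
    if "a \<in> carrier A" for a
    using fin_supp_map[OF \<beta>_fin[OF that], of "\<lambda>x. ?\<beta> x a \<star> x" A] sB[OF _ that] B_subset
    by (auto simp: additive_zero[OF A_group A_group mul_additive_left])
  let ?T = "A_reg \<boxtimes>\<^bsub>B\<^esub> A_reg"
  let ?p = "pure_tens A_reg B A_reg"
  note T = ABA.tens_abelian_group(1)
  have p_add: "additive A ?T (?p a)" "additive A ?T (\<lambda>x. ?p x a)" if "a \<in> carrier A" for a
    using ABA.balanced_pure that by (auto simp: balanced_def)
  show "inj_on can_map (carrier ?T)"
  proof (rule can_injI)
    show "additive (A \<boxtimes>\<^bsub>R\<^esub> C) ?T (\<lambda>v. fsum ?T (carrier A) (\<lambda>x. ?p (s x v) x))"
    proof (rule fsum_family_additive[OF AC_group T])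
      show "additive (A \<boxtimes>\<^bsub>R\<^esub> C) ?T (\<lambda>v. ?p (s x v) x)" if "x \<in> carrier A" for x
        by (rule additive_comp[OF s[OF that] p_add(2)[OF that]])
      show "fin_supp ?T (carrier A) (\<lambda>x. ?p (s x v) x)" if "v \<in> carrier (A \<boxtimes>\<^bsub>R\<^esub> C)" for v
        by (rule fin_supp_map[OF fin[OF that]]) (simp add: additive_zero[OF A_group T p_add(2)])
    qed
    fix a a' assume a: "a \<in> carrier A" "a' \<in> carrier A"
    have "?p a (fsum A (carrier A) (\<lambda>x. ?\<beta> x a' \<star> x)) = fsum ?T (carrier A) (\<lambda>x. ?p a (?\<beta> x a' \<star> x))"
      by (rule fsum_additive[OF A_group T p_add(1)[OF a(1)] \<beta>x[OF a(2)]])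
    also have "\<dots> = fsum ?T (carrier A) (\<lambda>x. ?p (s x (act_left a (\<tau> a'))) x)"
    proof (rule abelian_group.fsum_cong[OF T])
      show "(\<lambda>x. ?p a (?\<beta> x a' \<star> x)) \<in> carrier A \<rightarrow> carrier ?T"
        using \<beta>x(2)[OF a(2)] additive_closed[OF p_add(1)[OF a(1)]] by auto
      show "?p a (?\<beta> x a' \<star> x) = ?p (s x (act_left a (\<tau> a'))) x" if "x \<in> carrier A" for x
        using ABA.pure_balanced[of a "?\<beta> x a'" x] that a sB by (simp add: s_can)
    qed
    finally show "fsum ?T (carrier A) (\<lambda>x. ?p (s x (act_left a (\<tau> a'))) x) = ?p a a'"
      using a by (simp add: sum)
  qed
  show "projective_left_module TYPE('u) B A_reg"
    unfolding projective_left_module_def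
  proof (intro conjI allI impI)
    show "left_module B A_reg" by (rule A_reg_modules)
    fix M N :: "('a, 'u, unit) bimod" and p f
    assume M: "left_module B M" and N: "left_module B N"
      and p: "left_linear B M N p" and surj: "p ` carrier M = carrier N" and f: "left_linear B A_reg N f"
    interpret M: left_module B M by fact
    interpret N: left_module B N by fact
    have "\<exists>m. m \<in> carrier M \<and> p m = f x" if "x \<in> carrier A" for x
    proof -
      have "f x \<in> p ` carrier M" unfolding surj by (rule left_linearD(2)[OF f]) (simp add: that)
      then show ?thesis by (auto simp: image_iff)
    qed
    then obtain q where q: "\<And>x. x \<in> carrier A \<Longrightarrow> q x \<in> carrier M" "\<And>x. x \<in> carrier A \<Longrightarrow> p (q x) = f x"
      by metis
    let ?h = "\<lambda>x a. lact M (?\<beta> x a) (q x)"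
    define g where "g a = fsum M (carrier A) (\<lambda>x. ?h x a)" for a
    have \<beta>_add: "additive A B (?\<beta> x)" if "x \<in> carrier A" for x
      by (rule additive_B[OF additive_comp[OF right_linear_additive[OF coact_linear] s[OF that]] sB[OF that]])
    have h_add: "additive A M (?h x)" if "x \<in> carrier A" for x
      by (rule additive_comp[OF \<beta>_add[OF that] additive_lact'[OF M q(1)[OF that]]])
    have B_group: "abelian_group B" using ring_B by (rule ring.is_abelian_group)
    have h_fin: "fin_supp M (carrier A) (\<lambda>x. ?h x a)" if "a \<in> carrier A" for a
      by (rule fin_supp_map[OF \<beta>_fin[OF that]])
        (use additive_zero[OF B_group M.M.abelian_group_axioms additive_lact'[OF M q(1)]] in simp)
    have h_closed: "(\<lambda>x. ?h x a) \<in> carrier A \<rightarrow> carrier M" if "a \<in> carrier A" for a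
      using additive_closed[OF h_add that] by auto
    have g_add: "additive A M g"
      unfolding g_def by (rule fsum_family_additive[OF A_group M.M.abelian_group_axioms h_add h_fin])
    \<comment> \<open>\<open>\<tau>\<close> is left B-linear and \<open>s x\<close> is left A-linear
      on values of the canonical map, so each coefficient \<open>?\<beta> x\<close> is left
      B-linear.\<close>
    have "g (b \<star> a) = lact M b (g a)" if a: "a \<in> carrier A" and b: "b \<in> carrier B" for a b
    proof -
      have "lact M b (g a) = fsum M (carrier A) (\<lambda>x. lact M b (?h x a))"
        unfolding g_def
        by (rule fsum_additive[OF M.M.abelian_group_axioms M.M.abelian_group_axioms additive_lact[OF M b] h_fin[OF a] h_closed[OF a]])
      also have "\<dots> = g (b \<star> a)"
        unfolding g_def
      proof (rule M.M.fsum_cong)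
        show "(\<lambda>x. lact M b (?h x a)) \<in> carrier A \<rightarrow> carrier M"
          using h_closed[OF a] M.lact_closed[OF b] by auto
        show "lact M b (?h x a) = ?h x (b \<star> a)" if "x \<in> carrier A" for x
          using s_can[OF that B_subset[OF b] a] M.lact_mult[OF b sB[OF that a] q(1)[OF that]]
          by (simp add: coact_coinvariant_mul[OF b a])
      qed
      finally show ?thesis by simp
    qed
    with g_add have "left_linear B A_reg M g" by (simp add: left_linear_iff)
    moreover have "p (g a) = f a" if a: "a \<in> carrier A" for a
    proof -
      have f_add: "additive A N f" using left_linear_additive[OF f] by simp
      have "p (g a) = fsum N (carrier A) (\<lambda>x. p (?h x a))"
        unfolding g_def
        by (rule fsum_additive[OF M.M.abelian_group_axioms N.M.abelian_group_axioms left_linear_additive[OF p] h_fin[OF a] h_closed[OF a]])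
      also have "\<dots> = fsum N (carrier A) (\<lambda>x. f (?\<beta> x a \<star> x))"
      proof (rule N.M.fsum_cong)
        show "(\<lambda>x. p (?h x a)) \<in> carrier A \<rightarrow> carrier N"
          using h_closed[OF a] left_linearD(2)[OF p] by auto
        show "p (?h x a) = f (?\<beta> x a \<star> x)" if "x \<in> carrier A" for x
          using p f q that sB[OF that a] by (simp add: left_linear_def)
      qed
      also have "\<dots> = f a"
        using fsum_additive[OF A_group N.M.abelian_group_axioms f_add \<beta>x[OF a]] sum[OF a] by simp
      finally show ?thesis .
    qed
    ultimately show "\<exists>g. left_linear B A_reg M g \<and> (\<forall>x\<in>carrier A_reg. p (g x) = f x)"
      by auto
  qed
qed

end

theorem proposition4p2:
  fixes k :: "'k ring"
    and R :: "('k, 'r) module"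
    and A :: "('r, 'a, 'r) bimod"
    and \<mu> :: "(('a \<times> 'a) \<Rightarrow>\<^sub>0 int) set \<Rightarrow> 'a"
    and \<eta> :: "'r \<Rightarrow> 'a"
    and C :: "('r, 'c, 'r) bimod"
    and \<Delta> :: "'c \<Rightarrow> (('c \<times> 'c) \<Rightarrow>\<^sub>0 int) set"
    and \<epsilon> :: "'c \<Rightarrow> 'r"
    and \<psi> :: "(('c \<times> 'a) \<Rightarrow>\<^sub>0 int) set \<Rightarrow> (('a \<times> 'c) \<Rightarrow>\<^sub>0 int) set"
    and e :: 'c
    and B :: "('r, 'a, 'r) bimod"
    and A_reg :: "('a, 'a, 'a) bimod"
  assumes "unital_algebra k R"
    and "bijective_entwining k R A \<mu> \<eta> C \<Delta> \<epsilon> \<psi>"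
    and "grouplike R C \<Delta> \<epsilon> e"
    and B_eq: "B = coinvariant_ring R A \<mu> \<eta> C \<psi> e"
    and A_reg_eq: "A_reg = regular (ring_of R A \<mu> \<eta>)"
  shows
    "(flat_left_module TYPE(('r, 'a, 'c) test_type) R C \<and>
      projective_right_comodule TYPE(('r, 'a, 'c) test_type) R C \<Delta> \<epsilon> C \<Delta> \<longrightarrow>
        (coinvariants_tensor_condition k R A C \<psi> e \<and>
         can R A \<mu> \<eta> C \<psi> e ` carrier (A_reg \<boxtimes>\<^bsub>B\<^esub> A_reg) = carrier (A \<boxtimes>\<^bsub>R\<^esub> C) \<longrightarrow>
         bij_betw (can R A \<mu> \<eta> C \<psi> e) (carrier (A_reg \<boxtimes>\<^bsub>B\<^esub> A_reg)) (carrier (A \<boxtimes>\<^bsub>R\<^esub> C))) \<and>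
        (bij_betw (can R A \<mu> \<eta> C \<psi> e) (carrier (A_reg \<boxtimes>\<^bsub>B\<^esub> A_reg)) (carrier (A \<boxtimes>\<^bsub>R\<^esub> C)) \<longrightarrow>
         projective_right_module TYPE('u) B A_reg)) \<and>
     (flat_right_module TYPE(('r, 'a, 'c) test_type) R C \<and>
      projective_left_comodule TYPE(('r, 'a, 'c) test_type) R C \<Delta> \<epsilon> C \<Delta> \<longrightarrow>
        (coinvariants_tensor_condition k R A C \<psi> e \<and>
         can R A \<mu> \<eta> C \<psi> e ` carrier (A_reg \<boxtimes>\<^bsub>B\<^esub> A_reg) = carrier (A \<boxtimes>\<^bsub>R\<^esub> C) \<longrightarrow>
         bij_betw (can R A \<mu> \<eta> C \<psi> e) (carrier (A_reg \<boxtimes>\<^bsub>B\<^esub> A_reg)) (carrier (A \<boxtimes>\<^bsub>R\<^esub> C))) \<and>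
        (bij_betw (can R A \<mu> \<eta> C \<psi> e) (carrier (A_reg \<boxtimes>\<^bsub>B\<^esub> A_reg)) (carrier (A \<boxtimes>\<^bsub>R\<^esub> C)) \<longrightarrow>
         projective_left_module TYPE('u) B A_reg))"
proof -
  interpret grouplike_entwining k R A \<mu> \<eta> C \<Delta> \<epsilon> \<psi> e
    using assms(2,3)
    by (simp add: grouplike_entwining_def grouplike_entwining_axioms_def bijective_entwining_def grouplike_def)
  \<comment> \<open>Bijectivity unfolds into injectivity and an image equation. In part (1) the
    image equation is assumed, in part (2) it is taken from the bijectivity hypothesis; in both it
    provides the surjectivity from which the dual basis is built.\<close>
  show ?thesis
    unfolding B_eq A_reg_eq bij_betw_def
    by (intro conjI impI; elim conjE;
        (assumption | rule can_inj_if_right_projective projective_right_module_A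
          can_inj_if_left_projective projective_left_module_A; (assumption | erule equalityD2)))
qed

end
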